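(* Let $\Sigma$ be a signed graph, $\mathbb A$ an abelian group, and $B$ a canonical base of $\Sigma$, with complement $B^c=E\setminus B$. Then $${\rm F}(\Sigma,\mathbb A)=\Big(\bigoplus_{\rho}{\rm Tor}_2(\mathbb A)\cdot{\bf 1}_{\omega(C_\rho)}\Big)\oplus\Big(\bigoplus_{e\in B^c}\mathbb A\cdot{\bf I}_{\omega(C_e)}\Big)\cong({\rm Tor}_2\mathbb A)^{u_c(\Sigma)}\oplus\mathbb A^{{\rm cr}(\Sigma)},$$ where $C_\rho$ ranges over all negative circles contained in $B$, $\omega(C_\rho)$ is any orientation of $C_\rho$, $C_e=C(B,e)$ is the unique signed-graph circuit contained in $B\cup e$, $\omega(C_e)$ is a direction of $C_e$, and ${\rm cr}(\Sigma)=|B^c|$.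
   Context: A graph $(V,E)$ has finite vertex set $V$ and finite edge set $E$ (multiple edges allowed); each edge has two ends, each end is attached to one vertex or to none, and at least one end is attached to a vertex. A loop has both ends at the same vertex, a link has its ends at two distinct vertices, an outer-edge has exactly one end attached to a vertex. A signed graph $\Sigma=(V,E,\sigma)$ is a graph with a sign function $\sigma:E\to\{1,-1\}$. A circle is a connected 2-regular signed (sub)graph without outer-edges (a loop with its vertex is a circle); its sign is the product of its edge signs. A signed graph is balanced if it has no outer-edges and all its circles are positive; otherwise unbalanced. $b(\Sigma)$ is the number of balanced components, $u_c(\Sigma)$ the number of unbalanced components without outer-edges, and ${\rm cr}(\Sigma)=|E|-|V|+b(\Sigma)$. ${\rm Tor}_2(\mathbb A)=\{a\in\mathbb A:2a=0\}$. Each edge $e$ has exactly two orientations (arcs) $\vec e$ and $\vec e^{\,-1}$: an orientation puts an arrow on each of the two ends of $e$, with the same direction along $e$ if $e$ is positive and opposite directions if $e$ is negative; $\vec e^{\,-1}$ reverses both arrows. $\vec E$ is the set of all arcs. $[v,\vec e\,]$ is $1$ (resp. $-1$) if $\vec e$ is a non-loop arc at $v$ whose arrow at $v$ points to (resp. away from) $v$; $2$ (resp. $-2$) if $\vec e$ is a negative loop at $v$ pointing to (resp. away from) $v$; $0$ otherwise. A 1-chain over $\mathbb A$ is a function ${\bf c}:\vec E\to\mathbb A$ with ${\bf c}(\vec e^{\,-1})=-{\bf c}(\vec e\,)$. The flow group ${\rm F}(\Sigma,\mathbb A)$ is the group of 1-chains (flows) with $\sum_{e\in E}[v,\vec e\,]{\bf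 c}(\vec e\,)=0$ for all $v\in V$. An orientation $\omega(S)$ of an edge set $S$ is a choice of one arc for each edge of $S$; ${\bf 1}_{\omega(S)}$ is the integer 1-chain equal to $1$ on arcs of $\omega(S)$ and $0$ on edges outside $S$. For a subgroup $H\le\mathbb A$ and an integer 1-chain ${\bf c}$, $H\cdot{\bf c}=\{a\cdot{\bf c}:a\in H\}$. A (signed-graph) circuit is a connected signed graph $C$ whose edge set is nonempty and minimal admitting a nowhere-zero real (equivalently integer) flow. The circuits are: (C1) open lines (connected 2-regular signed graphs with exactly two outer-edges); (C2) positive circles; (C3) unions of two edge-disjoint negative circles meeting at exactly one vertex; (C4) unions of a negative circle $C_1$ and a half-line $H$ meeting exactly at the endpoint of $H$ (a half-line is a connected signed graph with exactly one outer-edge, degree 1 at one vertex, its endpoint, and degree 2 at all other vertices; an outer-edge with its endpoint is a half-line); (C5) unions of two disjoint negative circles $C_1,C_2$ and a line segment $P$ (a path with at least one edge and two distinct endpoints) meeting each $C_i$ exactly at one of its endpoints. Edges of $H$ in (C4) and of $P$ in (C5) are double edges, all other edges of circuits are single. A direction $\omega(C)$ of a circuit $C$ is $\{\vec e:{\bf c}(\vec e\,)>0\}$ for a nowhere-zero integer flow ${\bf c}$ on $C$. ${\bf I}_{\omega(C)}$ is the integer flow equal to $1$ on arcs of $\omega(C)$ of single edges, $2$ on arcs of $\omega(C)$ of double edges, and $0$ on edges outside $C$. Canonical base: for each connected component $\Sigma_i$ of $\Sigma$ choose a spanning tree $T_i$ of $\Sigma_i$ with outer-edges removed. If $\Sigma_i$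 is balanced let $B_i=T_i$. If $\Sigma_i$ has outer-edges let $B_i=T_i\cup e_i$ with $e_i$ an outer-edge of $\Sigma_i$. If $\Sigma_i$ is unbalanced without outer-edges let $B_i=T_i\cup e_i$ with $e_i$ an edge such that the unique circle in $T_i\cup e_i$ is negative. Then $B=\bigcup_iB_i$ is called a canonical base. For each $e\in B^c$ there is a unique circuit $C(B,e)$ contained in $B\cup e$. *)

theory Defs
  imports "HOL-Algebra.Product_Groups" "HOL-Algebra.FiniteProduct"
begin

section \<open>Signed graphs\<close>

text \<open>Every edge has two ends, named by the two Booleans; \<open>att \<Sigma> e i\<close> is the vertex to which
  end \<open>i\<close> of \<open>e\<close> is attached, or \<open>None\<close> if that end is attached to no vertex.\<close>

record ('v, 'e) sgraph =
  verts :: "'v set"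
  edges :: "'e set"
  att   :: "'e \<Rightarrow> bool \<Rightarrow> 'v option"
  esign :: "'e \<Rightarrow> int"

locale signed_graph =
  fixes \<Sigma> :: "('v, 'e) sgraph"
  assumes finite_verts: "finite (verts \<Sigma>)"
    and finite_edges: "finite (edges \<Sigma>)"
    and att_verts: "\<lbrakk>e \<in> edges \<Sigma>; att \<Sigma> e i = Some v\<rbrakk> \<Longrightarrow> v \<in> verts \<Sigma>"
    and att_some: "e \<in> edges \<Sigma> \<Longrightarrow> \<exists>i. att \<Sigma> e i \<noteq> None"
    and esign_cases: "e \<in> edges \<Sigma> \<Longrightarrow> esign \<Sigma> e = 1 \<or> esign \<Sigma> e = - 1"

definition loop_at :: "('v, 'e) sgraph \<Rightarrow> 'e \<Rightarrow> 'v \<Rightarrow> bool" where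
  "loop_at \<Sigma> e v \<longleftrightarrow> (\<forall>i. att \<Sigma> e i = Some v)"

text \<open>For edges of a signed graph at most one end is unattached.\<close>

definition outer_edge :: "('v, 'e) sgraph \<Rightarrow> 'e \<Rightarrow> bool" where
  "outer_edge \<Sigma> e \<longleftrightarrow> (\<exists>!i. att \<Sigma> e i = None)"

definition outer_edges :: "('v, 'e) sgraph \<Rightarrow> 'e set" where
  "outer_edges \<Sigma> = {e \<in> edges \<Sigma>. outer_edge \<Sigma> e}"

text \<open>The degree counts edge ends, so that a loop contributes 2 and an outer-edge 1.\<close>

definition vdegree :: "('v, 'e) sgraph \<Rightarrow> 'v \<Rightarrow> nat" where
  "vdegree \<Sigma> v = card {(e, i). e \<in> edges \<Sigma> \<and> att \<Sigma> e i = Some v}"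

definition adjacency :: "('v, 'e) sgraph \<Rightarrow> ('v \<times> 'v) set" where
  "adjacency \<Sigma> = {(u, v). \<exists>e \<in> edges \<Sigma>. \<exists>i. att \<Sigma> e i = Some u \<and> att \<Sigma> e (\<not> i) = Some v}"

definition connection :: "('v, 'e) sgraph \<Rightarrow> ('v \<times> 'v) set" where
  "connection \<Sigma> = (adjacency \<Sigma>)\<^sup>* \<inter> verts \<Sigma> \<times> verts \<Sigma>"

definition sconnected :: "('v, 'e) sgraph \<Rightarrow> bool" where
  "sconnected \<Sigma> \<longleftrightarrow> verts \<Sigma> \<noteq> {} \<and> connection \<Sigma> = verts \<Sigma> \<times> verts \<Sigma>"

definition components :: "('v, 'e) sgraph \<Rightarrow> ('v, 'e) sgraph set" where
  "components \<Sigma> =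
     (\<lambda>W. \<Sigma>\<lparr>verts := W, edges := {e \<in> edges \<Sigma>. \<exists>i. \<exists>v \<in> W. att \<Sigma> e i = Some v}\<rparr>)
       ` (verts \<Sigma> // connection \<Sigma>)"

text \<open>The subgraph formed by the edges in \<open>S\<close> and the vertices to which they are attached. Circles,
  lines and circuits have no isolated vertices, so they are given by their edge sets.\<close>

definition subgr :: "('v, 'e) sgraph \<Rightarrow> 'e set \<Rightarrow> ('v, 'e) sgraph" where
  "subgr \<Sigma> S = \<Sigma>\<lparr>verts := {v. \<exists>e \<in> S. \<exists>i. att \<Sigma> e i = Some v}, edges := S\<rparr>"

definition is_circle :: "('v, 'e) sgraph \<Rightarrow> bool" where
  "is_circle \<Gamma> \<longleftrightarrow> sconnected \<Gamma> \<and> outer_edges \<Gamma> = {} \<and> (\<forall>v \<in> verts \<Gamma>. vdegree \<Gamma> v = 2)"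

definition circles :: "('v, 'e) sgraph \<Rightarrow> 'e set set" where
  "circles \<Sigma> = {S. S \<subseteq> edges \<Sigma> \<and> is_circle (subgr \<Sigma> S)}"

definition negative_circles :: "('v, 'e) sgraph \<Rightarrow> 'e set set" where
  "negative_circles \<Sigma> = {S \<in> circles \<Sigma>. (\<Prod>e\<in>S. esign \<Sigma> e) = - 1}"

definition balanced :: "('v, 'e) sgraph \<Rightarrow> bool" where
  "balanced \<Sigma> \<longleftrightarrow> outer_edges \<Sigma> = {} \<and> (\<forall>S \<in> circles \<Sigma>. (\<Prod>e\<in>S. esign \<Sigma> e) = 1)"

definition num_balanced :: "('v, 'e) sgraph \<Rightarrow> nat" where
  "num_balanced \<Sigma> = card {\<Gamma> \<in> components \<Sigma>. balanced \<Gamma>}"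

definition u_c :: "('v, 'e) sgraph \<Rightarrow> nat" where
  "u_c \<Sigma> = card {\<Gamma> \<in> components \<Sigma>. \<not> balanced \<Gamma> \<and> outer_edges \<Gamma> = {}}"

definition cr :: "('v, 'e) sgraph \<Rightarrow> int" where
  "cr \<Sigma> = int (card (edges \<Sigma>)) - int (card (verts \<Sigma>)) + int (num_balanced \<Sigma>)"


section \<open>Arcs, chains and flows\<close>

text \<open>An arc is an edge together with an arrow on each of its ends: \<open>1\<close> if the arrow at that end
  points out of the edge (towards the vertex, if the end is attached to one), \<open>-1\<close> if it points
  into the edge. The two arrows have the same direction along the edge iff these numbers differ.\<close>

type_synonym 'e arc = "'e \<times> (bool \<Rightarrow> int)"

definition arcs :: "('v, 'e) sgraph \<Rightarrow> 'e arc set" where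
  "arcs \<Sigma> = {(e, t). e \<in> edges \<Sigma> \<and> (\<forall>i. t i = 1 \<or> t i = - 1) \<and>
     (if esign \<Sigma> e = 1 then t True \<noteq> t False else t True = t False)}"

definition arc_inv :: "'e arc \<Rightarrow> 'e arc" where
  "arc_inv a = (fst a, \<lambda>i. - snd a i)"

definition incidence :: "('v, 'e) sgraph \<Rightarrow> 'v \<Rightarrow> 'e arc \<Rightarrow> int" where
  "incidence \<Sigma> v a = (case a of (e, t) \<Rightarrow>
     if loop_at \<Sigma> e v then (if esign \<Sigma> e = - 1 then 2 * t True else 0)
     else if att \<Sigma> e True = Some v then t True
     else if att \<Sigma> e False = Some v then t False
     else 0)"

definition orientation :: "('v, 'e) sgraph \<Rightarrow> 'e set \<Rightarrow> 'e arc set \<Rightarrow> bool" where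
  "orientation \<Sigma> S \<omega> \<longleftrightarrow>
     \<omega> \<subseteq> {a \<in> arcs \<Sigma>. fst a \<in> S} \<and> (\<forall>e \<in> S. \<exists>!a. a \<in> \<omega> \<and> fst a = e)"

text \<open>Coefficient groups are groups in the sense of \<open>HOL-Algebra\<close>, written multiplicatively: the
  integer multiple \<open>n a\<close> is \<open>a [^] n\<close> and sums are \<open>finprod\<close>.\<close>

definition one_chains ::
  "('v, 'e) sgraph \<Rightarrow> ('a, 'm) monoid_scheme \<Rightarrow> ('e arc \<Rightarrow> 'a) set" where
  "one_chains \<Sigma> A = {c \<in> arcs \<Sigma> \<rightarrow>\<^sub>E carrier A. \<forall>a \<in> arcs \<Sigma>. c (arc_inv a) = inv\<^bsub>A\<^esub> (c a)}"

text \<open>The term for an edge in the conservation law does not depend on which of its two arcs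
  is used, so the law is required for every orientation \<open>\<omega>\<close> of the whole edge set.\<close>

definition flows ::
  "('v, 'e) sgraph \<Rightarrow> ('a, 'm) monoid_scheme \<Rightarrow> ('e arc \<Rightarrow> 'a) set" where
  "flows \<Sigma> A = {c \<in> one_chains \<Sigma> A. \<forall>v \<in> verts \<Sigma>. \<forall>\<omega>. orientation \<Sigma> (edges \<Sigma>) \<omega> \<longrightarrow>
     finprod A (\<lambda>a. c a [^]\<^bsub>A\<^esub> incidence \<Sigma> v a) \<omega> = \<one>\<^bsub>A\<^esub>}"

definition flow_group ::
  "('v, 'e) sgraph \<Rightarrow> ('a, 'm) monoid_scheme \<Rightarrow> ('e arc \<Rightarrow> 'a) monoid" where
  "flow_group \<Sigma> A = (product_group (arcs \<Sigma>) (\<lambda>_. A))\<lparr>carrier := flows \<Sigma> A\<rparr>"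

definition scale_chain ::
  "('v, 'e) sgraph \<Rightarrow> ('a, 'm) monoid_scheme \<Rightarrow> 'a \<Rightarrow> ('e arc \<Rightarrow> int) \<Rightarrow> ('e arc \<Rightarrow> 'a)" where
  "scale_chain \<Sigma> A h c = (\<lambda>a \<in> arcs \<Sigma>. h [^]\<^bsub>A\<^esub> c a)"

definition multiples ::
  "('v, 'e) sgraph \<Rightarrow> ('a, 'm) monoid_scheme \<Rightarrow> 'a set \<Rightarrow> ('e arc \<Rightarrow> int) \<Rightarrow> ('e arc \<Rightarrow> 'a) set"
  where
  "multiples \<Sigma> A H c = (\<lambda>h. scale_chain \<Sigma> A h c) ` H"

definition orientation_chain :: "('v, 'e) sgraph \<Rightarrow> 'e arc set \<Rightarrow> ('e arc \<Rightarrow> int)" where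
  "orientation_chain \<Sigma> \<omega> =
     (\<lambda>a \<in> arcs \<Sigma>. if a \<in> \<omega> then 1 else if arc_inv a \<in> \<omega> then - 1 else 0)"


section \<open>Circuits\<close>

definition nowhere_zero_flow :: "('v, 'e) sgraph \<Rightarrow> ('e arc \<Rightarrow> int) \<Rightarrow> bool" where
  "nowhere_zero_flow \<Gamma> c \<longleftrightarrow> c \<in> flows \<Gamma> integer_group \<and> (\<forall>a \<in> arcs \<Gamma>. c a \<noteq> 0)"

definition circuit :: "('v, 'e) sgraph \<Rightarrow> 'e set \<Rightarrow> bool" where
  "circuit \<Sigma> C \<longleftrightarrow> C \<subseteq> edges \<Sigma> \<and> C \<noteq> {} \<and> sconnected (subgr \<Sigma> C) \<and>
     (\<exists>c. nowhere_zero_flow (subgr \<Sigma> C) c) \<and>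
     (\<forall>D. D \<subset> C \<and> D \<noteq> {} \<longrightarrow> \<not> (\<exists>c. nowhere_zero_flow (subgr \<Sigma> D) c))"

definition circuit_direction :: "('v, 'e) sgraph \<Rightarrow> 'e set \<Rightarrow> 'e arc set \<Rightarrow> bool" where
  "circuit_direction \<Sigma> C \<omega> \<longleftrightarrow>
     (\<exists>c. nowhere_zero_flow (subgr \<Sigma> C) c \<and> \<omega> = {a \<in> arcs (subgr \<Sigma> C). c a > 0})"

definition half_line :: "('v, 'e) sgraph \<Rightarrow> 'v \<Rightarrow> bool" where
  "half_line \<Gamma> p \<longleftrightarrow> sconnected \<Gamma> \<and> card (outer_edges \<Gamma>) = 1 \<and> p \<in> verts \<Gamma> \<and>
     vdegree \<Gamma> p = 1 \<and> (\<forall>v \<in> verts \<Gamma> - {p}. vdegree \<Gamma> v = 2)"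

definition line_segment :: "('v, 'e) sgraph \<Rightarrow> 'v \<Rightarrow> 'v \<Rightarrow> bool" where
  "line_segment \<Gamma> p q \<longleftrightarrow> sconnected \<Gamma> \<and> outer_edges \<Gamma> = {} \<and>
     p \<in> verts \<Gamma> \<and> q \<in> verts \<Gamma> \<and> p \<noteq> q \<and> vdegree \<Gamma> p = 1 \<and> vdegree \<Gamma> q = 1 \<and>
     (\<forall>v \<in> verts \<Gamma> - {p, q}. vdegree \<Gamma> v = 2)"

text \<open>The edges of the half-line in a circuit made of a negative circle and a half-line, and those of
  the line segment in a circuit made of two negative circles joined by a line segment.\<close>

definition double_edge :: "('v, 'e) sgraph \<Rightarrow> 'e set \<Rightarrow> 'e \<Rightarrow> bool" where
  "double_edge \<Sigma> C e \<longleftrightarrow>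
     (\<exists>C1 \<in> negative_circles \<Sigma>. \<exists>H \<subseteq> edges \<Sigma>. \<exists>p.
        C = C1 \<union> H \<and> half_line (subgr \<Sigma> H) p \<and>
        verts (subgr \<Sigma> C1) \<inter> verts (subgr \<Sigma> H) = {p} \<and> e \<in> H) \<or>
     (\<exists>C1 \<in> negative_circles \<Sigma>. \<exists>C2 \<in> negative_circles \<Sigma>. \<exists>P \<subseteq> edges \<Sigma>. \<exists>p q.
        C = C1 \<union> P \<union> C2 \<and> line_segment (subgr \<Sigma> P) p q \<and>
        verts (subgr \<Sigma> C1) \<inter> verts (subgr \<Sigma> C2) = {} \<and>
        verts (subgr \<Sigma> C1) \<inter> verts (subgr \<Sigma> P) = {p} \<and>
        verts (subgr \<Sigma> C2) \<inter> verts (subgr \<Sigma> P) = {q} \<and> e \<in> P)"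

definition circuit_flow :: "('v, 'e) sgraph \<Rightarrow> 'e set \<Rightarrow> 'e arc set \<Rightarrow> ('e arc \<Rightarrow> int)" where
  "circuit_flow \<Sigma> C \<omega> = (\<lambda>a \<in> arcs \<Sigma>.
     (if double_edge \<Sigma> C (fst a) then 2 else 1) *
     (if a \<in> \<omega> then 1 else if arc_inv a \<in> \<omega> then - 1 else 0))"


section \<open>Canonical bases\<close>

definition spanning_tree :: "('v, 'e) sgraph \<Rightarrow> 'e set \<Rightarrow> bool" where
  "spanning_tree \<Gamma> T \<longleftrightarrow>
     T \<subseteq> edges \<Gamma> \<and> sconnected (\<Gamma>\<lparr>edges := T\<rparr>) \<and> circles (\<Gamma>\<lparr>edges := T\<rparr>) = {}"

definition component_base :: "('v, 'e) sgraph \<Rightarrow> 'e set \<Rightarrow> bool" where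
  "component_base \<Gamma> D \<longleftrightarrow>
     (\<exists>T. spanning_tree (\<Gamma>\<lparr>edges := edges \<Gamma> - outer_edges \<Gamma>\<rparr>) T \<and>
       (if balanced \<Gamma> then D = T
        else if outer_edges \<Gamma> \<noteq> {} then \<exists>e \<in> outer_edges \<Gamma>. D = insert e T
        else \<exists>e \<in> edges \<Gamma>. D = insert e T \<and>
               (\<exists>S \<in> negative_circles \<Gamma>. circles (\<Gamma>\<lparr>edges := insert e T\<rparr>) = {S})))"

definition canonical_base :: "('v, 'e) sgraph \<Rightarrow> 'e set \<Rightarrow> bool" where
  "canonical_base \<Sigma> B \<longleftrightarrow>
     (\<exists>D. (\<forall>\<Gamma> \<in> components \<Sigma>. component_base \<Gamma> (D \<Gamma>)) \<and> B = (\<Union>\<Gamma> \<in> components \<Sigma>. D \<Gamma>))"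

definition base_circuit :: "('v, 'e) sgraph \<Rightarrow> 'e set \<Rightarrow> 'e \<Rightarrow> 'e set" where
  "base_circuit \<Sigma> B e = (THE C. circuit \<Sigma> C \<and> C \<subseteq> insert e B)"


section \<open>Group-theoretic notions\<close>

definition tor2 :: "('a, 'm) monoid_scheme \<Rightarrow> 'a set" where
  "tor2 A = {a \<in> carrier A. a [^]\<^bsub>A\<^esub> (2::nat) = \<one>\<^bsub>A\<^esub>}"

definition internal_direct_sum ::
  "('a, 'm) monoid_scheme \<Rightarrow> 'i set \<Rightarrow> ('i \<Rightarrow> 'a set) \<Rightarrow> bool" where
  "internal_direct_sum G I H \<longleftrightarrow> (\<forall>i \<in> I. subgroup (H i) G) \<and>
     (\<lambda>x. finprod G x I) \<in> iso (sum_group I (\<lambda>i. G\<lparr>carrier := H i\<rparr>)) G"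

end

theory Submission
  imports Defs
begin

text \<open>
  Inside a component with spanning tree \<open>T\<close>, a chain supported on \<open>T\<close> whose boundary vanishes off
  one vertex is zero, because a nonempty subset of a forest has a leaf other than any given vertex.
  Hence a flow is determined by its values off \<open>B\<close> and, in an unbalanced component without
  outer-edges, by its value on one edge of the negative circle in \<open>B\<close>; after subtracting a flow
  with the same values off \<open>B\<close>, the latter value has to be 2-torsion, as a negative circle carries
  a \<open>\<plusminus>1\<close>-chain whose boundary is \<open>\<plusminus>2\<close> at a single vertex.

  Over the integers this makes the flows on \<open>B \<union> e\<close> an infinite cyclic group generated by a flow
  \<open>g\<close> with \<open>g e = 1\<close>, and \<open>C(B, e)\<close> is the support of \<open>g\<close>. A circuit has at most one edge more than
  vertices, so its degrees exceed 2 by at most 2 in total. Parity of the degrees in the classes on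
  which \<open>\<bar>g\<bar>\<close> is constant then shows that \<open>\<bar>g\<bar>\<close> is 2 on the double edges and 1 elsewhere.
\<close>

section \<open>Edge sets of a signed graph\<close>

text \<open>Coefficients lie in an arbitrary abelian group, so there is no rank to count and no
  division by 2: existence has to come from integer chains, scaled afterwards by group elements, and
  uniqueness from peeling leaves, where the exponent is plus or minus 1. The obstacle is that
  circuits are given by minimality of nowhere-zero flows, whereas double edges are given by shape.
  No classification of circuits is carried out; only the shapes that can occur when the fundamental
  flow takes a value other than plus or minus 1 are recovered from it. The normalisation to 1 at e
  needs no denominators for a simple reason: moving both ends of a non-outer edge along the tree to
  one vertex leaves boundary 0 or plus or minus 2, which a multiple of the negative circle chain
  cancels, and an outer-edge of the base absorbs any boundary. The coordinates are triangular rather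
  than independent: a circuit C(B, e) may run through a negative circle of B, so the torsion
  coordinates can be read off only after the circuit coordinates have been removed.\<close>

context signed_graph
begin

definition ends :: "'e set \<Rightarrow> 'v \<Rightarrow> ('e \<times> bool) set" where
  "ends S v = {(e, i). e \<in> S \<and> att \<Sigma> e i = Some v}"

definition vset :: "'e set \<Rightarrow> 'v set" where
  "vset S = {v. \<exists>e\<in>S. \<exists>i. att \<Sigma> e i = Some v}"

definition deg :: "'e set \<Rightarrow> 'v \<Rightarrow> nat" where
  "deg S v = card (ends S v)"

definition adj :: "'e set \<Rightarrow> ('v \<times> 'v) set" where
  "adj S = {(u, v). \<exists>e\<in>S. \<exists>i. att \<Sigma> e i = Some u \<and> att \<Sigma> e (\<not> i) = Some v}"

lemma finite_sub: "S \<subseteq> edges \<Sigma> \<Longrightarrow> finite S"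
  using finite_edges finite_subset by blast

lemma finite_ends: "S \<subseteq> edges \<Sigma> \<Longrightarrow> finite (ends S v)"
  by (rule finite_subset[of _ "S \<times> UNIV"]) (auto simp: ends_def finite_sub)

lemma vset_subset: "S \<subseteq> edges \<Sigma> \<Longrightarrow> vset S \<subseteq> verts \<Sigma>"
  using att_verts by (auto simp: vset_def)

lemma finite_vset: "S \<subseteq> edges \<Sigma> \<Longrightarrow> finite (vset S)"
  using vset_subset finite_verts finite_subset by blast

lemma vset_mono: "X \<subseteq> S \<Longrightarrow> vset X \<subseteq> vset S"
  by (auto simp: vset_def)

lemma vset_Un: "vset (X \<union> Y) = vset X \<union> vset Y"
  by (auto simp: vset_def)

lemma vset_nonempty: "S \<subseteq> edges \<Sigma> \<Longrightarrow> S \<noteq> {} \<Longrightarrow> vset S \<noteq> {}"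
  using att_some by (fastforce simp: vset_def)

lemma vset_iff_ends: "v \<in> vset S \<longleftrightarrow> ends S v \<noteq> {}"
  by (auto simp: vset_def ends_def)

lemma deg_0_iff: "S \<subseteq> edges \<Sigma> \<Longrightarrow> deg S v = 0 \<longleftrightarrow> v \<notin> vset S"
  by (simp add: deg_def finite_ends vset_iff_ends)

lemma ends_split: "X \<subseteq> S \<Longrightarrow> ends S v = ends X v \<union> ends (S - X) v"
  and ends_disj: "ends X v \<inter> ends (S - X) v = {}"
  by (auto simp: ends_def)

lemma deg_split:
  assumes "S \<subseteq> edges \<Sigma>" "X \<subseteq> S"
  shows "deg S v = deg X v + deg (S - X) v"
  unfolding deg_def ends_split[OF assms(2)]
  by (rule card_Un_disjoint) (use assms in \<open>auto intro!: finite_ends simp: ends_disj\<close>)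

lemma deg_disjoint_eq:
  assumes "S \<subseteq> edges \<Sigma>" "X \<subseteq> S" "v \<notin> vset (S - X)"
  shows "deg X v = deg S v"
proof -
  have "deg (S - X) v = 0"
    using assms by (subst deg_0_iff) auto
  then show ?thesis
    using deg_split[OF assms(1,2), of v] by simp
qed

lemma outer_edge_iff: "e \<in> edges \<Sigma> \<Longrightarrow> outer_edge \<Sigma> e \<longleftrightarrow> (\<exists>i. att \<Sigma> e i = None)"
  using att_some[of e] unfolding outer_edge_def Ex1_def ex_bool_eq all_bool_eq by auto

text \<open>At least one end of an edge is attached, so an outer-edge has exactly one loose end and
  projecting loose ends to edges is injective.\<close>

lemma card_unattached:
  assumes "S \<subseteq> edges \<Sigma>"
  shows "card {(e, i). e \<in> S \<and> att \<Sigma> e i = None} = card {e \<in> S. outer_edge \<Sigma> e}"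
proof -
  let ?N = "{(e, i). e \<in> S \<and> att \<Sigma> e i = None}"
  have "inj_on fst ?N"
  proof (rule inj_onI)
    fix x y
    assume "x \<in> ?N" "y \<in> ?N" "fst x = fst y"
    then obtain e i j where *: "x = (e, i)" "y = (e, j)" "e \<in> S" "att \<Sigma> e i = None" "att \<Sigma> e j = None"
      by auto
    then obtain k where "att \<Sigma> e k \<noteq> None"
      using att_some assms by blast
    with * show "x = y" by (cases i; cases j; cases k; simp)
  qed
  moreover have "fst ` ?N = {e \<in> S. outer_edge \<Sigma> e}"
  proof (rule equalityI; rule subsetI)
    fix e
    assume "e \<in> fst ` ?N"
    then obtain i where i: "e \<in> S" "att \<Sigma> e i = None" by auto
    then obtain k where "att \<Sigma> e k \<noteq> None"
      using att_some assms by blast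
    with i have "outer_edge \<Sigma> e"
      using outer_edge_iff[of e] assms by blast
    with i show "e \<in> {e \<in> S. outer_edge \<Sigma> e}" by simp
  next
    fix e
    assume "e \<in> {e \<in> S. outer_edge \<Sigma> e}"
    then obtain i where "(e, i) \<in> ?N"
      using outer_edge_iff[of e] assms by blast
    then show "e \<in> fst ` ?N"
      by (rule image_eqI[rotated]) simp
  qed
  ultimately show ?thesis
    using card_image[of fst ?N] by argo
qed

lemma disjoint_ends: "u \<noteq> v \<Longrightarrow> ends S u \<inter> ends S v = {}"
  by (auto simp: ends_def)

lemma ends_Union: "(\<Union>v\<in>vset S. ends S v) = {(e, i). e \<in> S \<and> att \<Sigma> e i \<noteq> None}"
  by (auto simp: ends_def vset_def)

text \<open>Each edge has two ends; the attached ones are distributed over the vertices and the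
  loose ones are counted by the outer-edges.\<close>

lemma handshake:
  assumes "S \<subseteq> edges \<Sigma>"
  shows "(\<Sum>v\<in>vset S. deg S v) + card {e \<in> S. outer_edge \<Sigma> e} = 2 * card S"
proof -
  have fin: "finite S" using assms finite_sub by blast
  let ?N = "{(e, i). e \<in> S \<and> att \<Sigma> e i = None}"
  let ?M = "{(e, i). e \<in> S \<and> att \<Sigma> e i \<noteq> None}"
  have "(\<Sum>v\<in>vset S. deg S v) = card (\<Union>v\<in>vset S. ends S v)"
    unfolding deg_def
    by (rule card_UN_disjoint[symmetric])
       (use assms finite_vset finite_ends in \<open>auto simp: disjoint_ends\<close>)
  then have M: "(\<Sum>v\<in>vset S. deg S v) = card ?M"
    by (simp add: ends_Union)
  have "?M \<union> ?N = S \<times> UNIV" "?M \<inter> ?N = {}"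
    by auto
  moreover have "finite ?M" "finite ?N"
    by (rule finite_subset[of _ "S \<times> UNIV"]; auto simp: fin)+
  ultimately have "card ?M + card ?N = card (S \<times> (UNIV :: bool set))"
    using card_Un_disjoint[of ?M ?N] by presburger
  then show ?thesis
    using M card_unattached[OF assms] by (simp add: card_cartesian_product)
qed

lemma handshake_superset:
  assumes "S \<subseteq> edges \<Sigma>" "vset S \<subseteq> W" "finite W"
  shows "(\<Sum>v\<in>W. deg S v) + card {e \<in> S. outer_edge \<Sigma> e} = 2 * card S"
proof -
  have "(\<Sum>v\<in>W. deg S v) = (\<Sum>v\<in>vset S. deg S v)"
    by (rule sum.mono_neutral_right) (use assms deg_0_iff in auto)
  then show ?thesis using handshake[OF assms(1)] by simp
qed

section \<open>Reachability and connected edge sets\<close>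

lemma adj_sym: "(u, v) \<in> adj S \<Longrightarrow> (v, u) \<in> adj S"
proof -
  assume "(u, v) \<in> adj S"
  then obtain e i where e: "e \<in> S" "att \<Sigma> e i = Some u" "att \<Sigma> e (\<not> i) = Some v"
    unfolding adj_def by blast
  then have "att \<Sigma> e (\<not> i) = Some v \<and> att \<Sigma> e (\<not> (\<not> i)) = Some u"
    by simp
  then show ?thesis
    using e(1) unfolding adj_def by blast
qed

lemma adj_rtrancl_sym: "(u, v) \<in> (adj S)\<^sup>* \<Longrightarrow> (v, u) \<in> (adj S)\<^sup>*"
  using adj_sym by (metis sym_rtrancl symD symI)

lemma sconnected_subgr:
  "sconnected (subgr \<Sigma> S) \<longleftrightarrow>
     vset S \<noteq> {} \<and> (\<forall>u\<in>vset S. \<forall>v\<in>vset S. (u, v) \<in> (adj S)\<^sup>*)"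
proof -
  have "verts (subgr \<Sigma> S) = vset S" "adjacency (subgr \<Sigma> S) = adj S"
    by (auto simp: subgr_def vset_def adjacency_def adj_def)
  then show ?thesis
    unfolding sconnected_def connection_def by auto
qed

lemma is_circle_subgr:
  "is_circle (subgr \<Sigma> S) \<longleftrightarrow> sconnected (subgr \<Sigma> S) \<and> (\<forall>e\<in>S. \<not> outer_edge \<Sigma> e) \<and>
     (\<forall>v\<in>vset S. deg S v = 2)"
proof -
  have "verts (subgr \<Sigma> S) = vset S" "outer_edges (subgr \<Sigma> S) = {e \<in> S. outer_edge \<Sigma> e}"
    "vdegree (subgr \<Sigma> S) v = deg S v" for v
    by (auto simp: subgr_def vset_def outer_edges_def outer_edge_def vdegree_def deg_def ends_def)
  then show ?thesis
    unfolding is_circle_def by auto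
qed

text \<open>\<open>X\<close> consists of the edges of \<open>S\<close> having an end reachable from
  \<open>u\<close>, so every walk in \<open>S\<close> starting at \<open>u\<close> stays in
  \<open>X\<close>. The last conclusion keeps track of reachability in \<open>S\<close>, which later
  tells that a given vertex lies outside the piece.\<close>

lemma component_split:
  assumes "S \<subseteq> edges \<Sigma>" "u \<in> vset S"
  obtains X where "X \<subseteq> S" "u \<in> vset X" "sconnected (subgr \<Sigma> X)" "vset X \<inter> vset (S - X) = {}"
    "\<And>v. v \<in> vset X \<longleftrightarrow> (u, v) \<in> (adj S)\<^sup>*"
proof -
  define X where "X = {b \<in> S. \<exists>i v. att \<Sigma> b i = Some v \<and> (u, v) \<in> (adj S)\<^sup>*}"
  have both: "(u, v) \<in> (adj S)\<^sup>*" if "b \<in> X" "att \<Sigma> b i = Some v" for b i v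
  proof -
    obtain j w where w: "att \<Sigma> b j = Some w" "(u, w) \<in> (adj S)\<^sup>*" "b \<in> S"
      using \<open>b \<in> X\<close> unfolding X_def by blast
    show ?thesis
    proof (cases "i = j")
      case True
      then show ?thesis using w that by simp
    next
      case False
      then have "i = (\<not> j)" by auto
      then have "(w, v) \<in> adj S" using w that unfolding adj_def by auto
      then show ?thesis using w by (meson rtrancl.rtrancl_into_rtrancl)
    qed
  qed
  have vX1: "(u, v) \<in> (adj S)\<^sup>*" if "v \<in> vset X" for v
    using that both unfolding vset_def by blast
  have uX: "u \<in> vset X"
    using assms(2) unfolding vset_def X_def by blast
  have reach: "(u, v) \<in> (adj X)\<^sup>* \<and> v \<in> vset X" if "(u, v) \<in> (adj S)\<^sup>*" for v
    using that
  proof (induction rule: rtrancl_induct)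
    case base
    then show ?case using uX by simp
  next
    case (step y z)
    obtain e i where e: "e \<in> S" "att \<Sigma> e i = Some y" "att \<Sigma> e (\<not> i) = Some z"
      using step(2) unfolding adj_def by blast
    then have "e \<in> X" using step(1) unfolding X_def by blast
    then have "(y, z) \<in> adj X" "z \<in> vset X"
      using e unfolding adj_def vset_def by blast+
    then show ?case using step by (meson rtrancl.rtrancl_into_rtrancl)
  qed
  have con: "sconnected (subgr \<Sigma> X)"
    unfolding sconnected_subgr
  proof (intro conjI ballI)
    fix w v
    assume "w \<in> vset X" "v \<in> vset X"
    then have "(u, w) \<in> (adj X)\<^sup>*" "(u, v) \<in> (adj X)\<^sup>*"
      using reach vX1 by blast+
    then show "(w, v) \<in> (adj X)\<^sup>*"
      using adj_rtrancl_sym rtrancl_trans by metis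
  qed (use uX in blast)
  have "vset X \<inter> vset (S - X) = {}"
  proof (rule ccontr)
    assume "vset X \<inter> vset (S - X) \<noteq> {}"
    then obtain v e i where "v \<in> vset X" "e \<in> S" "e \<notin> X" "att \<Sigma> e i = Some v"
      unfolding vset_def by blast
    then show False using vX1 unfolding X_def by blast
  qed
  then show ?thesis
    using that[of X] uX con vX1 reach X_def by blast
qed

text \<open>If no vertex were shared, a walk from \<open>X\<close> could never leave
  \<open>vset X\<close>. This supplies the vertex at which some property of edges changes.\<close>

lemma connected_meet:
  assumes "sconnected (subgr \<Sigma> S)" "S \<subseteq> edges \<Sigma>" "X \<subseteq> S" "X \<noteq> {}" "X \<noteq> S"
  obtains v where "v \<in> vset X" "v \<in> vset (S - X)"
proof -
  have "\<exists>v. v \<in> vset X \<and> v \<in> vset (S - X)"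
  proof (rule ccontr)
    assume no: "\<not> ?thesis"
    obtain u where u: "u \<in> vset X"
      using vset_nonempty assms by (metis ex_in_conv order_trans)
    have cl: "z \<in> vset X" if "(u, z) \<in> (adj S)\<^sup>*" for z
      using that
    proof (induction rule: rtrancl_induct)
      case base
      then show ?case using u .
    next
      case (step y z)
      obtain e i where e: "e \<in> S" "att \<Sigma> e i = Some y" "att \<Sigma> e (\<not> i) = Some z"
        using step(2) unfolding adj_def by blast
      then have "e \<in> X" using no step.IH by (auto simp: vset_def)
      then show ?case using e by (auto simp: vset_def)
    qed
    have "S - X \<noteq> {}" using assms by blast
    then obtain w where w: "w \<in> vset (S - X)"
      using vset_nonempty[of "S - X"] assms by blast
    have "w \<in> vset S" "u \<in> vset S"
      using w u vset_mono[of "S - X" S] vset_mono[of X S] assms by auto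
    then have "w \<in> vset X"
      using cl assms(1) unfolding sconnected_subgr by blast
    then show False using no w by blast
  qed
  then show ?thesis using that by blast
qed

text \<open>Minimality leaves no room: deleting an edge of a set with more edges than vertices,
  deleting the edge at a vertex of degree 1, or splitting into two parts without common vertex would
  produce a smaller dense set. With as many edges as vertices and all degrees at least 2, the
  handshake makes every degree equal to 2.\<close>

lemma minimal_dense_is_circle:
  assumes S: "S \<subseteq> edges \<Sigma>" "S \<noteq> {}" "\<forall>e\<in>S. \<not> outer_edge \<Sigma> e"
    and dense: "card (vset S) \<le> card S"
    and min: "\<And>X. X \<subset> S \<Longrightarrow> X \<noteq> {} \<Longrightarrow> card X < card (vset X)"
  shows "is_circle (subgr \<Sigma> S)"
proof -
  have fin: "finite S" using S finite_sub by blast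
  have finX: "finite (vset X)" if "X \<subseteq> S" for X using finite_vset that S by blast
  have pos: "card (vset S) > 0"
    using vset_nonempty[OF S(1,2)] finX by (simp add: card_gt_0_iff)
  have eq: "card S = card (vset S)"
  proof (rule ccontr)
    assume "card S \<noteq> card (vset S)"
    then have gt: "card (vset S) < card S" using dense by simp
    obtain b where b: "b \<in> S" using S by blast
    have c: "card (S - {b}) = card S - 1" using b by (simp add: fin)
    then have "S - {b} \<noteq> {}" using gt pos fin by (metis card.empty diff_is_0_eq less_one linorder_not_le
          nat_less_le not_gr_zero)
    then have "card (S - {b}) < card (vset (S - {b}))"
      using min[of "S - {b}"] b by blast
    also have "\<dots> \<le> card (vset S)"
      by (rule card_mono) (auto simp: finX vset_mono)
    finally show False using c gt by simp
  qed
  have ge2: "deg S v \<ge> 2" if v: "v \<in> vset S" for v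
  proof (rule ccontr)
    assume "\<not> deg S v \<ge> 2"
    moreover have "deg S v \<noteq> 0" using v deg_0_iff S by blast
    ultimately have "card (ends S v) = 1" unfolding deg_def by simp
    then obtain x where "ends S v = {x}" by (auto simp: card_1_singleton_iff)
    moreover obtain b i where "x = (b, i)" by (cases x)
    ultimately have bi: "ends S v = {(b, i)}" by simp
    then have b: "b \<in> S" "att \<Sigma> b i = Some v" by (auto simp: ends_def)
    let ?X = "S - {b}"
    have "v \<notin> vset ?X" using bi by (auto simp: vset_iff_ends ends_def)
    then have sub: "vset ?X \<subseteq> vset S - {v}" using vset_mono[of ?X S] by blast
    show False
    proof (cases "?X = {}")
      case True
      \<comment> \<open>Minimality says nothing about the empty set; but an edge that is neither an
        outer-edge nor a loop has two vertices, so \<open>{b}\<close> alone is not dense.\<close>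
      then have Sb: "S = {b}" using b by blast
      have "att \<Sigma> b (\<not> i) \<noteq> None"
      proof
        assume *: "att \<Sigma> b (\<not> i) = None"
        then have "outer_edge \<Sigma> b"
          using outer_edge_iff b S(1) by blast
        then show False using S b by blast
      qed
      then obtain w where w: "att \<Sigma> b (\<not> i) = Some w" by blast
      have "w \<noteq> v"
      proof
        assume "w = v"
        then have "(b, \<not> i) \<in> ends S v" using w b by (simp add: ends_def)
        then show False using bi by simp
      qed
      moreover have "{v, w} \<subseteq> vset S" using b w by (auto simp: vset_def)
      then have "card {v, w} \<le> card (vset S)" by (intro card_mono finX) auto
      ultimately show False using eq Sb by simp
    next
      case False
      have "card ?X < card (vset ?X)" using min[of ?X] False b by blast
      also have "\<dots> \<le> card (vset S - {v})" by (rule card_mono) (auto simp: finX sub)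
      also have "\<dots> = card (vset S) - 1" using v by (simp add: finX)
      finally show False using eq b by (simp add: fin)
    qed
  qed
  have eq2: "deg S v = 2" if v: "v \<in> vset S" for v
  proof (rule ccontr)
    assume "deg S v \<noteq> 2"
    then have "2 < deg S v" using ge2[OF v] by simp
    then have "(\<Sum>v\<in>vset S. 2) < (\<Sum>v\<in>vset S. deg S v)"
      using v ge2 finX by (intro sum_strict_mono_ex1) auto
    moreover have "{e \<in> S. outer_edge \<Sigma> e} = {}" using S by blast
    then have "(\<Sum>v\<in>vset S. deg S v) = 2 * card S"
      using handshake[OF S(1)] by (metis add_0_right card.empty)
    ultimately show False using eq by simp
  qed
  have "sconnected (subgr \<Sigma> S)"
  proof -
    obtain u where u: "u \<in> vset S" using vset_nonempty S by blast
    obtain X where X: "X \<subseteq> S" "u \<in> vset X" "sconnected (subgr \<Sigma> X)" "vset X \<inter> vset (S - X) = {}"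
      using component_split[OF S(1) u] by metis
    show ?thesis
    proof (cases "X = S")
      case True
      then show ?thesis using X by simp
    next
      case False
      have ne: "X \<noteq> {}" using X(2) by (auto simp: vset_def)
      have "card X < card (vset X)"
        by (rule min) (use False X(1) ne in auto)
      moreover have "card (S - X) < card (vset (S - X))"
        by (rule min) (use False X(1) ne in auto)
      moreover have "card X + card (S - X) = card S"
        using X(1) fin by (metis card_Diff_subset card_mono finite_subset le_add_diff_inverse)
      moreover have "vset S = vset X \<union> vset (S - X)"
        using X(1) by (metis Diff_partition vset_Un)
      then have "card (vset S) = card (vset X) + card (vset (S - X))"
        using X finX by (simp add: card_Un_disjoint)
      ultimately show ?thesis using eq by simp
    qed
  qed
  then show ?thesis
    using eq2 S by (auto simp: is_circle_subgr)
qed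

lemma dense_contains_circle:
  assumes "S \<subseteq> edges \<Sigma>" "S \<noteq> {}" "\<forall>e\<in>S. \<not> outer_edge \<Sigma> e" "card (vset S) \<le> card S"
  shows "\<exists>X\<subseteq>S. is_circle (subgr \<Sigma> X)"
  using assms
proof (induction "card S" arbitrary: S rule: less_induct)
  case less
  have fin: "finite S" using less.prems finite_sub by blast
  show ?case
  proof (cases "\<exists>X. X \<subset> S \<and> X \<noteq> {} \<and> card (vset X) \<le> card X")
    case True
    then obtain X where X: "X \<subset> S" "X \<noteq> {}" "card (vset X) \<le> card X" by blast
    then have "card X < card S" using fin by (simp add: psubset_card_mono)
    then have "\<exists>Y\<subseteq>X. is_circle (subgr \<Sigma> Y)"
      using less.hyps[of X] less.prems X by blast
    then show ?thesis using X by blast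
  next
    case False
    then have "is_circle (subgr \<Sigma> S)"
      using less.prems by (intro minimal_dense_is_circle) (auto simp: not_le)
    then show ?thesis by blast
  qed
qed

lemma forest_card:
  assumes "S \<subseteq> edges \<Sigma>" "S \<noteq> {}" "\<forall>e\<in>S. \<not> outer_edge \<Sigma> e" "\<And>X. X \<subseteq> S \<Longrightarrow> \<not> is_circle (subgr \<Sigma> X)"
  shows "card S < card (vset S)"
  using dense_contains_circle assms by (metis linorder_not_le)

end

section \<open>Trees and integer boundaries\<close>

context signed_graph
begin

text \<open>The vertex set \<open>W\<close> is carried along because a tree without edges still has
  one vertex, which \<open>vset T\<close> cannot see.\<close>

definition tree :: "'e set \<Rightarrow> 'v set \<Rightarrow> bool" where
  "tree T W \<longleftrightarrow> T \<subseteq> edges \<Sigma> \<and> (\<forall>e\<in>T. \<not> outer_edge \<Sigma> e) \<and> vset T \<subseteq> W \<and> W \<noteq> {} \<and> finite W \<and>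
     (\<forall>u\<in>W. \<forall>v\<in>W. (u, v) \<in> (adj T)\<^sup>*) \<and> (\<forall>X\<subseteq>T. \<not> is_circle (subgr \<Sigma> X))"

lemma treeD:
  assumes "tree T W"
  shows "T \<subseteq> edges \<Sigma>" "\<And>e. e \<in> T \<Longrightarrow> \<not> outer_edge \<Sigma> e" "vset T \<subseteq> W" "W \<noteq> {}" "finite W"
    "\<And>u v. u \<in> W \<Longrightarrow> v \<in> W \<Longrightarrow> (u, v) \<in> (adj T)\<^sup>*" "\<And>X. X \<subseteq> T \<Longrightarrow> \<not> is_circle (subgr \<Sigma> X)"
  using assms unfolding tree_def by auto

text \<open>Take a maximal \<open>X\<close> containing \<open>r\<close> with at most one vertex more
  than there are edges of \<open>T\<close> having both ends in it. If \<open>X\<close> were not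
  \<open>W\<close>, some walk from \<open>r\<close> would leave \<open>X\<close>, and the edge by
  which it leaves adds one vertex and at least one edge.\<close>

lemma connected_card_le:
  assumes "T \<subseteq> edges \<Sigma>" "finite W" "r \<in> W" "\<And>v. v \<in> W \<Longrightarrow> (r, v) \<in> (adj T)\<^sup>*" "vset T \<subseteq> W"
  shows "card W \<le> card T + 1"
proof -
  define E where "E = (\<lambda>X. {b \<in> T. \<exists>i v w. att \<Sigma> b i = Some v \<and> att \<Sigma> b (\<not> i) = Some w \<and> v \<in> X \<and> w \<in> X})"
  define P where "P = (\<lambda>X. X \<subseteq> W \<and> r \<in> X \<and> card X \<le> card (E X) + 1)"
  have finT: "finite T" using assms finite_sub by blast
  have finE: "finite (E X)" for X using finT by (simp add: E_def)
  have "P {r}" using assms by (simp add: P_def)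
  moreover have "finite {X. P X}"
    by (rule finite_subset[of _ "Pow W"]) (use assms in \<open>auto simp: P_def\<close>)
  ultimately obtain X where X: "P X" and max: "\<And>Y. P Y \<Longrightarrow> X \<subseteq> Y \<Longrightarrow> X = Y"
    using finite_has_maximal[of "{X. P X}"] by (metis empty_iff mem_Collect_eq)
  have PX: "X \<subseteq> W" "r \<in> X" "card X \<le> card (E X) + 1"
    using X by (auto simp: P_def)
  have finX: "finite X" using PX assms finite_subset by blast
  have "X = W"
  proof (rule ccontr)
    assume "X \<noteq> W"
    then obtain z where z: "z \<in> W" "z \<notin> X" using PX by blast
    have "v \<in> X" if "(r, v) \<in> (adj T)\<^sup>*" for v
      using that
    proof (induction rule: rtrancl_induct)
      case base
      then show ?case using PX by blast
    next
      case (step y v)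
      show ?case
      proof (rule ccontr)
        assume v: "v \<notin> X"
        obtain e i where e: "e \<in> T" "att \<Sigma> e i = Some y" "att \<Sigma> e (\<not> i) = Some v"
          using step(2) unfolding adj_def by blast
        then have vW: "v \<in> W" using assms(5) unfolding vset_def by blast
        have e_notin: "e \<notin> E X"
        proof
          assume "e \<in> E X"
          then obtain j a b where j: "att \<Sigma> e j = Some a" "att \<Sigma> e (\<not> j) = Some b" "a \<in> X" "b \<in> X"
            unfolding E_def by blast
          then show False using e v by (cases "i = j") auto
        qed
        have e_in: "e \<in> E (insert v X)"
          using e step.IH unfolding E_def by blast
        have mono: "insert e (E X) \<subseteq> E (insert v X)"
          using e_in unfolding E_def by blast
        have "card (insert v X) = card X + 1"
          using v finX by simp
        also have "\<dots> \<le> card (E X) + 1 + 1"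
          using PX by simp
        also have "\<dots> = card (insert e (E X)) + 1"
          using e_notin finE by simp
        also have "\<dots> \<le> card (E (insert v X)) + 1"
          using mono finE by (simp add: card_mono)
        finally have "P (insert v X)" using PX vW by (simp add: P_def)
        then have "X = insert v X" using max by blast
        then show False using v by blast
      qed
    qed
    then show False using z assms(4) by blast
  qed
  then have "card W \<le> card (E W) + 1" using PX by simp
  also have "card (E W) \<le> card T" by (rule card_mono[OF finT]) (auto simp: E_def)
  finally show ?thesis by simp
qed

lemma tree_sub_card:
  assumes "tree T W" "S \<subseteq> T" "S \<noteq> {}"
  shows "card S < card (vset S)"
  by (rule forest_card) (use treeD[OF assms(1)] assms(2,3) in auto)

text \<open>Connectivity bounds the number of vertices from above, absence of circles from below;
  the edgeless tree is separate because the forest bound needs a nonempty edge set.\<close>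

lemma tree_card:
  assumes "tree T W"
  shows "card T + 1 = card W"
proof -
  obtain r where r: "r \<in> W" using treeD(4)[OF assms] by blast
  have "card W \<le> card T + 1"
    by (rule connected_card_le[of T W r]) (use treeD[OF assms] r in auto)
  moreover have "card T + 1 \<le> card W"
  proof (cases "T = {}")
    case True
    moreover have "card W > 0" using treeD(4,5)[OF assms] by (simp add: card_gt_0_iff)
    ultimately show ?thesis by simp
  next
    case False
    then have "card T < card (vset T)" using tree_sub_card assms by blast
    also have "\<dots> \<le> card W" by (rule card_mono) (use treeD[OF assms] in auto)
    finally show ?thesis by simp
  qed
  ultimately show ?thesis by simp
qed

text \<open>If every vertex but \<open>r\<close> had degree at least 2, the degree sum would be at
  least twice the number of vertices minus 1, too much for a forest. Excluding \<open>r\<close>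
  matters because conservation is later known only away from one vertex.\<close>

lemma tree_leaf:
  assumes "tree T W" "S \<subseteq> T" "S \<noteq> {}"
  obtains v where "v \<in> vset S" "v \<noteq> r" "deg S v = 1"
proof -
  have S: "S \<subseteq> edges \<Sigma>" "\<forall>e\<in>S. \<not> outer_edge \<Sigma> e" using treeD[OF assms(1)] assms by auto
  have fin: "finite (vset S)" using finite_vset S by blast
  have "\<exists>v. v \<in> vset S \<and> v \<noteq> r \<and> deg S v = 1"
  proof (rule ccontr)
    assume no: "\<not> ?thesis"
    have ge: "deg S v \<ge> (if v = r then 1 else 2)" if "v \<in> vset S" for v
    proof -
      have "deg S v \<noteq> 0" using that deg_0_iff S by blast
      moreover have "v = r \<or> deg S v \<noteq> 1" using that no by blast
      ultimately show ?thesis by auto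
    qed
    have "(\<Sum>v\<in>vset S. (2::nat)) \<le> (\<Sum>v\<in>vset S. (if v = r then 1 else 2) + (if v = r then 1 else 0))"
      by (rule sum_mono) auto
    also have "\<dots> = (\<Sum>v\<in>vset S. (if v = r then 1 else 2)) + (\<Sum>v\<in>vset S. (if v = r then 1 else 0))"
      by (rule sum.distrib)
    also have "\<dots> \<le> (\<Sum>v\<in>vset S. deg S v) + 1"
      using ge fin by (intro add_mono sum_mono) auto
    also have "\<dots> = 2 * card S + 1"
    proof -
      have "{e \<in> S. outer_edge \<Sigma> e} = {}" using S by blast
      then show ?thesis using handshake[OF S(1)] by (metis add_0_right card.empty)
    qed
    finally have "2 * card (vset S) \<le> 2 * card S + 1" by simp
    then show False using tree_sub_card[OF assms] by simp
  qed
  then show ?thesis using that by blast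
qed

text \<open>The loose end of \<open>b\<close> takes one unit out of the degree sum, so degrees of at
  least 2 throughout would need more edges than vertices, whereas a forest together with
  \<open>b\<close> has at most as many edges as vertices.\<close>

lemma tree_outer_leaf:
  assumes "tree T W" "S \<subseteq> insert b T" "S \<noteq> {}" "b \<in> edges \<Sigma>" "outer_edge \<Sigma> b"
  obtains v where "v \<in> vset S" "deg S v = 1"
proof (cases "b \<in> S")
  case False
  then have "S \<subseteq> T" using assms by blast
  then show ?thesis using tree_leaf[OF assms(1) _ assms(3)] that by metis
next
  case True
  have S: "S \<subseteq> edges \<Sigma>" using treeD[OF assms(1)] assms by auto
  have fin: "finite (vset S)" "finite S" using finite_vset finite_sub S by blast+
  have "\<exists>v. v \<in> vset S \<and> deg S v = 1"
  proof (rule ccontr)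
    assume no: "\<not> ?thesis"
    have ge: "deg S v \<ge> 2" if "v \<in> vset S" for v
    proof -
      have "deg S v \<noteq> 0" using that deg_0_iff S by blast
      moreover have "deg S v \<noteq> 1" using that no by blast
      ultimately show ?thesis by auto
    qed
    have "{e \<in> S. outer_edge \<Sigma> e} = {b}" using treeD[OF assms(1)] assms True by auto
    then have hs: "(\<Sum>v\<in>vset S. deg S v) + 1 = 2 * card S"
      using handshake[OF S] by (metis is_singletonI is_singleton_altdef)
    have "(\<Sum>v\<in>vset S. (2::nat)) \<le> (\<Sum>v\<in>vset S. deg S v)"
      using ge by (rule sum_mono)
    then have "2 * card (vset S) + 1 \<le> 2 * card S" using hs by simp
    moreover have "card S \<le> card (vset S)"
    proof (cases "S = {b}")
      case True
      then show ?thesis using vset_nonempty[OF S assms(3)] fin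
        by (simp add: Suc_le_eq card_gt_0_iff)
    next
      case False
      then have "card (S - {b}) < card (vset (S - {b}))"
        using assms True by (intro tree_sub_card[OF assms(1)]) auto
      also have "\<dots> \<le> card (vset S)" by (rule card_mono[OF fin(1)]) (rule vset_mono, blast)
      finally show ?thesis using True fin by (simp add: card_Diff_singleton)
    qed
    ultimately show False by simp
  qed
  then show ?thesis using that by blast
qed

text \<open>Removing \<open>a\<close> and \<open>b\<close> leaves a forest, which has fewer edges
  than vertices. This bound is what limits the branching of a fundamental circuit.\<close>

lemma tree_plus_two_card:
  assumes "tree T W" "S \<subseteq> insert a (insert b T)" "S \<noteq> {}" "S \<subseteq> edges \<Sigma>"
  shows "card S \<le> card (vset S) + 1"
proof -
  have fin: "finite (vset S)" "finite S" using finite_vset finite_sub assms by blast+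
  have le: "card S \<le> card (S - {a, b}) + 2"
  proof -
    have "card S \<le> card ((S - {a, b}) \<union> {a, b})"
      using fin by (intro card_mono) auto
    also have "\<dots> \<le> card (S - {a, b}) + card {a, b}" by (rule card_Un_le)
    also have "card {a, b} \<le> 2" by (simp add: card_insert_if)
    finally show ?thesis by simp
  qed
  show ?thesis
  proof (cases "S - {a, b} = {}")
    case True
    then have "card S \<le> 2" using le by (metis add_0 card.empty)
    moreover have "card (vset S) > 0" using vset_nonempty assms fin by (simp add: card_gt_0_iff)
    ultimately show ?thesis by simp
  next
    case False
    then have "card (S - {a, b}) < card (vset (S - {a, b}))"
      using assms by (intro tree_sub_card[OF assms(1)]) auto
    also have "\<dots> \<le> card (vset S)" by (rule card_mono[OF fin(1)]) (rule vset_mono, blast)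
    finally show ?thesis using le by simp
  qed
qed

text \<open>The arrows, in the convention for arcs, of the arc of \<open>e\<close> that points out of end \<open>True\<close>;
  chains are identified with functions on edges through these arcs.\<close>

definition tau :: "'e \<Rightarrow> bool \<Rightarrow> int" where
  "tau e i = (if i then 1 else - esign \<Sigma> e)"

text \<open>Incidence number of \<open>v\<close> with the arc described by \<open>tau\<close>;
  adding over both ends makes a positive loop contribute 0 and a negative loop 2.\<close>

definition eta :: "'v \<Rightarrow> 'e \<Rightarrow> int" where
  "eta v e = (\<Sum>i\<in>UNIV. if att \<Sigma> e i = Some v then tau e i else 0)"

definition bd :: "'e set \<Rightarrow> ('e \<Rightarrow> int) \<Rightarrow> 'v \<Rightarrow> int" where
  "bd S f v = (\<Sum>e\<in>S. eta v e * f e)"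

section \<open>Calculus of integer boundaries\<close>

lemma sum_bool: "(\<Sum>i\<in>UNIV. h i) = h j + h (\<not> j)" for h :: "bool \<Rightarrow> int"
  by (cases j) (simp_all add: UNIV_bool)

lemma tau_cases: "e \<in> edges \<Sigma> \<Longrightarrow> tau e i = 1 \<or> tau e i = -1"
  using esign_cases[of e] by (auto simp: tau_def)

lemma tau_square: "e \<in> edges \<Sigma> \<Longrightarrow> tau e i * tau e i = 1"
  using tau_cases[of e i] by auto

lemma tau_abs: "e \<in> edges \<Sigma> \<Longrightarrow> \<bar>tau e i\<bar> = 1"
  using tau_cases[of e i] by auto

lemma eta_alt:
  "eta v e = (if att \<Sigma> e j = Some v then tau e j else 0) + (if att \<Sigma> e (\<not> j) = Some v then tau e (\<not> j) else 0)"
  unfolding eta_def by (rule sum_bool)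

lemma eta_0: "(\<And>i. att \<Sigma> e i \<noteq> Some v) \<Longrightarrow> eta v e = 0"
  by (simp add: eta_def)

text \<open>Summing over edge ends rather than edges lets the degree of \<open>v\<close> control the
  number of terms.\<close>

lemma bd_ends:
  assumes "S \<subseteq> edges \<Sigma>"
  shows "bd S f v = (\<Sum>(e, i)\<in>ends S v. tau e i * f e)"
proof -
  have E: "ends S v = Sigma S (\<lambda>e. {i. att \<Sigma> e i = Some v})"
    by (auto simp: ends_def)
  have "(\<Sum>(e, i)\<in>ends S v. tau e i * f e) = (\<Sum>e\<in>S. \<Sum>i | att \<Sigma> e i = Some v. tau e i * f e)"
    unfolding E by (rule sum.Sigma[symmetric]) (use assms finite_sub in auto)
  also have "\<dots> = (\<Sum>e\<in>S. eta v e * f e)"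
  proof (rule sum.cong)
    fix e
    have "(\<Sum>i | att \<Sigma> e i = Some v. tau e i) = eta v e"
      using sum.inter_filter[of UNIV "tau e" "\<lambda>i. att \<Sigma> e i = Some v"] by (simp add: eta_def)
    then show "(\<Sum>i | att \<Sigma> e i = Some v. tau e i * f e) = eta v e * f e"
      by (simp flip: sum_distrib_right)
  qed simp
  finally show ?thesis by (simp add: bd_def)
qed

lemma bd_add: "bd S (\<lambda>e. f e + g e) v = bd S f v + bd S g v"
  by (simp add: bd_def sum.distrib algebra_simps)

lemma bd_diff: "bd S (\<lambda>e. f e - g e) v = bd S f v - bd S g v"
  by (simp add: bd_def sum_subtractf algebra_simps)

lemma bd_scale: "bd S (\<lambda>e. c * f e) v = c * bd S f v"
  by (simp add: bd_def sum_distrib_left algebra_simps)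

lemma bd_cong: "(\<And>e. e \<in> S \<Longrightarrow> f e = g e) \<Longrightarrow> bd S f v = bd S g v"
  by (simp add: bd_def)

lemma bd_superset:
  assumes "S \<subseteq> edges \<Sigma>" "X \<subseteq> S" "\<And>e. e \<in> S - X \<Longrightarrow> f e = 0"
  shows "bd S f v = bd X f v"
  unfolding bd_def by (rule sum.mono_neutral_right) (use assms finite_sub in auto)

lemma bd_split:
  assumes "S \<subseteq> edges \<Sigma>" "X \<subseteq> S"
  shows "bd S f v = bd X f v + bd (S - X) f v"
  unfolding bd_def using sum.subset_diff[OF assms(2) finite_sub[OF assms(1)]] by (simp add: add.commute)

lemma bd_not_vset: "v \<notin> vset S \<Longrightarrow> bd S f v = 0"
  unfolding bd_def vset_def by (rule sum.neutral) (auto simp: eta_0)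

lemma bd_single:
  assumes "S \<subseteq> edges \<Sigma>" "e \<in> S"
  shows "bd S (\<lambda>x. if x = e then c else 0) v = eta v e * c"
proof -
  have "bd S (\<lambda>x. if x = e then c else 0) v = (\<Sum>x\<in>S. if x = e then eta v e * c else 0)"
    unfolding bd_def by (rule sum.cong) auto
  then show ?thesis using assms finite_sub by simp
qed

text \<open>The unit at \<open>u\<close> is pushed along a walk edge by edge; the sign it arrives
  with at \<open>w\<close> depends on the signs of the edges, so only plus or minus 1 is
  claimed.\<close>

lemma path_chain:
  assumes "S \<subseteq> edges \<Sigma>" "(u, w) \<in> (adj S)\<^sup>*"
  obtains f \<epsilon> where "\<And>e. e \<notin> S \<Longrightarrow> f e = 0" "\<epsilon> = 1 \<or> \<epsilon> = -1"
    "\<And>v. bd S f v = (if v = u then 1 else 0) + (if v = w then \<epsilon> else 0)"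
proof -
  have "\<exists>f \<epsilon>. (\<forall>e. e \<notin> S \<longrightarrow> f e = 0) \<and> (\<epsilon> = 1 \<or> \<epsilon> = -1) \<and>
    (\<forall>v. bd S f v = (if v = u then 1 else 0) + (if v = w then \<epsilon> else 0))"
    using assms(2)
  proof (induction rule: rtrancl_induct)
    case base
    \<comment> \<open>The zero chain works with sign -1: for \<open>w = u\<close> the two terms
      cancel.\<close>
    show ?case
      by (rule exI[of _ "\<lambda>_. 0"], rule exI[of _ "-1"]) (simp add: bd_def)
  next
    case (step y z)
    then obtain f \<epsilon> where f: "\<And>e. e \<notin> S \<Longrightarrow> f e = 0" "\<epsilon> = 1 \<or> \<epsilon> = -1"
      "\<And>v. bd S f v = (if v = u then 1 else 0) + (if v = y then \<epsilon> else 0)"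
      by blast
    obtain e i where e: "e \<in> S" "att \<Sigma> e i = Some y" "att \<Sigma> e (\<not> i) = Some z"
      using step(2) unfolding adj_def by blast
    \<comment> \<open>Chosen so that the boundary of \<open>e\<close> at \<open>y\<close> cancels
      the current sign, using that the square of \<open>tau e i\<close> is 1.\<close>
    let ?c = "- \<epsilon> * tau e i"
    let ?g = "\<lambda>x. f x + (if x = e then ?c else 0)"
    have eE: "e \<in> edges \<Sigma>" using e assms by blast
    have "bd S ?g v = (if v = u then 1 else 0) + (if v = z then ?c * tau e (\<not> i) else 0)" for v
    proof -
      have "eta v e = (if v = y then tau e i else 0) + (if v = z then tau e (\<not> i) else 0)"
        by (auto simp: eta_alt[of v e i] e(2,3))
      then have "bd S ?g v = (if v = u then 1 else 0) + (if v = y then \<epsilon> else 0) +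
          ((if v = y then tau e i else 0) + (if v = z then tau e (\<not> i) else 0)) * ?c"
        by (simp only: bd_add bd_single[OF assms(1) e(1)] f(3))
      then show ?thesis using tau_cases[OF eE, of i]
        by (cases "v = y"; cases "v = z") (auto simp: algebra_simps)
    qed
    moreover have "?c * tau e (\<not> i) = 1 \<or> ?c * tau e (\<not> i) = -1"
      using f(2) tau_cases[OF eE, of i] tau_cases[OF eE, of "\<not> i"] by auto
    moreover have "\<forall>x. x \<notin> S \<longrightarrow> ?g x = 0" using f(1) e(1) by auto
    ultimately show ?case
      by (intro exI[of _ ?g] exI[of _ "?c * tau e (\<not> i)"] conjI allI) auto
  qed
  then show ?thesis using that by blast
qed

end

section \<open>Circles\<close>

context signed_graph
begin

lemma attached: "e \<in> edges \<Sigma> \<Longrightarrow> \<not> outer_edge \<Sigma> e \<Longrightarrow> \<exists>v. att \<Sigma> e i = Some v"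
  using outer_edge_iff[of e] by auto

lemma deg1_bd:
  assumes "S \<subseteq> edges \<Sigma>" "deg S v = 1" "a \<in> S" "att \<Sigma> a i = Some v"
  shows "bd S f v = tau a i * f a" "\<bar>bd S f v\<bar> = \<bar>f a\<bar>"
proof -
  obtain x where x: "ends S v = {x}" using assms(2) by (auto simp: deg_def card_1_singleton_iff)
  moreover have "(a, i) \<in> ends S v" using assms by (simp add: ends_def)
  ultimately have "ends S v = {(a, i)}" by simp
  then show "bd S f v = tau a i * f a" by (simp add: bd_ends[OF assms(1)])
  then show "\<bar>bd S f v\<bar> = \<bar>f a\<bar>" using tau_abs[of a i] assms by (simp add: abs_mult subsetD)
qed

lemma deg2_bd:
  assumes "S \<subseteq> edges \<Sigma>" "deg S v = 2"
  obtains a i b j where "ends S v = {(a, i), (b, j)}" "(a, i) \<noteq> (b, j)"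
    "\<And>f. bd S f v = tau a i * f a + tau b j * f b" "a \<in> S" "b \<in> S"
    "tau a i = 1 \<or> tau a i = -1" "tau b j = 1 \<or> tau b j = -1"
proof -
  obtain x y where xy: "ends S v = {x, y}" "x \<noteq> y" using assms(2) by (auto simp: deg_def card_2_iff)
  obtain a i b j where ab: "x = (a, i)" "y = (b, j)" by (cases x; cases y)
  have "bd S f v = tau a i * f a + tau b j * f b" for f
    using xy ab by (simp add: bd_ends[OF assms(1)])
  moreover have "(a, i) \<in> ends S v" "(b, j) \<in> ends S v"
    using xy ab by auto
  then have "a \<in> S" "b \<in> S" by (auto simp: ends_def)
  ultimately show ?thesis using that[of a i b j] xy ab tau_cases assms by blast
qed

text \<open>At a vertex with two edge ends, conservation equates the two values up to sign.\<close>

lemma deg2_abs: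
  assumes "S \<subseteq> edges \<Sigma>" "deg S v = 2" "bd S f v = 0" "a \<in> S" "b \<in> S"
    "att \<Sigma> a i = Some v" "att \<Sigma> b j = Some v"
  shows "\<bar>f a\<bar> = \<bar>f b\<bar>"
proof -
  obtain a' i' b' j' where e: "ends S v = {(a', i'), (b', j')}"
    "bd S f v = tau a' i' * f a' + tau b' j' * f b'" "tau a' i' = 1 \<or> tau a' i' = -1"
     "tau b' j' = 1 \<or> tau b' j' = -1"
    using deg2_bd[OF assms(1,2)] by metis
  then have "\<bar>f a'\<bar> = \<bar>f b'\<bar>" using assms(3) by auto
  moreover have "(a, i) \<in> ends S v" "(b, j) \<in> ends S v"
    using assms by (auto simp: ends_def)
  then have "a = a' \<or> a = b'" "b = a' \<or> b = b'" using e(1) by auto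
  ultimately show ?thesis by auto
qed

text \<open>The absolute value could change only at a vertex shared by two classes of edges; a
  vertex of degree 1 sees a single edge, and conservation at degree 2 forces equal absolute
  values.\<close>

lemma connected_const_abs:
  assumes "S \<subseteq> edges \<Sigma>" "sconnected (subgr \<Sigma> S)"
    and v: "\<And>v. v \<in> vset S \<Longrightarrow> deg S v = 1 \<or> deg S v = 2 \<and> bd S f v = 0"
    and "a \<in> S" "b \<in> S"
  shows "\<bar>f a\<bar> = \<bar>f b\<bar>"
proof (rule ccontr)
  assume ne: "\<bar>f a\<bar> \<noteq> \<bar>f b\<bar>"
  define Z where "Z = {x \<in> S. \<bar>f x\<bar> = \<bar>f a\<bar>}"
  have "a \<in> Z" "b \<notin> Z" using assms(4) ne by (auto simp: Z_def)
  moreover have "Z \<subseteq> S" by (auto simp: Z_def)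
  ultimately have "Z \<noteq> {}" "Z \<noteq> S" "Z \<subseteq> S" using assms(5) by blast+
  then obtain w where "w \<in> vset Z" "w \<in> vset (S - Z)"
    using connected_meet[OF assms(2,1)] by metis
  then obtain c i d j where c: "c \<in> Z" "att \<Sigma> c i = Some w" and d: "d \<in> S - Z" "att \<Sigma> d j = Some w"
    unfolding vset_def by blast
  then have "w \<in> vset S" unfolding vset_def by blast
  from v[OF this] show False
  proof
    assume "deg S w = 1"
    then obtain x where "ends S w = {x}" by (auto simp: deg_def card_1_singleton_iff)
    moreover have "(c, i) \<in> ends S w" "(d, j) \<in> ends S w" using c d by (auto simp: ends_def Z_def)
    ultimately show False using c(1) d(1) by auto
  next
    assume "deg S w = 2 \<and> bd S f w = 0"
    then show False using deg2_abs[of S w f c d i j] c d assms(1) by (auto simp: Z_def)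
  qed
qed

text \<open>Conservation at a vertex of degree 2 puts both of its ends in the class or neither. The
  class is selected by an arbitrary predicate so that single values as well as all remaining values
  can be treated.\<close>

lemma class_deg:
  assumes "S \<subseteq> edges \<Sigma>" "deg S v = 2" "bd S f v = 0"
  shows "deg {x \<in> S. P \<bar>f x\<bar>} v = 0 \<or> deg {x \<in> S. P \<bar>f x\<bar>} v = 2 \<and> v \<notin> vset (S - {x \<in> S. P \<bar>f x\<bar>})"
proof (cases "v \<in> vset {x \<in> S. P \<bar>f x\<bar>}")
  case False
  then show ?thesis using deg_0_iff[of "{x \<in> S. P \<bar>f x\<bar>}" v] assms(1) by blast
next
  case True
  then obtain c i where c: "c \<in> S" "P \<bar>f c\<bar>" "att \<Sigma> c i = Some v" unfolding vset_def by blast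
  have "P \<bar>f d\<bar>" if "d \<in> S" "att \<Sigma> d j = Some v" for d j
    using deg2_abs[OF assms c(1) that(1) c(3) that(2)] c(2) by simp
  then have nv: "v \<notin> vset (S - {x \<in> S. P \<bar>f x\<bar>})" unfolding vset_def by blast
  have "deg {x \<in> S. P \<bar>f x\<bar>} v = deg S v"
    by (rule deg_disjoint_eq) (use assms nv in auto)
  then show ?thesis using nv assms(2) by simp
qed

lemma circleD:
  assumes "is_circle (subgr \<Sigma> S)"
  shows "sconnected (subgr \<Sigma> S)" "\<And>e. e \<in> S \<Longrightarrow> \<not> outer_edge \<Sigma> e" "\<And>v. v \<in> vset S \<Longrightarrow> deg S v = 2"
    "S \<noteq> {}"
  using assms unfolding is_circle_subgr sconnected_subgr by (auto simp: vset_def)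

lemma handshake_no_outer:
  assumes "S \<subseteq> edges \<Sigma>" "\<And>e. e \<in> S \<Longrightarrow> \<not> outer_edge \<Sigma> e" "vset S \<subseteq> W" "finite W"
  shows "(\<Sum>v\<in>W. deg S v) = 2 * card S"
proof -
  have "{e \<in> S. outer_edge \<Sigma> e} = {}" using assms by blast
  then show ?thesis using handshake_superset[OF assms(1,3,4)] by (metis add_0_right card.empty)
qed

text \<open>The degree sum is even when there are no loose ends, so a single vertex cannot be
  odd.\<close>

lemma even_deg_all:
  assumes "S \<subseteq> edges \<Sigma>" "\<And>e. e \<in> S \<Longrightarrow> \<not> outer_edge \<Sigma> e" "\<And>v. v \<noteq> p \<Longrightarrow> even (deg S v)"
  shows "even (deg S p)"
proof -
  have fin: "finite (insert p (vset S))" using finite_vset assms by simp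
  have "(\<Sum>v\<in>insert p (vset S). deg S v) = 2 * card S"
    by (rule handshake_no_outer) (use assms fin in auto)
  moreover have "(\<Sum>v\<in>insert p (vset S). deg S v) = deg S p + (\<Sum>v\<in>insert p (vset S) - {p}. deg S v)"
    using fin by (rule sum.remove) simp
  moreover have "even (\<Sum>v\<in>insert p (vset S) - {p}. deg S v)"
    using assms(3) by (intro dvd_sum) auto
  ultimately have "even (deg S p + (\<Sum>v\<in>insert p (vset S) - {p}. deg S v))"
    by (metis dvd_triv_left)
  then show ?thesis using \<open>even (\<Sum>v\<in>insert p (vset S) - {p}. deg S v)\<close> by simp
qed

text \<open>The edges where \<open>\<bar>f\<bar>\<close> takes a fixed value have even degree away from \<open>p\<close>,
  hence also at \<open>p\<close>, so that \<open>\<bar>f\<bar>\<close> cannot change at \<open>p\<close>.\<close>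

lemma circle_const_abs:
  assumes S: "is_circle (subgr \<Sigma> S)" "S \<subseteq> edges \<Sigma>"
    and bd: "\<And>v. v \<noteq> p \<Longrightarrow> bd S f v = 0" and ab: "a \<in> S" "b \<in> S"
  shows "\<bar>f a\<bar> = \<bar>f b\<bar>"
proof (rule ccontr)
  assume ne: "\<bar>f a\<bar> \<noteq> \<bar>f b\<bar>"
  define Z where "Z = {x \<in> S. \<bar>f x\<bar> = \<bar>f a\<bar>}"
  have "a \<in> Z" "b \<notin> Z" using ne ab by (auto simp: Z_def)
  then have Z: "Z \<subseteq> S" "Z \<noteq> {}" "Z \<noteq> S" using ab by (auto simp: Z_def)
  have "deg Z v = 0 \<or> deg Z v = 2 \<and> v \<notin> vset (S - Z)" if "v \<noteq> p" for v
  proof (cases "v \<in> vset S")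
    case True
    show ?thesis
      unfolding Z_def
      using class_deg[OF S(2) circleD(3)[OF S(1) True] bd[OF that], of "\<lambda>x. x = \<bar>f a\<bar>"] .
  next
    case False
    then have "v \<notin> vset Z" using vset_mono[OF Z(1)] by blast
    then show ?thesis using deg_0_iff[of Z v] Z(1) S(2) by blast
  qed
  note off = this
  have "even (deg Z p)"
  proof (rule even_deg_all)
    show "Z \<subseteq> edges \<Sigma>" using Z S by blast
    show "\<And>e. e \<in> Z \<Longrightarrow> \<not> outer_edge \<Sigma> e" using Z circleD(2)[OF S(1)] by blast
    show "even (deg Z v)" if "v \<noteq> p" for v using off[OF that] by auto
  qed
  obtain w where w: "w \<in> vset Z" "w \<in> vset (S - Z)"
    using connected_meet[OF circleD(1)[OF S(1)] S(2) Z] by blast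
  have ZE: "Z \<subseteq> edges \<Sigma>" "S - Z \<subseteq> edges \<Sigma>" using Z S by blast+
  have n0: "deg Z w \<noteq> 0" "deg (S - Z) w \<noteq> 0" using w deg_0_iff ZE by blast+
  then have "w = p" using off[of w] w by metis
  have "w \<in> vset S" using w(1) vset_mono[OF Z(1)] by blast
  then have "deg Z w + deg (S - Z) w = 2" using circleD(3)[OF S(1)] deg_split[OF S(2) Z(1), of w] by metis
  then have "deg Z w = 1" using n0 by linarith
  then show False using \<open>even (deg Z p)\<close> \<open>w = p\<close> by simp
qed

lemma pair_sum_sign:
  fixes x y :: int
  assumes "x = 1 \<or> x = -1" "y = 1 \<or> y = -1"
  shows "x * y = (if x + y = 0 then -1 else 1)"
  using assms by auto

text \<open>Both sides count the product of the signs of all arrows of \<open>s\<close>, edge by edge and vertex by vertex.\<close>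

lemma two_regular_sign:
  assumes S: "S \<subseteq> edges \<Sigma>" "\<And>e. e \<in> S \<Longrightarrow> \<not> outer_edge \<Sigma> e" "\<And>v. v \<in> vset S \<Longrightarrow> deg S v = 2"
    and s: "\<And>e. e \<in> S \<Longrightarrow> s e = 1 \<or> s e = -1"
  shows "(\<Prod>e\<in>S. esign \<Sigma> e) = (-1) ^ card {v \<in> vset S. bd S s v \<noteq> 0}"
proof -
  have fin: "finite S" "finite (vset S)" using finite_sub finite_vset S by blast+
  let ?h = "\<lambda>(e, i). tau e i * s e"
  have all: "(\<Union>v\<in>vset S. ends S v) = S \<times> UNIV"
  proof -
    have "att \<Sigma> e i \<noteq> None" if "e \<in> S" for e i
      using attached[of e i] S(1) S(2)[OF that] that by auto
    then show ?thesis unfolding ends_Union by auto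
  qed
  have "(\<Prod>x\<in>S \<times> UNIV. ?h x) = (\<Prod>e\<in>S. \<Prod>i\<in>UNIV. tau e i * s e)"
    using prod.cartesian_product[of "\<lambda>e i. tau e i * s e" UNIV S] by simp
  also have "\<dots> = (\<Prod>e\<in>S. - esign \<Sigma> e)"
  proof (rule prod.cong)
    fix e assume "e \<in> S"
    then show "(\<Prod>i\<in>UNIV. tau e i * s e) = - esign \<Sigma> e"
      using s[of e] by (auto simp: UNIV_bool tau_def)
  qed simp
  also have "\<dots> = (-1) ^ card S * (\<Prod>e\<in>S. esign \<Sigma> e)"
    using prod.distrib[of "\<lambda>_. -1" "esign \<Sigma>" S] by simp
  finally have 1: "(\<Prod>x\<in>S \<times> UNIV. ?h x) = (-1) ^ card S * (\<Prod>e\<in>S. esign \<Sigma> e)" .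
  have "(\<Prod>x\<in>(\<Union>v\<in>vset S. ends S v). ?h x) = (\<Prod>v\<in>vset S. \<Prod>x\<in>ends S v. ?h x)"
    by (rule prod.UNION_disjoint) (use fin finite_ends[OF S(1)] disjoint_ends in auto)
  also have "\<dots> = (\<Prod>v\<in>vset S. if bd S s v = 0 then -1 else 1)"
  proof (rule prod.cong)
    fix v assume "v \<in> vset S"
    then have "deg S v = 2" by (rule S(3))
    then obtain a i b j where e: "ends S v = {(a, i), (b, j)}" "(a, i) \<noteq> (b, j)"
      "bd S s v = tau a i * s a + tau b j * s b" "a \<in> S" "b \<in> S"
      "tau a i = 1 \<or> tau a i = -1" "tau b j = 1 \<or> tau b j = -1"
      using deg2_bd[OF S(1)] by metis
    have "(\<Prod>x\<in>ends S v. ?h x) = (tau a i * s a) * (tau b j * s b)"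
      using e(1,2) by simp
    also have "\<dots> = (if bd S s v = 0 then -1 else 1)"
      unfolding e(3) by (rule pair_sum_sign) (use s[OF e(4)] s[OF e(5)] e(6,7) in auto)
    finally show "(\<Prod>x\<in>ends S v. ?h x) = (if bd S s v = 0 then -1 else 1)" .
  qed simp
  also have "\<dots> = (-1) ^ card {v \<in> vset S. bd S s v = 0}"
  proof -
    have "(\<Prod>v\<in>vset S. if bd S s v = 0 then -1 else 1) = (\<Prod>v\<in>{v \<in> vset S. bd S s v = 0}. - 1 :: int)"
      using prod.inter_filter[OF fin(2), of "\<lambda>_. -1 :: int" "\<lambda>v. bd S s v = 0"] by simp
    then show ?thesis by simp
  qed
  finally have 2: "(\<Prod>x\<in>S \<times> UNIV. ?h x) = (-1) ^ card {v \<in> vset S. bd S s v = 0}"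
    unfolding all .
  have "(\<Sum>v\<in>vset S. deg S v) = 2 * card S"
    by (rule handshake_no_outer) (use S fin in auto)
  \<comment> \<open>Two-regularity makes the numbers of edges and vertices equal, so the sign
    \<open>(-1) ^ card S\<close> from the edgewise count splits over the vertices with zero and with
    nonzero boundary.\<close>
  then have cS: "card S = card (vset S)" using S(3) by simp
  have "vset S = {v \<in> vset S. bd S s v = 0} \<union> {v \<in> vset S. bd S s v \<noteq> 0}" by blast
  moreover have "card ({v \<in> vset S. bd S s v = 0} \<union> {v \<in> vset S. bd S s v \<noteq> 0}) =
      card {v \<in> vset S. bd S s v = 0} + card {v \<in> vset S. bd S s v \<noteq> 0}"
    using fin by (intro card_Un_disjoint) auto
  ultimately have "card (vset S) = card {v \<in> vset S. bd S s v = 0} + card {v \<in> vset S. bd S s v \<noteq> 0}"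
    by argo
  then have "(-1 :: int) ^ card S = (-1) ^ card {v \<in> vset S. bd S s v = 0} * (-1) ^ card {v \<in> vset S. bd S s v \<noteq> 0}"
    by (simp add: cS power_add)
  then have "(\<Prod>e\<in>S. esign \<Sigma> e) * (-1) ^ card {v \<in> vset S. bd S s v \<noteq> 0} = 1"
    using 1 2 by (simp add: mult.commute)
  then show ?thesis
    by (cases "even (card {v \<in> vset S. bd S s v \<noteq> 0})") auto
qed

text \<open>After deleting an edge that is not a loop, its ends are the only vertices of odd degree;
  were they separated, the piece containing \<open>u\<close> would have exactly one vertex of odd
  degree.\<close>

lemma circle_minus_edge_path:
  assumes S: "is_circle (subgr \<Sigma> S)" "S \<subseteq> edges \<Sigma>" and b: "b \<in> S" "att \<Sigma> b i = Some w" "att \<Sigma> b (\<not> i) = Some u"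
  shows "(u, w) \<in> (adj (S - {b}))\<^sup>*"
proof (rule ccontr)
  assume no: "\<not> ?thesis"
  then have uw: "u \<noteq> w" by auto
  have E: "S - {b} \<subseteq> edges \<Sigma>" "{b} \<subseteq> S" using S b by blast+
  have "ends {b} u = {(b, \<not> i)}"
  proof -
    have "(e, j) \<in> ends {b} u \<longleftrightarrow> (e, j) = (b, \<not> i)" for e j
      using uw b by (cases "j = i") (auto simp: ends_def)
    then show ?thesis by (intro equalityI subrelI) simp_all
  qed
  then have d1: "deg {b} u = 1" by (simp add: deg_def)
  have d0: "deg {b} v = 0" if "v \<noteq> u" "v \<noteq> w" for v
  proof -
    have "att \<Sigma> b j \<noteq> Some v" for j
      using that b by (cases "j = i") auto
    then have "ends {b} v = {}" by (auto simp: ends_def)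
    then show ?thesis by (simp add: deg_def)
  qed
  have dS: "even (deg S v)" for v
    using circleD(3)[OF S(1), of v] deg_0_iff[OF S(2), of v] by (cases "v \<in> vset S") auto
  have "u \<in> vset S" using b by (auto simp: vset_def)
  then have du: "deg (S - {b}) u = 1"
    using deg_split[OF S(2) E(2), of u] d1 circleD(3)[OF S(1)] by simp
  then have "u \<in> vset (S - {b})" using deg_0_iff[OF E(1)] by (metis one_neq_zero)
  then obtain X where X: "X \<subseteq> S - {b}" "u \<in> vset X" "vset X \<inter> vset ((S - {b}) - X) = {}"
    "\<And>v. v \<in> vset X \<longleftrightarrow> (u, v) \<in> (adj (S - {b}))\<^sup>*"
    using component_split[OF E(1)] by metis
  have XE: "X \<subseteq> edges \<Sigma>" using X E by blast
  have dX: "deg X v = deg (S - {b}) v" if "v \<in> vset X" for v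
    by (rule deg_disjoint_eq) (use that X E in auto)
  have "even (deg X u)"
  proof (rule even_deg_all[OF XE])
    show "\<not> outer_edge \<Sigma> e" if "e \<in> X" for e using that X(1) circleD(2)[OF S(1)] by blast
    show "even (deg X v)" if "v \<noteq> u" for v
    proof (cases "v \<in> vset X")
      case False
      then show ?thesis using deg_0_iff[OF XE, of v] by simp
    next
      case True
      then have "v \<noteq> w" using X(4) no by blast
      then show ?thesis
        using dX[OF True] deg_split[OF S(2) E(2), of v] d0[OF that] dS[of v] by simp
    qed
  qed
  then show False using dX[OF X(2)] du by simp
qed

text \<open>The edge \<open>b\<close> is closed up by a path chain through the rest of the circle.
  All boundary collects at \<open>w\<close>, where it is a sum of two units, hence 0 or of absolute
  value 2; \<open>two_regular_sign\<close> decides between these by the sign of the circle.\<close>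

lemma circle_chain:
  assumes S: "is_circle (subgr \<Sigma> S)" "S \<subseteq> edges \<Sigma>" and b: "b \<in> S" "att \<Sigma> b i = Some w"
  obtains g where "\<And>e. e \<in> S \<Longrightarrow> \<bar>g e\<bar> = 1" "\<And>e. e \<notin> S \<Longrightarrow> g e = 0" "g b = 1"
    "\<And>v. v \<noteq> w \<Longrightarrow> bd S g v = 0"
    "(\<Prod>e\<in>S. esign \<Sigma> e) = 1 \<Longrightarrow> bd S g w = 0" "(\<Prod>e\<in>S. esign \<Sigma> e) = -1 \<Longrightarrow> \<bar>bd S g w\<bar> = 2"
proof -
  have bE: "b \<in> edges \<Sigma>" using b S by blast
  obtain u where u: "att \<Sigma> b (\<not> i) = Some u"
    using attached[OF bE circleD(2)[OF S(1) b(1)]] by blast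
  have E: "S - {b} \<subseteq> edges \<Sigma>" using S by blast
  obtain f \<epsilon> where f: "\<And>e. e \<notin> S - {b} \<Longrightarrow> f e = 0" "\<epsilon> = 1 \<or> \<epsilon> = -1"
    "\<And>v. bd (S - {b}) f v = (if v = u then 1 else 0) + (if v = w then \<epsilon> else 0)"
    using path_chain[OF E circle_minus_edge_path[OF S b u]] by metis
  define c where "c = tau b (\<not> i)"
  \<comment> \<open>The path is scaled by \<open>- c\<close> so that it cancels the boundary of
    \<open>b\<close> at \<open>u\<close>; it avoids \<open>b\<close>, which leaves the value 1
    there.\<close>
  define g where "g = (\<lambda>e. (if e = b then 1 else 0) + (- c) * f e)"
  have c: "c = 1 \<or> c = -1" using tau_cases[OF bE] by (simp add: c_def)
  have bdf: "bd S f v = (if v = u then 1 else 0) + (if v = w then \<epsilon> else 0)" for v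
    using bd_superset[of S "S - {b}" f v] f S(2) by auto
  have bdg: "bd S g v = (if v = w then tau b i - c * \<epsilon> else 0)" for v
  proof -
    have "eta v b = (if v = w then tau b i else 0) + (if v = u then c else 0)"
      by (auto simp: eta_alt[of v b i] b(2) u c_def)
    then have "bd S g v = (if v = w then tau b i else 0) + (if v = u then c else 0) -
        c * ((if v = u then 1 else 0) + (if v = w then \<epsilon> else 0))"
      unfolding g_def bd_add bd_scale bd_single[OF S(2) b(1)] bdf by simp
    then show ?thesis by (cases "v = u"; cases "v = w") (auto simp: algebra_simps)
  qed
  have gb: "g b = 1" using f(1)[of b] by (simp add: g_def)
  have g0: "g e = 0" if "e \<notin> S" for e
    using that f(1)[of e] b by (auto simp: g_def)
  have abs: "\<bar>g e\<bar> = 1" if "e \<in> S" for e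
  proof -
    have "\<bar>g e\<bar> = \<bar>g b\<bar>"
      by (rule circle_const_abs[OF S _ that b(1), of w]) (simp add: bdg)
    then show ?thesis using gb by simp
  qed
  have wS: "w \<in> vset S" using b by (auto simp: vset_def)
  have sgn: "(\<Prod>e\<in>S. esign \<Sigma> e) = (-1) ^ card {v \<in> vset S. bd S g v \<noteq> 0}"
  proof (intro two_regular_sign S(2) circleD[OF S(1)])
    show "g e = 1 \<or> g e = -1" if "e \<in> S" for e using abs[OF that] by linarith
  qed
  have set: "{v \<in> vset S. bd S g v \<noteq> 0} = (if bd S g w = 0 then {} else {w})"
    using bdg wS by auto
  have "bd S g w = 0" if "(\<Prod>e\<in>S. esign \<Sigma> e) = 1"
    using sgn that set by (auto split: if_splits)
  moreover have "\<bar>bd S g w\<bar> = 2" if "(\<Prod>e\<in>S. esign \<Sigma> e) = -1"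
  proof -
    have "bd S g w \<noteq> 0" using sgn that set by (auto split: if_splits)
    then show ?thesis using bdg[of w] c f(2) tau_cases[OF bE, of i] by auto
  qed
  ultimately show ?thesis using that[of g] abs g0 gb bdg by auto
qed

end

section \<open>Rigid integer flows\<close>

context signed_graph
begin

text \<open>On the circle \<open>f\<close> is a constant absolute value times a sign function. By
  \<open>two_regular_sign\<close> an odd number of vertices has nonzero boundary, and only
  \<open>p\<close> is available; two units that do not cancel add up to plus or minus 2.\<close>

lemma negative_circle_bd:
  assumes S: "is_circle (subgr \<Sigma> S)" "S \<subseteq> edges \<Sigma>" "(\<Prod>e\<in>S. esign \<Sigma> e) = -1"
    and bd: "\<And>v. v \<noteq> p \<Longrightarrow> bd S f v = 0" and b: "b \<in> S" "f b \<noteq> 0"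
  shows "\<bar>bd S f p\<bar> = 2 * \<bar>f b\<bar>"
proof -
  define s where "s = (\<lambda>x. sgn (f x))"
  have const: "\<bar>f x\<bar> = \<bar>f b\<bar>" if "x \<in> S" for x
    by (rule circle_const_abs[OF S(1,2) bd that b(1)])
  have fs: "f x = \<bar>f b\<bar> * s x" if "x \<in> S" for x
    using const[OF that] abs_mult_sgn[of "f x"] by (simp add: s_def)
  have s1: "s x = 1 \<or> s x = -1" if "x \<in> S" for x
    using const[OF that] b(2) by (auto simp: s_def sgn_if)
  have bds: "bd S f v = \<bar>f b\<bar> * bd S s v" for v
    unfolding bd_scale[symmetric] by (rule bd_cong) (rule fs)
  have "bd S s v = 0" if "v \<noteq> p" for v
    using bds[of v] bd[OF that] b(2) by simp
  then have set: "{v \<in> vset S. bd S s v \<noteq> 0} \<subseteq> {p}" by blast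
  have "(-1 :: int) ^ card {v \<in> vset S. bd S s v \<noteq> 0} = -1"
    using two_regular_sign[OF S(2) circleD(2,3)[OF S(1)] s1] S(3) by simp
  then have "card {v \<in> vset S. bd S s v \<noteq> 0} \<noteq> 0"
    by (metis power_0 one_neq_neg_one)
  then have p: "p \<in> vset S" "bd S s p \<noteq> 0" using set by (auto simp: card_eq_0_iff)
  obtain a i c j where "bd S s p = tau a i * s a + tau c j * s c" "a \<in> S" "c \<in> S"
    "tau a i = 1 \<or> tau a i = -1" "tau c j = 1 \<or> tau c j = -1"
    using deg2_bd[OF S(2) circleD(3)[OF S(1) p(1)]] by metis
  then have "\<bar>bd S s p\<bar> = 2" using p(2) s1[of a] s1[of c] by auto
  then show ?thesis by (simp add: bds abs_mult)
qed

section \<open>Values meeting at a vertex, and parity\<close>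

lemma deg_empty: "deg {} v = 0"
  by (simp add: deg_def ends_def)

lemma deg_class:
  "deg {b \<in> C. P b} v = card {x \<in> ends C v. P (fst x)}"
  unfolding deg_def by (rule arg_cong[of _ _ card]) (auto simp: ends_def)

text \<open>Three nonzero values that cancel up to signs: the largest absolute value is the sum of
  the other two. If \<open>m = n\<close>, their common class has degree 2 at
  \<open>p\<close>.\<close>

lemma deg3_classes:
  assumes C: "C \<subseteq> edges \<Sigma>" "deg C p = 3" and bd: "bd C f p = 0" and nz: "\<And>b. b \<in> C \<Longrightarrow> f b \<noteq> 0"
  obtains m n where "m > 0" "n > 0"
    "\<And>k. deg {b \<in> C. \<bar>f b\<bar> = k} p = (if k = m then 1 else 0) + (if k = n then 1 else 0) + (if k = m + n then 1 else 0)"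
proof -
  obtain x y z where xyz: "ends C p = {x, y, z}" "x \<noteq> y" "y \<noteq> z" "x \<noteq> z"
    using C(2) unfolding deg_def card_3_iff by blast
  obtain a i where x: "x = (a, i)" by (cases x)
  obtain b j where y: "y = (b, j)" by (cases y)
  obtain c l where z: "z = (c, l)" by (cases z)
  have "(a, i) \<in> ends C p" "(b, j) \<in> ends C p" "(c, l) \<in> ends C p"
    using xyz x y z by auto
  then have C3: "a \<in> C" "b \<in> C" "c \<in> C" by (auto simp: ends_def)
  have "bd C f p = tau a i * f a + (tau b j * f b + tau c l * f c)"
    unfolding bd_ends[OF C(1)] xyz(1) using xyz(2-4) x y z by simp
  then have sum0: "tau a i * f a + (tau b j * f b + tau c l * f c) = 0"
    using bd by simp
  have t: "tau a i = 1 \<or> tau a i = -1" "tau b j = 1 \<or> tau b j = -1" "tau c l = 1 \<or> tau c l = -1"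
    using tau_cases C3 C(1) by blast+
  have nz3: "f a \<noteq> 0" "f b \<noteq> 0" "f c \<noteq> 0" using nz C3 by auto
  have cnt: "deg {b \<in> C. \<bar>f b\<bar> = k} p =
      (if k = \<bar>f a\<bar> then 1 else 0) + (if k = \<bar>f b\<bar> then 1 else 0) + (if k = \<bar>f c\<bar> then 1 else 0)" for k
  proof -
    have "{w \<in> ends C p. \<bar>f (fst w)\<bar> = k} =
        (if k = \<bar>f a\<bar> then {x} else {}) \<union> (if k = \<bar>f b\<bar> then {y} else {}) \<union> (if k = \<bar>f c\<bar> then {z} else {})"
      unfolding xyz(1) using x y z by auto
    then show ?thesis unfolding deg_class using xyz(2-4) by auto
  qed
  have "\<bar>f a\<bar> = \<bar>f b\<bar> + \<bar>f c\<bar> \<or> \<bar>f b\<bar> = \<bar>f a\<bar> + \<bar>f c\<bar> \<or> \<bar>f c\<bar> = \<bar>f a\<bar> + \<bar>f b\<bar>"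
    using sum0 t by (elim disjE) (simp, linarith)+
  then show ?thesis
  proof (elim disjE)
    assume *: "\<bar>f a\<bar> = \<bar>f b\<bar> + \<bar>f c\<bar>"
    show ?thesis by (rule that[of "\<bar>f b\<bar>" "\<bar>f c\<bar>"]) (use nz3 cnt * in auto)
  next
    assume *: "\<bar>f b\<bar> = \<bar>f a\<bar> + \<bar>f c\<bar>"
    show ?thesis by (rule that[of "\<bar>f a\<bar>" "\<bar>f c\<bar>"]) (use nz3 cnt * in auto)
  next
    assume *: "\<bar>f c\<bar> = \<bar>f a\<bar> + \<bar>f b\<bar>"
    show ?thesis by (rule that[of "\<bar>f a\<bar>" "\<bar>f b\<bar>"]) (use nz3 cnt * in auto)
  qed
qed

text \<open>The degree sum is even, so the parities at the two exceptional vertices agree.\<close>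

lemma even_deg_all2:
  assumes "S \<subseteq> edges \<Sigma>" "\<And>e. e \<in> S \<Longrightarrow> \<not> outer_edge \<Sigma> e" "p \<noteq> q"
    "\<And>v. v \<noteq> p \<Longrightarrow> v \<noteq> q \<Longrightarrow> even (deg S v)"
  shows "even (deg S p) \<longleftrightarrow> even (deg S q)"
proof -
  define W where "W = insert p (insert q (vset S))"
  have fin: "finite W" using finite_vset assms by (simp add: W_def)
  have "(\<Sum>v\<in>W. deg S v) = 2 * card S"
    by (rule handshake_no_outer) (use assms fin in \<open>auto simp: W_def\<close>)
  moreover have "(\<Sum>v\<in>W. deg S v) = deg S p + (\<Sum>v\<in>W - {p}. deg S v)"
    using fin by (rule sum.remove) (simp add: W_def)
  moreover have "(\<Sum>v\<in>W - {p}. deg S v) = deg S q + (\<Sum>v\<in>W - {p} - {q}. deg S v)"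
    by (rule sum.remove) (use fin assms(3) in \<open>auto simp: W_def\<close>)
  moreover have "even (\<Sum>v\<in>W - {p} - {q}. deg S v)"
    using assms(4) by (intro dvd_sum) auto
  ultimately show ?thesis
    by (metis dvd_triv_left even_add)
qed

end

text \<open>This isolates what is used about the fundamental flow of an edge \<open>e\<close>: it is
  normalised at \<open>e\<close>, flows on its support are determined by their value at
  \<open>e\<close>, and the support has at most one edge more than it has vertices. The base itself
  no longer appears.\<close>

locale rigid_flow = signed_graph \<Sigma> for \<Sigma> :: "('v, 'e) sgraph" +
  fixes C :: "'e set" and g :: "'e \<Rightarrow> int" and e :: 'e
  assumes C: "C \<subseteq> edges \<Sigma>" and e: "e \<in> C" and supp: "\<And>b. g b \<noteq> 0 \<longleftrightarrow> b \<in> C"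
    and flow: "\<And>v. bd C g v = 0" and ge: "\<bar>g e\<bar> = 1" and cyc: "card C \<le> card (vset C) + 1"
    and rigid: "\<And>h b. (\<And>b. b \<notin> C \<Longrightarrow> h b = 0) \<Longrightarrow> (\<And>v. bd C h v = 0) \<Longrightarrow> h e = 0 \<Longrightarrow> h b = 0"
begin

lemma sub_edges: "X \<subseteq> C \<Longrightarrow> X \<subseteq> edges \<Sigma>"
  using C by blast

lemma flow_multiple:
  assumes "\<And>b. b \<notin> C \<Longrightarrow> h b = 0" "\<And>v. bd C h v = 0"
  obtains k where "\<And>b. h b = k * g b"
proof -
  \<comment> \<open>\<open>g e\<close> is plus or minus 1, hence its own inverse, and
    \<open>h e * g e\<close> is the quotient.\<close>
  define k where "k = h e * g e"
  have "h b - k * g b = 0" for b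
  proof (rule rigid[of "\<lambda>b. h b - k * g b"])
    show "h b - k * g b = 0" if "b \<notin> C" for b using assms(1)[OF that] supp[of b] that by simp
    show "bd C (\<lambda>b. h b - k * g b) v = 0" for v
      by (simp add: bd_diff bd_scale assms flow)
    have "g e * g e = 1" using ge by (metis abs_mult_self_eq mult_1)
    then show "h e - k * g e = 0" by (simp add: k_def mult.assoc)
  qed
  then show ?thesis using that[of k] by simp
qed

text \<open>Extended by zero, \<open>h\<close> is a nonzero multiple of \<open>g\<close>, whose
  support is all of \<open>C\<close>.\<close>

lemma support_minimal:
  assumes "X \<subseteq> C" "X \<noteq> {}" "\<And>b. b \<in> X \<Longrightarrow> h b \<noteq> 0" "\<And>v. bd X h v = 0"
  shows "X = C"
proof -
  let ?h = "\<lambda>b. if b \<in> X then h b else 0"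
  have "bd C ?h v = 0" for v
  proof -
    have "bd C ?h v = bd X ?h v" by (rule bd_superset) (use C assms in auto)
    also have "\<dots> = bd X h v" by (rule bd_cong) simp
    finally show ?thesis using assms by simp
  qed
  then obtain k where k: "\<And>b. ?h b = k * g b"
    using flow_multiple[of ?h] assms(1) by (metis subsetD)
  obtain x where x: "x \<in> X" using assms by blast
  then have "k \<noteq> 0" using k[of x] assms(3)[OF x] by auto
  then have "?h b \<noteq> 0" if "b \<in> C" for b using k[of b] supp[of b] that by simp
  then have "C \<subseteq> X" by (metis subsetI)
  then show ?thesis using assms(1) by blast
qed

text \<open>A part sharing no vertex with the rest inherits conservation from \<open>g\<close>, so
  minimality of the support applies.\<close>

lemma part_eq:
  assumes "X \<subseteq> C" "X \<noteq> {}" "\<And>v. v \<in> vset X \<Longrightarrow> v \<notin> vset (C - X)"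
  shows "X = C"
proof (rule support_minimal[OF assms(1,2), of g])
  show "g b \<noteq> 0" if "b \<in> X" for b using that assms(1) supp by blast
  show "bd X g v = 0" for v
  proof (cases "v \<in> vset X")
    case True
    then show ?thesis using bd_split[OF C assms(1), of g v] flow[of v] bd_not_vset assms(3) by simp
  qed (simp add: bd_not_vset)
qed

lemma connected: "sconnected (subgr \<Sigma> C)"
proof -
  obtain u where u: "u \<in> vset C" using vset_nonempty[OF C] e by blast
  obtain X where X: "X \<subseteq> C" "u \<in> vset X" "sconnected (subgr \<Sigma> X)" "vset X \<inter> vset (C - X) = {}"
    using component_split[OF C u] by metis
  have "X = C" by (rule part_eq) (use X in \<open>auto simp: vset_def\<close>)
  then show ?thesis using X by simp
qed

text \<open>A lone edge end would force the value of its edge to be zero.\<close>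

lemma deg_ge2: "v \<in> vset C \<Longrightarrow> 2 \<le> deg C v"
proof (rule ccontr)
  assume v: "v \<in> vset C" "\<not> 2 \<le> deg C v"
  then have "deg C v = 1" using deg_0_iff[OF C, of v] by linarith
  moreover obtain a i where a: "a \<in> C" "att \<Sigma> a i = Some v" using v unfolding vset_def by blast
  ultimately have "\<bar>g a\<bar> = 0" using deg1_bd(2)[OF C] flow[of v] by (metis abs_0)
  then show False using a supp by auto
qed

section \<open>Branch vertices of a rigid flow\<close>

definition outs :: nat where "outs = card {b \<in> C. outer_edge \<Sigma> b}"

text \<open>By the handshake this sum is twice the difference between the numbers of edges and
  vertices; being even and at most 2, it has only these values. Branching therefore means one vertex
  of degree 4, two of degree 3, or one of degree 3 together with one outer-edge.\<close>

lemma excess: "(\<Sum>v\<in>vset C. deg C v - 2) + outs = 0 \<or> (\<Sum>v\<in>vset C. deg C v - 2) + outs = 2"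
proof -
  have "(\<Sum>v\<in>vset C. deg C v) = (\<Sum>v\<in>vset C. (deg C v - 2) + 2)"
  proof (rule sum.cong)
    show "deg C v = deg C v - 2 + 2" if "v \<in> vset C" for v
      using deg_ge2[OF that] by simp
  qed simp
  also have "\<dots> = (\<Sum>v\<in>vset C. deg C v - 2) + 2 * card (vset C)"
    by (simp only: sum.distrib sum_constant mult.commute of_nat_id)
  finally have "(\<Sum>v\<in>vset C. deg C v - 2) + 2 * card (vset C) + outs = 2 * card C"
    using handshake[OF C] by (simp add: outs_def)
  then show ?thesis using cyc by presburger
qed

text \<open>Away from the branch vertices, edges of a class defined by absolute values do not meet
  edges outside it, so \<open>g\<close> restricted to the class still satisfies conservation
  there.\<close>

lemma off_branch:
  assumes "deg C v = 2 \<or> v \<notin> vset C"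
  shows "deg {b \<in> C. P \<bar>g b\<bar>} v = 0 \<or> deg {b \<in> C. P \<bar>g b\<bar>} v = 2 \<and> v \<notin> vset (C - {b \<in> C. P \<bar>g b\<bar>})"
    and "bd {b \<in> C. P \<bar>g b\<bar>} g v = 0"
proof -
  let ?Z = "{b \<in> C. P \<bar>g b\<bar>}"
  have Z: "?Z \<subseteq> C" by blast
  show 1: "deg ?Z v = 0 \<or> deg ?Z v = 2 \<and> v \<notin> vset (C - ?Z)"
  proof (cases "v \<in> vset C")
    case True
    then show ?thesis using class_deg[OF C _ flow[of v], of P] assms by blast
  next
    case False
    then have "v \<notin> vset ?Z" using vset_mono[OF Z] by blast
    then show ?thesis using deg_0_iff[OF sub_edges[OF Z]] by blast
  qed
  show "bd ?Z g v = 0"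
  proof (cases "v \<in> vset ?Z")
    case True
    then have "v \<notin> vset (C - ?Z)" using 1 deg_0_iff[OF sub_edges[OF Z]] by blast
    then show ?thesis using bd_split[OF C Z, of g v] flow[of v] bd_not_vset by simp
  qed (simp add: bd_not_vset)
qed

abbreviation ones :: "'e set" where "ones \<equiv> {b \<in> C. \<bar>g b\<bar> = 1}"

lemma e_ones: "e \<in> ones"
  using e ge by simp

text \<open>By connectivity the class of value 1 meets the rest somewhere, and at a vertex of degree
  2 the absolute value cannot change.\<close>

lemma branch_vertex:
  assumes "ones \<noteq> C"
  obtains p where "p \<in> vset ones" "p \<in> vset (C - ones)" "3 \<le> deg C p"
proof -
  have "ones \<noteq> {}" using e_ones by blast
  then obtain p where p: "p \<in> vset ones" "p \<in> vset (C - ones)"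
    using connected_meet[OF connected C, of ones] assms by blast
  have pC: "p \<in> vset C" using p(1) vset_mono[of ones C] by blast
  have "deg C p \<noteq> 2"
  proof
    assume "deg C p = 2"
    then have "deg ones p = 0" using off_branch(1)[of p "\<lambda>x. x = 1"] p(2) by blast
    then show False using p(1) deg_0_iff[of ones p] C by blast
  qed
  then have "3 \<le> deg C p" using deg_ge2[OF pC] by simp
  then show ?thesis using that p by blast
qed

lemma excess_at:
  assumes "p \<in> vset C"
  shows "(\<Sum>v\<in>vset C. deg C v - 2) = (deg C p - 2) + (\<Sum>v\<in>vset C - {p}. deg C v - 2)"
  using sum.remove[OF finite_vset[OF C] assms] .

lemma deg2_of_no_excess:
  assumes "(\<Sum>v\<in>vset C - A. deg C v - 2) = 0" "v \<notin> A"
  shows "deg C v = 2 \<or> v \<notin> vset C"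
proof -
  have fin: "finite (vset C - A)" using finite_vset[OF C] by simp
  show ?thesis
  proof (cases "v \<in> vset C")
    case True
    then have "deg C v - 2 = 0" using assms fin by (simp add: sum_eq_0_iff)
    then show ?thesis using deg_ge2[OF True] by simp
  qed simp
qed

lemma no_outs: "outs = 0 \<Longrightarrow> b \<in> C \<Longrightarrow> \<not> outer_edge \<Sigma> b"
  using finite_sub[OF C] by (auto simp: outs_def)

text \<open>By parity both \<open>ones\<close> and its complement have degree 2 at \<open>p\<close>.
  The boundary of \<open>ones\<close> is then 0 or plus or minus 2, that of the rest 0 or plus or
  minus \<open>2 * g c\<close> with \<open>g c\<close> not plus or minus 1; they can cancel only if
  both vanish, and then \<open>ones\<close> carries a smaller flow.\<close>

lemma no_single_branch:
  assumes p: "p \<in> vset ones" "p \<in> vset (C - ones)" and "deg C p = 4" "outs = 0"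
    and off: "\<And>v. v \<noteq> p \<Longrightarrow> deg C v = 2 \<or> v \<notin> vset C"
  shows False
proof -
  let ?D = "C - ones"
  have sub: "ones \<subseteq> C" "?D \<subseteq> C" by blast+
  have ev: "even (deg {b \<in> C. P \<bar>g b\<bar>} p)" for P
  proof (rule even_deg_all)
    show "{b \<in> C. P \<bar>g b\<bar>} \<subseteq> edges \<Sigma>" using C by blast
    show "\<not> outer_edge \<Sigma> b" if "b \<in> {b \<in> C. P \<bar>g b\<bar>}" for b using that no_outs assms(4) by blast
    show "even (deg {b \<in> C. P \<bar>g b\<bar>} v)" if "v \<noteq> p" for v
      using off_branch(1)[OF off[OF that], of P] by auto
  qed
  have dsum: "deg ones p + deg ?D p = 4" using deg_split[OF C sub(1), of p] assms(3) by simp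
  have "deg ones p \<noteq> 0" "deg ?D p \<noteq> 0"
    using p deg_0_iff sub_edges[OF sub(1)] sub_edges[OF sub(2)] by blast+
  moreover have "even (deg ones p)" using ev[of "\<lambda>x. x = 1"] .
  ultimately have d2: "deg ones p = 2" "deg ?D p = 2" using dsum by presburger+
  obtain a i b j where ab': "ends ones p = {(a, i), (b, j)}" "(a, i) \<noteq> (b, j)"
    "\<And>f. bd ones f p = tau a i * f a + tau b j * f b" "a \<in> ones" "b \<in> ones"
    "tau a i = 1 \<or> tau a i = -1" "tau b j = 1 \<or> tau b j = -1"
    by (rule deg2_bd[OF sub_edges[OF sub(1)] d2(1)]) (rule that, assumption+)
  note ab = ab'(3)[of g] ab'(4-7)
  obtain c k d l where cd': "ends ?D p = {(c, k), (d, l)}" "(c, k) \<noteq> (d, l)"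
    "\<And>f. bd ?D f p = tau c k * f c + tau d l * f d" "c \<in> ?D" "d \<in> ?D"
    "tau c k = 1 \<or> tau c k = -1" "tau d l = 1 \<or> tau d l = -1"
    by (rule deg2_bd[OF sub_edges[OF sub(2)] d2(2)]) (rule that, assumption+)
  note cd = cd'(3)[of g] cd'(4-7) cd'(1,2)
  \<comment> \<open>Otherwise the class of \<open>\<bar>g c\<bar>\<close> would have exactly one end
    at \<open>p\<close>, against parity.\<close>
  have "\<bar>g d\<bar> = \<bar>g c\<bar>"
  proof (rule ccontr)
    assume ne: "\<bar>g d\<bar> \<noteq> \<bar>g c\<bar>"
    have "{x \<in> ends C p. \<bar>g (fst x)\<bar> = \<bar>g c\<bar>} = {(c, k)}"
    proof -
      have "ends C p = ends ones p \<union> {(c, k), (d, l)}" using ends_split[OF sub(1), of p] cd(6) by simp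
      moreover have "\<bar>g (fst x)\<bar> \<noteq> \<bar>g c\<bar>" if "x \<in> ends ones p" for x
        using that cd(2) by (auto simp: ends_def)
      ultimately show ?thesis using ne by auto
    qed
    then have "deg {b \<in> C. \<bar>g b\<bar> = \<bar>g c\<bar>} p = 1" unfolding deg_class by simp
    then show False using ev[of "\<lambda>x. x = \<bar>g c\<bar>"] by simp
  qed
  then have "g d = g c \<or> g d = - g c" by linarith
  then have s2: "bd ?D g p = 0 \<or> \<bar>bd ?D g p\<bar> = 2 * \<bar>g c\<bar>"
    unfolding cd(1) using cd(4,5) by (elim disjE) (simp_all add: abs_mult)
  have "\<bar>g a\<bar> = 1" "\<bar>g b\<bar> = 1" using ab by auto
  then have "g a = 1 \<or> g a = -1" "g b = 1 \<or> g b = -1" by linarith+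
  then have s1: "bd ones g p = 0 \<or> \<bar>bd ones g p\<bar> = 2"
    unfolding ab(1) using ab(4,5) by (elim disjE) simp_all
  have "\<bar>g c\<bar> \<noteq> 1" using cd(2) by auto
  moreover have "bd ones g p + bd ?D g p = 0" using bd_split[OF C sub(1), of g p] flow by simp
  ultimately have "bd ones g p = 0"
    using s1 s2 by linarith
  then have "bd ones g v = 0" for v
    using off_branch(2)[OF off, of v "\<lambda>x. x = 1"] by (cases "v = p") auto
  then have "ones = C"
    using e_ones supp by (intro support_minimal[of _ g]) auto
  then show False using p by (auto simp: vset_def)
qed

text \<open>The classes of values 1 and 2 already use up the three ends at each vertex of
  \<open>A\<close>, and elsewhere classes do not meet. Edges with other values would thus form a
  detached part, hence all of \<open>C\<close>, although \<open>e\<close> has value 1.\<close>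

lemma other_values_empty:
  assumes "\<And>v. v \<notin> A \<Longrightarrow> deg C v = 2 \<or> v \<notin> vset C"
    and "\<And>v. v \<in> A \<Longrightarrow> deg C v = 3 \<and> deg ones v = 2 \<and> deg {b \<in> C. \<bar>g b\<bar> = 2} v = 1"
  shows "b \<in> C \<Longrightarrow> \<bar>g b\<bar> = 1 \<or> \<bar>g b\<bar> = 2"
proof -
  let ?P = "\<lambda>x. x \<noteq> 1 \<and> x \<noteq> (2 :: int)"
  let ?Z = "{b \<in> C. ?P \<bar>g b\<bar>}"
  assume b: "b \<in> C"
  have "?Z = {}"
  proof (rule ccontr)
    assume ne: "?Z \<noteq> {}"
    have "?Z = C"
    proof (rule part_eq[OF _ ne])
      fix v assume v: "v \<in> vset ?Z"
      show "v \<notin> vset (C - ?Z)"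
      proof (cases "v \<in> A")
        case False
        then show ?thesis using off_branch(1)[OF assms(1), of v ?P] v deg_0_iff[of ?Z v] C by blast
      next
        case True
        have "deg C v = card ({x \<in> ends C v. \<bar>g (fst x)\<bar> = 1} \<union> {x \<in> ends C v. \<bar>g (fst x)\<bar> = 2} \<union> {x \<in> ends C v. ?P \<bar>g (fst x)\<bar>})"
          unfolding deg_def by (rule arg_cong[of _ _ card]) auto
        also have "\<dots> = deg ones v + deg {b \<in> C. \<bar>g b\<bar> = 2} v + deg ?Z v"
          unfolding deg_class using finite_ends[OF C, of v]
          by (subst card_Un_disjoint; (subst card_Un_disjoint)?; force)
        finally have "deg ?Z v = 0" using assms(2)[OF True] by simp
        then show ?thesis using v deg_0_iff[of ?Z v] C by blast
      qed
    qed blast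
    then show False using e_ones by auto
  qed
  then show ?thesis using b by blast
qed

text \<open>Only the class containing the outer-edge can have odd degree at \<open>p\<close>. If
  \<open>m\<close> and \<open>n\<close> differed, both of their classes would be odd; so they agree,
  the values at \<open>p\<close> are \<open>m\<close> and \<open>2 * m\<close>, and since 1 occurs
  among them, \<open>m\<close> is 1.\<close>

lemma outer_branch:
  assumes p: "p \<in> vset ones" and "deg C p = 3" "outs = 1"
    and off: "\<And>v. v \<noteq> p \<Longrightarrow> deg C v = 2 \<or> v \<notin> vset C"
  shows "deg ones p = 2" "deg {b \<in> C. \<bar>g b\<bar> = 2} p = 1"
proof -
  have nz: "g b \<noteq> 0" if "b \<in> C" for b using supp that by blast
  obtain m n where mn: "m > 0" "n > 0"
    "\<And>k. deg {b \<in> C. \<bar>g b\<bar> = k} p = (if k = m then 1 else 0) + (if k = n then 1 else 0) + (if k = m + n then 1 else 0)"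
    using deg3_classes[OF C assms(2) flow nz] by blast
  obtain b0 where b0: "{b \<in> C. outer_edge \<Sigma> b} = {b0}"
    using assms(3) unfolding outs_def by (metis card_1_singletonE)
  have ev: "even (deg {b \<in> C. \<bar>g b\<bar> = k} p)" if "k \<noteq> \<bar>g b0\<bar>" for k
  proof (rule even_deg_all)
    show "{b \<in> C. \<bar>g b\<bar> = k} \<subseteq> edges \<Sigma>" using C by blast
    show "\<not> outer_edge \<Sigma> b" if b: "b \<in> {b \<in> C. \<bar>g b\<bar> = k}" for b
    proof
      assume "outer_edge \<Sigma> b"
      then have "b \<in> {b \<in> C. outer_edge \<Sigma> b}" using b by blast
      then show False using b \<open>k \<noteq> \<bar>g b0\<bar>\<close> unfolding b0 by simp
    qed
    show "even (deg {b \<in> C. \<bar>g b\<bar> = k} v)" if "v \<noteq> p" for v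
      using off_branch(1)[OF off[OF that], of "\<lambda>x. x = k"] by auto
  qed
  have "m = n"
  proof (rule ccontr)
    assume "m \<noteq> n"
    then have "odd (deg {b \<in> C. \<bar>g b\<bar> = m} p)" "odd (deg {b \<in> C. \<bar>g b\<bar> = n} p)"
      using mn by auto
    then have "m = \<bar>g b0\<bar>" "n = \<bar>g b0\<bar>" using ev by blast+
    then show False using \<open>m \<noteq> n\<close> by simp
  qed
  moreover have "deg ones p \<noteq> 0" using p deg_0_iff[of ones p] C by blast
  ultimately have "m = 1" "n = 1" using mn(1,2) mn(3)[of 1] by (auto split: if_splits)
  then show "deg ones p = 2" "deg {b \<in> C. \<bar>g b\<bar> = 2} p = 1"
    using mn(3)[of 1] mn(3)[of 2] by auto
qed

text \<open>If three different values met at \<open>p\<close>, the classes would be three paths from \<open>p\<close> to \<open>q\<close>;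
  two of them have the same sign and form a smaller flow.\<close>

lemma inner_branch:
  assumes p: "p \<in> vset ones" and "p \<noteq> q" "deg C p = 3" "deg C q = 3" "outs = 0"
    and off: "\<And>v. v \<noteq> p \<Longrightarrow> v \<noteq> q \<Longrightarrow> deg C v = 2 \<or> v \<notin> vset C"
  shows "deg ones p = 2" "deg {b \<in> C. \<bar>g b\<bar> = 2} p = 1" "deg ones q = 2" "deg {b \<in> C. \<bar>g b\<bar> = 2} q = 1"
proof -
  let ?Z = "\<lambda>k. {b \<in> C. \<bar>g b\<bar> = k}"
  have nz: "g b \<noteq> 0" if "b \<in> C" for b using supp that by blast
  obtain m n where mn: "m > 0" "n > 0"
    "\<And>k. deg (?Z k) p = (if k = m then 1 else 0) + (if k = n then 1 else 0) + (if k = m + n then 1 else 0)"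
    using deg3_classes[OF C assms(3) flow nz] by blast
  obtain m' n' where mn': "m' > 0" "n' > 0"
    "\<And>k. deg (?Z k) q = (if k = m' then 1 else 0) + (if k = n' then 1 else 0) + (if k = m' + n' then 1 else 0)"
    using deg3_classes[OF C assms(4) flow nz] by blast
  have par: "even (deg (?Z k) p) \<longleftrightarrow> even (deg (?Z k) q)" for k
  proof (rule even_deg_all2)
    show "?Z k \<subseteq> edges \<Sigma>" using C by blast
    show "\<not> outer_edge \<Sigma> b" if "b \<in> ?Z k" for b using that no_outs assms(5) by blast
    show "even (deg (?Z k) v)" if "v \<noteq> p" "v \<noteq> q" for v
      using off_branch(1)[OF off[OF that], of "\<lambda>x. x = k"] by auto
  qed (rule assms(2))
  have eq: "m = n"
  proof (rule ccontr)
    assume ne: "m \<noteq> n"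
    have at_p: "deg (?Z m) p = 1" "deg (?Z n) p = 1" "deg (?Z (m + n)) p = 1"
      using ne mn by auto
    have "odd (deg (?Z m) q)" "odd (deg (?Z n) q)" "odd (deg (?Z (m + n)) q)"
      using par[of m] par[of n] par[of "m + n"] at_p by auto
    moreover have "deg (?Z k) q \<le> 2" for k using mn' by auto
    moreover have "d = 1" if "odd d" "d \<le> 2" for d :: nat using that by (cases d) auto
    ultimately have at_q: "deg (?Z m) q = 1" "deg (?Z n) q = 1" "deg (?Z (m + n)) q = 1"
      by blast+
    have end_bd: "\<bar>bd (?Z k) g v\<bar> = k" if "deg (?Z k) v = 1" for k v
    proof -
      have ZE: "?Z k \<subseteq> edges \<Sigma>" using C by blast
      have "v \<in> vset (?Z k)" using that deg_0_iff[OF ZE, of v] by (metis one_neq_zero)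
      then obtain a i where a: "a \<in> ?Z k" "att \<Sigma> a i = Some v" unfolding vset_def by blast
      show ?thesis using deg1_bd(2)[OF ZE that a, of g] a(1) by simp
    qed
    have comb: False
      if kl: "k \<noteq> l" "k > 0" "l > 0" "deg (?Z k) p = 1" "deg (?Z l) p = 1"
        and sgn: "bd (?Z k) g p * bd (?Z l) g q = bd (?Z l) g p * bd (?Z k) g q"
        and j: "j \<noteq> k" "j \<noteq> l" "deg (?Z j) p = 1" for k l j
    proof -
      define \<alpha> where "\<alpha> = bd (?Z k) g p"
      define \<beta> where "\<beta> = bd (?Z l) g p"
      have ab: "\<alpha> \<noteq> 0" "\<beta> \<noteq> 0" using end_bd[OF kl(4)] end_bd[OF kl(5)] kl(2,3) by (auto simp: \<alpha>_def \<beta>_def)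
      \<comment> \<open>Crosswise multiplication by the boundaries at \<open>p\<close> makes the
        combination conserved there; the assumption \<open>sgn\<close> makes it conserved at
        \<open>q\<close>.\<close>
      define h where "h = (\<lambda>b. if \<bar>g b\<bar> = k then \<beta> * g b else - \<alpha> * g b)"
      let ?X = "?Z k \<union> ?Z l"
      have XE: "?X \<subseteq> edges \<Sigma>" "?Z k \<subseteq> ?X" using C by blast+
      have XD: "?X - ?Z k = ?Z l" using kl(1) by auto
      have bdh: "bd ?X h v = \<beta> * bd (?Z k) g v - \<alpha> * bd (?Z l) g v" for v
      proof -
        have "bd (?Z k) h v = bd (?Z k) (\<lambda>b. \<beta> * g b) v"
          by (rule bd_cong) (simp add: h_def)
        moreover have "bd (?Z l) h v = bd (?Z l) (\<lambda>b. - \<alpha> * g b) v"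
          by (rule bd_cong) (use kl(1) in \<open>auto simp: h_def\<close>)
        ultimately show ?thesis
          using bd_split[OF XE, of h v] unfolding XD bd_scale by simp
      qed
      have "bd ?X h v = 0" for v
      proof (cases "v = p \<or> v = q")
        case True
        then show ?thesis using sgn by (auto simp: bdh \<alpha>_def \<beta>_def mult.commute)
      next
        case False
        then show ?thesis
          using off_branch(2)[OF off, of v "\<lambda>x. x = k"] off_branch(2)[OF off, of v "\<lambda>x. x = l"]
          by (simp add: bdh)
      qed
      moreover have "h b \<noteq> 0" if "b \<in> ?X" for b
        using that ab nz by (auto simp: h_def)
      moreover have "?X \<noteq> {}"
      proof
        assume "?X = {}"
        then have "?Z k = {}" by blast
        then have "deg (?Z k) p = 0" using deg_empty by metis
        then show False using kl(4) by simp
      qed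
      ultimately have "?X = C" by (intro support_minimal[of _ h]) auto
      then have "?Z j = {}" using j(1,2) by auto
      then have "deg (?Z j) p = 0" using deg_empty by metis
      then show False using j(3) by simp
    qed
    define r where "r = (\<lambda>k. bd (?Z k) g p * bd (?Z k) g q)"
    have pm: "bd (?Z k) g q = bd (?Z k) g p \<or> bd (?Z k) g q = - bd (?Z k) g p"
      if "deg (?Z k) p = 1" "deg (?Z k) q = 1" for k
      using end_bd[OF that(1)] end_bd[OF that(2)] by linarith
    have c3: "m \<noteq> m + n" "n \<noteq> m + n" "m + n > 0" using mn by auto
    \<comment> \<open>Each class has equal or opposite boundaries at \<open>p\<close> and
      \<open>q\<close>. Of three classes two behave alike, and \<open>comb\<close> excludes every
      such pair.\<close>
    show False
      using pm[OF at_p(1) at_q(1)] pm[OF at_p(2) at_q(2)] pm[OF at_p(3) at_q(3)]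
        comb[OF ne mn(1,2) at_p(1,2) _ c3(1)[symmetric] c3(2)[symmetric] at_p(3)]
        comb[OF c3(1) mn(1) c3(3) at_p(1,3) _ ne[symmetric] c3(2) at_p(2)]
        comb[OF c3(2) mn(2) c3(3) at_p(2,3) _ ne c3(1) at_p(1)]
      by (elim disjE) simp_all
  qed
  have "m' = n'"
  proof (rule ccontr)
    assume ne: "m' \<noteq> n'"
    have "odd (deg (?Z m') q)" "odd (deg (?Z n') q)" using ne mn' by auto
    then have "odd (deg (?Z m') p)" "odd (deg (?Z n') p)" using par by blast+
    then have "m' = m + n" "n' = m + n" using mn(3)[of m'] mn(3)[of n'] eq by (auto split: if_splits)
    then show False using ne by simp
  qed
  \<comment> \<open>With \<open>m = n\<close> the class of \<open>m + n\<close> is the only one of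
    odd degree at \<open>p\<close>, and likewise for the primed values at \<open>q\<close>; parity
    matches the two sums.\<close>
  have "odd (deg (?Z (m + n)) p)" using mn eq by simp
  then have "odd (deg (?Z (m + n)) q)" using par by blast
  then have "m + n = m' + n'" using mn'(3)[of "m + n"] \<open>m' = n'\<close> by (auto split: if_splits)
  then have eq': "m' = m" "n' = m" using \<open>m' = n'\<close> eq by auto
  have "deg ones p \<noteq> 0" using p deg_0_iff[of ones p] C by blast
  then have "m = 1" using mn(1,2) mn(3)[of 1] eq by (auto split: if_splits)
  then show "deg ones p = 2" "deg (?Z 2) p = 1" "deg ones q = 2" "deg (?Z 2) q = 1"
    using mn(3)[of 1] mn(3)[of 2] mn'(3)[of 1] mn'(3)[of 2] eq eq' by auto
qed

end

section \<open>Double edges of circuits\<close>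

context signed_graph
begin

lemma verts_subgr: "verts (subgr \<Sigma> S) = vset S"
  by (simp add: subgr_def vset_def)

lemma vdegree_subgr: "vdegree (subgr \<Sigma> S) v = deg S v"
  by (simp add: subgr_def vdegree_def deg_def ends_def)

lemma outer_edges_subgr: "outer_edges (subgr \<Sigma> S) = {b \<in> S. outer_edge \<Sigma> b}"
  by (simp add: subgr_def outer_edges_def outer_edge_def)

lemma negative_circles_iff:
  "S \<in> negative_circles \<Sigma> \<longleftrightarrow> S \<subseteq> edges \<Sigma> \<and> is_circle (subgr \<Sigma> S) \<and> (\<Prod>e\<in>S. esign \<Sigma> e) = -1"
  by (auto simp: negative_circles_def circles_def)

lemma component_piece:
  assumes "S \<subseteq> edges \<Sigma>" "u \<in> vset S"
  obtains X where "X \<subseteq> S" "u \<in> vset X" "sconnected (subgr \<Sigma> X)" "vset X \<inter> vset (S - X) = {}"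
proof -
  obtain X where "X \<subseteq> S" "u \<in> vset X" "sconnected (subgr \<Sigma> X)" "vset X \<inter> vset (S - X) = {}"
    using component_split[OF assms] by metis
  then show ?thesis by (rule that)
qed

lemma double_edge_halfI:
  assumes "C1 \<in> negative_circles \<Sigma>" "H \<subseteq> edges \<Sigma>" "C = C1 \<union> H" "half_line (subgr \<Sigma> H) p"
    "vset C1 \<inter> vset H = {p}" "b \<in> H"
  shows "double_edge \<Sigma> C b"
  unfolding double_edge_def verts_subgr
  by (intro disjI1 bexI[OF _ assms(1)] exI[of _ H] exI[of _ p] conjI assms)

lemma double_edge_lineI:
  assumes "C1 \<in> negative_circles \<Sigma>" "C2 \<in> negative_circles \<Sigma>" "P \<subseteq> edges \<Sigma>" "C = C1 \<union> P \<union> C2"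
    "line_segment (subgr \<Sigma> P) p q" "vset C1 \<inter> vset C2 = {}" "vset C1 \<inter> vset P = {p}"
    "vset C2 \<inter> vset P = {q}" "b \<in> P"
  shows "double_edge \<Sigma> C b"
  unfolding double_edge_def verts_subgr
  by (intro disjI2 bexI[OF _ assms(1)] bexI[OF _ assms(2)] exI[of _ P] exI[of _ p] exI[of _ q] conjI assms)

text \<open>The definition of double edges restricts only the vertices shared by circle and path. A
  common edge would have both ends at \<open>p\<close>, giving \<open>H\<close> degree at least 2
  there.\<close>

lemma circle_path_disjoint:
  assumes "is_circle (subgr \<Sigma> S)" "S \<subseteq> edges \<Sigma>" "H \<subseteq> edges \<Sigma>" "vset S \<inter> vset H = {p}" "deg H p = 1"
  shows "S \<inter> H = {}"
proof (rule ccontr)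
  assume "S \<inter> H \<noteq> {}"
  then obtain b where b: "b \<in> S" "b \<in> H" by blast
  have "att \<Sigma> b i = Some p" for i
  proof -
    obtain v where v: "att \<Sigma> b i = Some v"
      using attached[OF _ circleD(2)[OF assms(1) b(1)]] b assms(2) by blast
    then have "v \<in> vset S \<inter> vset H" using b unfolding vset_def by blast
    then show ?thesis using v assms(4) by simp
  qed
  then have "{(b, True), (b, False)} \<subseteq> ends H p" using b by (auto simp: ends_def)
  then have "card {(b, True), (b, False)} \<le> deg H p"
    unfolding deg_def by (rule card_mono[OF finite_ends[OF assms(3)]])
  then show False using assms(5) by simp
qed

end

context rigid_flow
begin

section \<open>From the shape of a circuit to the values of its flow\<close>

lemma bd_complement: "X \<subseteq> C \<Longrightarrow> bd (C - X) g v = - bd X g v"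
  using bd_split[OF C, of X g v] flow[of v] by simp

text \<open>The value on the path is twice the value on each circle it ends at;
  since one of the values is that of \<open>e\<close>, the circles carry 1 and the path carries 2.\<close>

lemma double_edge_value:
  assumes "double_edge \<Sigma> C b"
  shows "\<bar>g b\<bar> = 2"
proof -
  have nz: "g b \<noteq> 0" if "b \<in> C" for b using supp that by blast
  \<comment> \<open>The circle touches the rest of \<open>C\<close> only through the one end of
    \<open>H\<close> at \<open>p\<close>. Conservation equates the boundary of the negative circle
    at \<open>p\<close>, twice its value, with the value carried by that end.\<close>
  have circ: "\<bar>g a\<bar> * 2 = \<bar>g c\<bar>"
    if S: "S \<in> negative_circles \<Sigma>" "S \<subseteq> C" "a \<in> S"
      and H: "H \<subseteq> C" "c \<in> H" "deg H p = 1" "vset S \<inter> vset H = {p}" "vset S \<inter> vset (C - S - H) = {}"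
      and const: "\<And>x y. x \<in> H \<Longrightarrow> y \<in> H \<Longrightarrow> \<bar>g x\<bar> = \<bar>g y\<bar>" for S H a c p
  proof -
    have S': "is_circle (subgr \<Sigma> S)" "S \<subseteq> edges \<Sigma>" "(\<Prod>e\<in>S. esign \<Sigma> e) = -1"
      using S(1) by (auto simp: negative_circles_iff)
    have HE: "H \<subseteq> edges \<Sigma>" using H(1) C by blast
    have disj: "S \<inter> H = {}" by (rule circle_path_disjoint[OF S'(1,2) HE H(4,3)])
    have HS: "H \<subseteq> C - S" using disj H(1) by blast
    have CSE: "C - S \<subseteq> edges \<Sigma>" using C by blast
    have bdS: "bd S g v = - bd H g v - bd (C - S - H) g v" for v
      using bd_complement[OF S(2), of v] bd_split[OF CSE HS, of g v] by simp
    have "bd S g v = 0" if "v \<noteq> p" for v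
    proof (cases "v \<in> vset S")
      case True
      then have "v \<notin> vset H" "v \<notin> vset (C - S - H)" using H(4,5) that by blast+
      then show ?thesis using bdS[of v] bd_not_vset by simp
    qed (simp add: bd_not_vset)
    then have "\<bar>bd S g p\<bar> = 2 * \<bar>g a\<bar>"
      by (rule negative_circle_bd[OF S']) (use S nz in auto)
    moreover have "p \<notin> vset (C - S - H)" using H(4,5) by blast
    then have "bd S g p = - bd H g p" using bdS[of p] bd_not_vset by simp
    moreover obtain d i where d: "d \<in> H" "att \<Sigma> d i = Some p"
      using H(4) unfolding vset_def by blast
    then have "\<bar>bd H g p\<bar> = \<bar>g d\<bar>" using deg1_bd(2)[OF HE H(3)] by blast
    ultimately show ?thesis using const[OF d(1) H(2)] by simp
  qed
  have const: "\<bar>g x\<bar> = \<bar>g y\<bar>"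
    if H: "H \<subseteq> C" "sconnected (subgr \<Sigma> H)" "x \<in> H" "y \<in> H"
      and v: "\<And>v. v \<in> vset H \<Longrightarrow> deg H v = 1 \<or> deg H v = 2 \<and> v \<notin> vset (C - H)" for H x y
  proof (rule connected_const_abs[OF sub_edges[OF H(1)] H(2) _ H(3,4)])
    fix v assume "v \<in> vset H"
    from v[OF this] show "deg H v = 1 \<or> deg H v = 2 \<and> bd H g v = 0"
      using bd_complement[OF H(1), of v] bd_not_vset[of v "C - H" g] by auto
  qed
  from assms consider
    (half) C1 H p where "C1 \<in> negative_circles \<Sigma>" "C = C1 \<union> H" "half_line (subgr \<Sigma> H) p"
      "vset C1 \<inter> vset H = {p}" "b \<in> H"
  | (line) C1 C2 P p q where "C1 \<in> negative_circles \<Sigma>" "C2 \<in> negative_circles \<Sigma>" "C = C1 \<union> P \<union> C2"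
      "line_segment (subgr \<Sigma> P) p q" "vset C1 \<inter> vset C2 = {}" "vset C1 \<inter> vset P = {p}"
      "vset C2 \<inter> vset P = {q}" "b \<in> P"
    unfolding double_edge_def verts_subgr
  proof (elim disjE bexE exE conjE, goal_cases)
    case (1 C1 H p)
    then show ?case by (intro that(1)[of C1 H p])
  next
    case (2 C1 C2 P p q)
    then show ?case by (intro that(2)[of C1 C2 P p q])
  qed
  then show ?thesis
  proof cases
    case half
    have H: "sconnected (subgr \<Sigma> H)" "deg H p = 1" "\<And>v. v \<in> vset H \<Longrightarrow> v \<noteq> p \<Longrightarrow> deg H v = 2"
      using half(3) by (auto simp: half_line_def verts_subgr vdegree_subgr)
    have sub: "H \<subseteq> C" "C1 \<subseteq> C" "C - H \<subseteq> C1" "C - C1 - H = {}" using half(2) by auto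
    have Hconst: "\<bar>g x\<bar> = \<bar>g y\<bar>" if "x \<in> H" "y \<in> H" for x y
    proof (rule const[OF sub(1) H(1) that])
      fix v assume v: "v \<in> vset H"
      show "deg H v = 1 \<or> deg H v = 2 \<and> v \<notin> vset (C - H)"
      proof (cases "v = p")
        case False
        then have "v \<notin> vset C1" using v half(4) by blast
        then show ?thesis using H(3)[OF v False] vset_mono[OF sub(3)] by blast
      qed (use H(2) in simp)
    qed
    have "vset C1 \<inter> vset (C - C1 - H) = {}" unfolding sub(4) by (simp add: vset_def)
    note two = circ[OF half(1) sub(2) _ sub(1) _ H(2) half(4) this Hconst]
    have "is_circle (subgr \<Sigma> C1)" using half(1) by (simp add: negative_circles_iff)
    then obtain a where a: "a \<in> C1" using circleD(4) by blast
    show ?thesis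
    proof (cases "e \<in> C1")
      case True
      then show ?thesis using two[OF True half(5)] ge by simp
    next
      case False
      then have "e \<in> H" using e half(2) by blast
      \<comment> \<open>The path cannot contain \<open>e\<close>: its value would be both 1 and
        even.\<close>
      then have "\<bar>g a\<bar> * 2 = 1" using two[OF a] ge by simp
      then show ?thesis by presburger
    qed
  next
    case line
    have P: "sconnected (subgr \<Sigma> P)" "deg P p = 1" "deg P q = 1"
      "\<And>v. v \<in> vset P \<Longrightarrow> v \<noteq> p \<Longrightarrow> v \<noteq> q \<Longrightarrow> deg P v = 2"
      using line(4) by (auto simp: line_segment_def verts_subgr vdegree_subgr)
    have sub: "P \<subseteq> C" "C1 \<subseteq> C" "C2 \<subseteq> C" "C - P \<subseteq> C1 \<union> C2" "C - C1 - P \<subseteq> C2" "C - C2 - P \<subseteq> C1"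
      using line(3) by auto
    have Pconst: "\<bar>g x\<bar> = \<bar>g y\<bar>" if "x \<in> P" "y \<in> P" for x y
    proof (rule const[OF sub(1) P(1) that])
      fix v assume v: "v \<in> vset P"
      have "v \<in> vset (C - P) \<Longrightarrow> v \<in> vset C1 \<or> v \<in> vset C2"
        using vset_mono[OF sub(4)] by (auto simp: vset_Un)
      then show "deg P v = 1 \<or> deg P v = 2 \<and> v \<notin> vset (C - P)"
        using P(2,3) P(4)[OF v] v line(6,7) by (cases "v = p \<or> v = q") blast+
    qed
    have 1: "vset C1 \<inter> vset (C - C1 - P) = {}" using vset_mono[OF sub(5)] line(5) by blast
    have 2: "vset C2 \<inter> vset (C - C2 - P) = {}" using vset_mono[OF sub(6)] line(5) by blast
    note two1 = circ[OF line(1) sub(2) _ sub(1) _ P(2) line(6) 1 Pconst]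
    note two2 = circ[OF line(2) sub(3) _ sub(1) _ P(3) line(7) 2 Pconst]
    have "is_circle (subgr \<Sigma> C1)" using line(1) by (simp add: negative_circles_iff)
    then obtain a where a: "a \<in> C1" using circleD(4) by blast
    consider "e \<in> C1" | "e \<in> C2" | "e \<in> P" using e line(3) by blast
    then show ?thesis
    proof cases
      case 1
      then show ?thesis using two1[OF 1 line(8)] ge by simp
    next
      case 2
      then show ?thesis using two2[OF 2 line(8)] ge by simp
    next
      case 3
      then have "\<bar>g a\<bar> * 2 = 1" using two1[OF a] ge by simp
      then show ?thesis by presburger
    qed
  qed
qed

section \<open>From the values of the flow to the shape of its support\<close>

abbreviation twos :: "'e set" where "twos \<equiv> {b \<in> C. \<bar>g b\<bar> = 2}"

lemma ones_twos_sub: "ones \<subseteq> C" "twos \<subseteq> C" "ones \<subseteq> edges \<Sigma>" "twos \<subseteq> edges \<Sigma>"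
  using C by auto

lemma sub_deg:
  assumes "deg C v = 2 \<or> v \<notin> vset C" "v \<in> vset {b \<in> C. P \<bar>g b\<bar>}"
  shows "deg {b \<in> C. P \<bar>g b\<bar>} v = 2" "v \<notin> vset (C - {b \<in> C. P \<bar>g b\<bar>})"
  using off_branch(1)[OF assms(1), of P] assms(2) deg_0_iff[of "{b \<in> C. P \<bar>g b\<bar>}" v] C by blast+

lemma complement_ones:
  assumes "\<And>b. b \<in> C \<Longrightarrow> \<bar>g b\<bar> = 1 \<or> \<bar>g b\<bar> = 2"
  shows "C - ones = twos" "C - twos = ones" "C = ones \<union> twos"
  using assms by auto

text \<open>On edges of value 1 the flow is itself a sign function, so
  \<open>two_regular_sign\<close> applies to it directly.\<close>

lemma ones_sign:
  assumes "S \<subseteq> ones" "is_circle (subgr \<Sigma> S)"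
  shows "(\<Prod>b\<in>S. esign \<Sigma> b) = (-1) ^ card {v \<in> vset S. bd S g v \<noteq> 0}"
proof (rule two_regular_sign)
  show "S \<subseteq> edges \<Sigma>" using assms ones_twos_sub by blast
  show "g b = 1 \<or> g b = -1" if "b \<in> S" for b
  proof -
    have "\<bar>g b\<bar> = 1" using that assms(1) by blast
    then show ?thesis by linarith
  qed
qed (use circleD[OF assms(2)] in auto)

text \<open>A 2-regular set has an even number of outer-edges, so the single outer-edge belongs to
  the class of value 2. Both classes are connected because a piece away from \<open>p\<close> would
  be detached from everything else. The circle is negative since its boundary is nonzero at exactly
  one vertex, namely \<open>p\<close>, where it balances the path.\<close>

lemma one_branch_decomposition:
  assumes p: "p \<in> vset ones" "p \<in> vset twos" and val: "\<And>b. b \<in> C \<Longrightarrow> \<bar>g b\<bar> = 1 \<or> \<bar>g b\<bar> = 2"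
    and dp: "deg ones p = 2" "deg twos p = 1" and "outs = 1"
    and off: "\<And>v. v \<noteq> p \<Longrightarrow> deg C v = 2 \<or> v \<notin> vset C"
  shows "ones \<in> negative_circles \<Sigma>" "half_line (subgr \<Sigma> twos) p" "vset ones \<inter> vset twos = {p}"
proof -
  note sub = ones_twos_sub
  note comp = complement_ones[OF val]
  have d1: "deg ones v = 2" if "v \<in> vset ones" for v
    using sub_deg(1)[OF off, of v "\<lambda>x. x = 1"] dp(1) that by (cases "v = p") auto
  have d2: "deg twos v = 2" if "v \<in> vset twos" "v \<noteq> p" for v
    using sub_deg(1)[OF off[OF that(2)], of "\<lambda>x. x = 2"] that by auto
  have apart: "v \<notin> vset ones \<or> v \<notin> vset twos" if "v \<noteq> p" for v
    using sub_deg(2)[OF off[OF that], of "\<lambda>x. x = 1"] comp(1) by auto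
  then show vs: "vset ones \<inter> vset twos = {p}" using p by blast
  have "(\<Sum>v\<in>vset ones. deg ones v) = 2 * card (vset ones)"
    using d1 by simp
  then have "2 * card (vset ones) + card {b \<in> ones. outer_edge \<Sigma> b} = 2 * card ones"
    using handshake[OF sub(3)] by simp
  then have "even (2 * card (vset ones) + card {b \<in> ones. outer_edge \<Sigma> b})"
    by (metis dvd_triv_left)
  then have "even (card {b \<in> ones. outer_edge \<Sigma> b})"
    by simp
  moreover have "card {b \<in> ones. outer_edge \<Sigma> b} + card {b \<in> twos. outer_edge \<Sigma> b} = outs"
  proof -
    have fin: "finite C" using finite_sub[OF C] .
    have "{b \<in> C. outer_edge \<Sigma> b} = {b \<in> ones. outer_edge \<Sigma> b} \<union> {b \<in> twos. outer_edge \<Sigma> b}"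
      using val by auto
    moreover have "{b \<in> ones. outer_edge \<Sigma> b} \<inter> {b \<in> twos. outer_edge \<Sigma> b} = {}" by auto
    ultimately show ?thesis
      unfolding outs_def using fin by (simp add: card_Un_disjoint)
  qed
  ultimately have o: "card {b \<in> ones. outer_edge \<Sigma> b} = 0" "card {b \<in> twos. outer_edge \<Sigma> b} = 1"
    using assms(6) by (cases "card {b \<in> ones. outer_edge \<Sigma> b}"; simp)+
  have "finite {b \<in> ones. outer_edge \<Sigma> b}" by (rule finite_subset[OF _ finite_sub[OF sub(3)]]) blast
  then have "{b \<in> ones. outer_edge \<Sigma> b} = {}" using o(1) card_0_eq by blast
  then have no1: "\<not> outer_edge \<Sigma> b" if "b \<in> ones" for b
    using that by blast
  have con: "sconnected (subgr \<Sigma> X)" if X: "X = {b \<in> C. P \<bar>g b\<bar>}" "p \<in> vset X" "X \<noteq> C" "\<And>v. v \<noteq> p \<Longrightarrow> v \<in> vset X \<Longrightarrow> v \<notin> vset (C - X)" for X P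
  proof -
    have XC: "X \<subseteq> C" using X by blast
    obtain Y where Y: "Y \<subseteq> X" "p \<in> vset Y" "sconnected (subgr \<Sigma> Y)" "vset Y \<inter> vset (X - Y) = {}"
      by (rule component_piece[OF sub_edges[OF XC] X(2)])
    have "X - Y = {}"
    proof (rule ccontr)
      assume ne: "X - Y \<noteq> {}"
      have "X - Y = C"
      proof (rule part_eq[OF _ ne])
        fix v assume v: "v \<in> vset (X - Y)"
        then have "v \<noteq> p" "v \<in> vset X" "v \<notin> vset Y"
          using Y vset_mono[of "X - Y" X] by blast+
        moreover have "C - (X - Y) = (C - X) \<union> Y" using Y(1) XC by blast
        ultimately show "v \<notin> vset (C - (X - Y))" using X(4) by (simp add: vset_Un)
      qed (use XC in blast)
      then show False using X(3) XC by blast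
    qed
    then show ?thesis using Y by (metis Diff_eq_empty_iff subset_antisym)
  qed
  have ne: "ones \<noteq> {}" "twos \<noteq> {}" "ones \<inter> twos = {}" using p by (auto simp: vset_def)
  have con1: "sconnected (subgr \<Sigma> ones)"
    by (rule con[of _ "\<lambda>x. x = 1"]) (use p ne apart comp in auto)
  have con2: "sconnected (subgr \<Sigma> twos)"
    by (rule con[of _ "\<lambda>x. x = 2"]) (use p ne apart comp in auto)
  show "half_line (subgr \<Sigma> twos) p"
    using con2 o(2) p(2) dp(2) d2 by (simp add: half_line_def outer_edges_subgr verts_subgr vdegree_subgr)
  have circ: "is_circle (subgr \<Sigma> ones)"
    using con1 no1 d1 by (simp add: is_circle_subgr)
  have "bd ones g v = 0" if "v \<noteq> p" for v
    using off_branch(2)[OF off[OF that], of "\<lambda>x. x = 1"] .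
  moreover have "bd ones g p \<noteq> 0"
  proof -
    obtain a i where a: "a \<in> twos" "att \<Sigma> a i = Some p" using p(2) unfolding vset_def by blast
    have "\<bar>bd twos g p\<bar> = \<bar>g a\<bar>" by (rule deg1_bd(2)[OF sub(4) dp(2) a])
    then show ?thesis using bd_complement[OF sub(1), of p] comp(1) a(1) by auto
  qed
  ultimately have "{v \<in> vset ones. bd ones g v \<noteq> 0} = {p}" using p(1) by auto
  then show "ones \<in> negative_circles \<Sigma>"
    using ones_sign[OF subset_refl circ] circ sub(3) by (simp add: negative_circles_iff)
qed

text \<open>The two ends of the path lie in one component by parity, and further components would be
  detached. The class of value 1 splits into the components of \<open>p\<close> and of
  \<open>q\<close>: a common component would be a circle with nonzero boundary at two vertices,
  hence positive, and would carry a flow of its own.\<close>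

lemma two_branch_decomposition:
  assumes p: "p \<in> vset ones" "p \<in> vset twos" "p \<noteq> q" and val: "\<And>b. b \<in> C \<Longrightarrow> \<bar>g b\<bar> = 1 \<or> \<bar>g b\<bar> = 2"
    and d: "deg ones p = 2" "deg twos p = 1" "deg ones q = 2" "deg twos q = 1" and o: "outs = 0"
    and off: "\<And>v. v \<noteq> p \<Longrightarrow> v \<noteq> q \<Longrightarrow> deg C v = 2 \<or> v \<notin> vset C"
  obtains C1 C2 where "C1 \<in> negative_circles \<Sigma>" "C2 \<in> negative_circles \<Sigma>" "C = C1 \<union> twos \<union> C2"
    "line_segment (subgr \<Sigma> twos) p q" "vset C1 \<inter> vset C2 = {}" "vset C1 \<inter> vset twos = {p}"
    "vset C2 \<inter> vset twos = {q}"
proof -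
  note sub = ones_twos_sub
  note comp = complement_ones[OF val]
  have q: "q \<in> vset ones" "q \<in> vset twos"
    using d(3,4) deg_0_iff[OF sub(3), of q] deg_0_iff[OF sub(4), of q] by auto
  have d1: "deg ones v = 2" if "v \<in> vset ones" for v
    using sub_deg(1)[OF off, of v "\<lambda>x. x = 1"] d(1,3) that by (cases "v = p \<or> v = q") auto
  have d2: "deg twos v = 2" if "v \<in> vset twos" "v \<noteq> p" "v \<noteq> q" for v
    using sub_deg(1)[OF off[OF that(2,3)], of "\<lambda>x. x = 2"] that by auto
  have apart: "v \<notin> vset ones \<or> v \<notin> vset twos" if "v \<noteq> p" "v \<noteq> q" for v
    using sub_deg(2)[OF off[OF that], of "\<lambda>x. x = 1"] comp(1) by auto
  have no: "\<not> outer_edge \<Sigma> b" if "b \<in> C" for b using no_outs[OF o that] .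
  have ne': "ones \<noteq> {}" "twos \<noteq> {}" "ones \<inter> twos = {}" using p by (auto simp: vset_def)
  have "ones \<noteq> C"
  proof
    assume "ones = C"
    then have "twos \<subseteq> ones" using sub(2) by simp
    then have "ones \<inter> twos = twos" by (rule Int_absorb1)
    then show False using ne'(2,3) by argo
  qed
  note ne = ne' this
  have "sconnected (subgr \<Sigma> twos)"
  proof -
    obtain Y where Y: "Y \<subseteq> twos" "p \<in> vset Y" "sconnected (subgr \<Sigma> Y)" "vset Y \<inter> vset (twos - Y) = {}"
      by (rule component_piece[OF sub(4) p(2)])
    have YE: "Y \<subseteq> edges \<Sigma>" using Y(1) sub(4) by blast
    have dY: "deg Y v = deg twos v" if "v \<in> vset Y" for v
      by (rule deg_disjoint_eq) (use that Y sub in auto)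
    \<comment> \<open>The component \<open>Y\<close> of \<open>p\<close> has odd degree at
      \<open>p\<close>, so it must contain the only other vertex of odd degree.\<close>
    have "even (deg Y p) \<longleftrightarrow> even (deg Y q)"
    proof (rule even_deg_all2[OF YE _ p(3)])
      show "\<not> outer_edge \<Sigma> b" if "b \<in> Y" for b using that Y(1) no by blast
      show "even (deg Y v)" if "v \<noteq> p" "v \<noteq> q" for v
      proof (cases "v \<in> vset Y")
        case True
        then have "v \<in> vset twos" using vset_mono[OF Y(1)] by blast
        then show ?thesis using dY[OF True] d2 that by simp
      next
        case False
        then show ?thesis using deg_0_iff[OF YE, of v] by simp
      qed
    qed
    then have qY: "q \<in> vset Y"
      using dY[OF Y(2)] d(2) deg_0_iff[OF YE, of q] by auto
    have "twos - Y = {}"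
    proof (rule ccontr)
      assume ne': "twos - Y \<noteq> {}"
      have "twos - Y = C"
      proof (rule part_eq[OF _ ne'])
        fix v assume v: "v \<in> vset (twos - Y)"
        then have "v \<noteq> p" "v \<noteq> q" "v \<in> vset twos" "v \<notin> vset Y"
          using Y qY vset_mono[of "twos - Y" twos] by blast+
        moreover have "C - (twos - Y) = ones \<union> Y" using Y(1) comp by blast
        ultimately show "v \<notin> vset (C - (twos - Y))" using apart by (auto simp: vset_Un)
      qed (use sub in blast)
      then show False using ne by blast
    qed
    then show ?thesis using Y by (metis Diff_eq_empty_iff subset_antisym)
  qed
  then have line: "line_segment (subgr \<Sigma> twos) p q"
    using p q d d2 no by (auto simp: line_segment_def outer_edges_subgr verts_subgr vdegree_subgr)
  have bd1: "bd ones g v = 0" if "v \<noteq> p" "v \<noteq> q" for v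
    using off_branch(2)[OF off[OF that], of "\<lambda>x. x = 1"] .
  have bd_ne: "bd ones g v \<noteq> 0" if "v = p \<or> v = q" for v
  proof -
    have "v \<in> vset twos" "deg twos v = 1" using that p q d by auto
    then obtain a i where a: "a \<in> twos" "att \<Sigma> a i = Some v" unfolding vset_def by blast
    have "\<bar>bd twos g v\<bar> = \<bar>g a\<bar>" by (rule deg1_bd(2)[OF sub(4) \<open>deg twos v = 1\<close> a])
    then show ?thesis using bd_complement[OF sub(1), of v] comp(1) a(1) by auto
  qed
  have piece: "is_circle (subgr \<Sigma> Y) \<and> (\<forall>v\<in>vset Y. bd Y g v = bd ones g v)"
    if Y: "Y \<subseteq> ones" "sconnected (subgr \<Sigma> Y)" "vset Y \<inter> vset (ones - Y) = {}" for Y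
  proof -
    have "deg Y v = 2" if "v \<in> vset Y" for v
    proof -
      have "deg Y v = deg ones v" by (rule deg_disjoint_eq) (use that Y sub in auto)
      then show ?thesis using d1 vset_mono[OF Y(1)] that by auto
    qed
    moreover have "bd Y g v = bd ones g v" if "v \<in> vset Y" for v
      using bd_split[OF sub(3) Y(1), of g v] bd_not_vset[of v "ones - Y" g] Y(3) that by auto
    ultimately show ?thesis using Y no by (auto simp: is_circle_subgr)
  qed
  obtain C1 where C1: "C1 \<subseteq> ones" "p \<in> vset C1" "sconnected (subgr \<Sigma> C1)" "vset C1 \<inter> vset (ones - C1) = {}"
    by (rule component_piece[OF sub(3) p(1)])
  have c1: "is_circle (subgr \<Sigma> C1)" "\<And>v. v \<in> vset C1 \<Longrightarrow> bd C1 g v = bd ones g v"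
    using piece[OF C1(1,3,4)] by blast+
  have C1E: "C1 \<subseteq> edges \<Sigma>" "C1 \<subseteq> C" using C1(1) sub by blast+
  have q1: "q \<notin> vset C1"
  proof
    assume "q \<in> vset C1"
    then have "{v \<in> vset C1. bd C1 g v \<noteq> 0} = {p, q}"
      using C1(2) c1(2) bd1 bd_ne by (intro equalityI subsetI) (auto, metis)
    then have sgn: "(\<Prod>b\<in>C1. esign \<Sigma> b) = 1"
      using ones_sign[OF C1(1) c1(1)] p(3) by simp
    obtain a where a: "a \<in> C1" using circleD(4)[OF c1(1)] by blast
    obtain w where w: "att \<Sigma> a True = Some w"
      using attached[of a True] no a C1E by blast
    obtain h where h: "\<And>b. b \<in> C1 \<Longrightarrow> \<bar>h b\<bar> = (1::int)" "\<And>v. v \<noteq> w \<Longrightarrow> bd C1 h v = 0"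
      "(\<Prod>b\<in>C1. esign \<Sigma> b) = 1 \<Longrightarrow> bd C1 h w = 0"
      by (rule circle_chain[OF c1(1) C1E(1) a w]; rule that; blast)
    have "C1 = C"
    proof (rule support_minimal[OF C1E(2), of h])
      show "h b \<noteq> 0" if "b \<in> C1" for b using h(1)[OF that] by auto
      show "bd C1 h v = 0" for v using h(2) h(3)[OF sgn] by (cases "v = w") auto
    qed (use a in blast)
    then show False using C1(1) ne(4) sub(1) by blast
  qed
  have q2: "q \<in> vset (ones - C1)"
  proof -
    have "vset ones = vset C1 \<union> vset (ones - C1)"
      unfolding vset_Un[symmetric] by (rule arg_cong[of _ _ vset]) (use C1(1) in blast)
    then show ?thesis using q(1) q1 by blast
  qed
  have "ones - C1 \<subseteq> edges \<Sigma>" using sub by blast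
  then obtain C2 where C2: "C2 \<subseteq> ones - C1" "q \<in> vset C2" "sconnected (subgr \<Sigma> C2)"
    "vset C2 \<inter> vset (ones - C1 - C2) = {}"
    by (rule component_piece[OF _ q2])
  have v12: "vset C1 \<inter> vset C2 = {}" using C1(4) vset_mono[OF C2(1)] by blast
  have "ones - C1 - C2 = {}"
  proof (rule ccontr)
    assume ne': "ones - C1 - C2 \<noteq> {}"
    have "ones - C1 - C2 = C"
    proof (rule part_eq[OF _ ne'])
      fix v assume v: "v \<in> vset (ones - C1 - C2)"
      have "v \<in> vset ones" "v \<notin> vset C2" "v \<notin> vset C1"
        using v C1(4) C2(4) vset_mono[of "ones - C1 - C2" ones] vset_mono[of "ones - C1 - C2" "ones - C1"] by blast+
      moreover from this have "v \<noteq> p" "v \<noteq> q" using C1(2) C2(2) by blast+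
      moreover have "C - (ones - C1 - C2) = twos \<union> C1 \<union> C2" using C1(1) C2(1) comp by blast
      ultimately show "v \<notin> vset (C - (ones - C1 - C2))" using apart by (auto simp: vset_Un)
    qed (use sub in blast)
    then show False using ne by blast
  qed
  then have C2eq: "C2 = ones - C1" using C2(1) by blast
  have "ones - C2 = C1" using C1(1) C2eq by blast
  then have c2: "is_circle (subgr \<Sigma> C2)" "\<And>v. v \<in> vset C2 \<Longrightarrow> bd C2 g v = bd ones g v"
    using piece[of C2] C2 v12 by blast+
  have "{v \<in> vset C1. bd C1 g v \<noteq> 0} = {p}"
    using C1(2) c1(2) bd1 bd_ne q1 by (intro equalityI subsetI) (auto, metis)
  then have n1: "C1 \<in> negative_circles \<Sigma>"
    using ones_sign[OF C1(1) c1(1)] c1(1) C1E by (simp add: negative_circles_iff)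
  have C2E: "C2 \<subseteq> ones" "C2 \<subseteq> edges \<Sigma>" using C2(1) sub by blast+
  have "p \<notin> vset C2" using v12 C1(2) by blast
  then have "{v \<in> vset C2. bd C2 g v \<noteq> 0} = {q}"
    using C2(2) c2(2) bd1 bd_ne by (intro equalityI subsetI) (auto, metis)
  then have n2: "C2 \<in> negative_circles \<Sigma>"
    using ones_sign[OF C2E(1) c2(1)] c2(1) C2E by (simp add: negative_circles_iff)
  have "C = C1 \<union> twos \<union> C2" using comp(3) C2eq C1(1) by blast
  moreover have "x = p" if "x \<in> vset C1" "x \<in> vset twos" for x
    using apart[of x] that q1 vset_mono[OF C1(1)] by blast
  then have "vset C1 \<inter> vset twos = {p}"
    using C1(2) p(2) by blast
  moreover have "x = q" if "x \<in> vset C2" "x \<in> vset twos" for x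
    using apart[of x] that \<open>p \<notin> vset C2\<close> vset_mono[OF C2E(1)] by blast
  then have "vset C2 \<inter> vset twos = {q}"
    using C2(2) q(2) by blast
  ultimately show ?thesis using that[OF n1 n2 _ line v12] by blast
qed

text \<open>Only the implication from value 2 to double edge remains. Where the class of value 1
  meets the rest there is a branch vertex; excess 2 leaves degree 4, which
  \<open>no_single_branch\<close> excludes, degree 3 with an outer-edge, or degree 3 with a second
  such vertex. In the last two cases only the values 1 and 2 occur and a decomposition exhibits the
  required shape.\<close>

theorem value_double_edge:
  assumes "b \<in> C"
  shows "\<bar>g b\<bar> = (if double_edge \<Sigma> C b then 2 else 1)"
proof (cases "double_edge \<Sigma> C b")
  case True
  then show ?thesis using double_edge_value by simp
next
  case False
  show ?thesis
  proof (cases "ones = C")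
    case True
    then show ?thesis using assms False by auto
  next
    case ne: False
    obtain p where p: "p \<in> vset ones" "p \<in> vset (C - ones)" "3 \<le> deg C p"
      using branch_vertex[OF ne] .
    have pC: "p \<in> vset C" using p(1) vset_mono[of ones C] by blast
    have ex: "deg C p - 2 + (\<Sum>v\<in>vset C - {p}. deg C v - 2) + outs = 2"
      using excess excess_at[OF pC] p(3) by linarith
    have "(b \<in> twos \<longrightarrow> double_edge \<Sigma> C b) \<and> (\<bar>g b\<bar> = 1 \<or> \<bar>g b\<bar> = 2)"
    proof (cases "(\<Sum>v\<in>vset C - {p}. deg C v - 2) = 0")
      case True
      have off: "deg C v = 2 \<or> v \<notin> vset C" if "v \<noteq> p" for v
        by (rule deg2_of_no_excess[OF True]) (use that in simp)
      consider "deg C p = 4" "outs = 0" | "deg C p = 3" "outs = 1"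
        using ex True p(3) by linarith
      then show ?thesis
      proof cases
        case 1
        then show ?thesis using no_single_branch[OF p(1,2) _ _ off] by blast
      next
        case 2
        note br = outer_branch[OF p(1) 2 off]
        have val: "\<And>b. b \<in> C \<Longrightarrow> \<bar>g b\<bar> = 1 \<or> \<bar>g b\<bar> = 2"
          by (rule other_values_empty[of "{p}"]) (use off br 2 in auto)
        have "p \<in> vset twos" using p(2) complement_ones(1)[OF val] by simp
        note dec = one_branch_decomposition[OF p(1) this val br 2(2) off]
        show ?thesis
          using double_edge_halfI[OF dec(1) ones_twos_sub(4) complement_ones(3)[OF val] dec(2,3)] val[OF assms]
          by blast
      qed
    next
      case False
      then have dp: "deg C p = 3" and o: "outs = 0" and one: "(\<Sum>v\<in>vset C - {p}. deg C v - 2) = 1"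
        using ex p(3) by linarith+
      have fin: "finite (vset C - {p})" using finite_vset[OF C] by simp
      obtain q where q: "q \<in> vset C - {p}" "deg C q - 2 \<noteq> 0"
        using False by (meson sum.neutral)
      have rem: "(\<Sum>v\<in>vset C - {p}. deg C v - 2) = deg C q - 2 + (\<Sum>v\<in>vset C - {p} - {q}. deg C v - 2)"
        by (rule sum.remove[OF fin q(1)])
      then have "(\<Sum>v\<in>vset C - {p} - {q}. deg C v - 2) = 0" and dq: "deg C q = 3"
        using one q(2) by linarith+
      then have zero: "(\<Sum>v\<in>vset C - {p, q}. deg C v - 2) = 0"
        by (subst Diff_insert2)
      have off: "deg C v = 2 \<or> v \<notin> vset C" if "v \<noteq> p" "v \<noteq> q" for v
        by (rule deg2_of_no_excess[OF zero]) (use that in simp)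
      have pq: "p \<noteq> q" using q by blast
      note br = inner_branch[OF p(1) pq dp dq o off]
      have val: "\<And>b. b \<in> C \<Longrightarrow> \<bar>g b\<bar> = 1 \<or> \<bar>g b\<bar> = 2"
        by (rule other_values_empty[of "{p, q}"]) (use off br dp dq in auto)
      have "p \<in> vset twos" using p(2) complement_ones(1)[OF val] by simp
      then obtain C1 C2 where dec: "C1 \<in> negative_circles \<Sigma>" "C2 \<in> negative_circles \<Sigma>" "C = C1 \<union> twos \<union> C2"
        "line_segment (subgr \<Sigma> twos) p q" "vset C1 \<inter> vset C2 = {}" "vset C1 \<inter> vset twos = {p}"
        "vset C2 \<inter> vset twos = {q}"
        using two_branch_decomposition[OF p(1) _ pq val br o off] by blast
      show ?thesis
        using double_edge_lineI[OF dec(1,2) ones_twos_sub(4) dec(3-7)] val[OF assms] by blast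
    qed
    then show ?thesis using False assms by auto
  qed
qed

end

section \<open>Connected components\<close>

context signed_graph
begin

lemma adjacency_eq: "adjacency \<Sigma> = adj (edges \<Sigma>)"
  by (simp add: adjacency_def adj_def)

lemma equiv_connection: "equiv (verts \<Sigma>) (connection \<Sigma>)"
proof (rule equivI)
  show "refl_on (verts \<Sigma>) (connection \<Sigma>)"
    by (auto simp: connection_def refl_on_def)
  show "sym (connection \<Sigma>)"
    using adj_rtrancl_sym by (auto simp: connection_def adjacency_eq sym_def)
  show "trans (connection \<Sigma>)"
    by (auto simp: connection_def trans_def)
qed (auto simp: connection_def)

lemma componentE:
  assumes "\<Gamma> \<in> components \<Sigma>"
  obtains W where "W \<in> verts \<Sigma> // connection \<Sigma>"
    "\<Gamma> = \<Sigma>\<lparr>verts := W, edges := {e \<in> edges \<Sigma>. \<exists>i. \<exists>v \<in> W. att \<Sigma> e i = Some v}\<rparr>"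
  using assms unfolding components_def by blast

lemma component_verts:
  assumes "\<Gamma> \<in> components \<Sigma>"
  shows "verts \<Gamma> \<in> verts \<Sigma> // connection \<Sigma>" "verts \<Gamma> \<subseteq> verts \<Sigma>" "verts \<Gamma> \<noteq> {}" "finite (verts \<Gamma>)"
proof -
  show 1: "verts \<Gamma> \<in> verts \<Sigma> // connection \<Sigma>" by (rule componentE[OF assms]) simp
  show 2: "verts \<Gamma> \<subseteq> verts \<Sigma>"
    using 1 equiv_connection by (metis Union_quotient Sup_upper)
  show "verts \<Gamma> \<noteq> {}" using 1 equiv_connection by (metis in_quotient_imp_non_empty)
  show "finite (verts \<Gamma>)" using 2 finite_verts finite_subset by blast
qed

lemma component_edges:
  assumes "\<Gamma> \<in> components \<Sigma>"
  shows "edges \<Gamma> = {e \<in> edges \<Sigma>. \<exists>i. \<exists>v \<in> verts \<Gamma>. att \<Sigma> e i = Some v}"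
  by (rule componentE[OF assms]) simp

lemma component_att:
  assumes "\<Gamma> \<in> components \<Sigma>"
  shows "att \<Gamma> = att \<Sigma>" "esign \<Gamma> = esign \<Sigma>" "subgr (\<Gamma>\<lparr>edges := X\<rparr>) S = subgr \<Sigma> S" "subgr \<Gamma> S = subgr \<Sigma> S"
  by (rule componentE[OF assms]; simp add: subgr_def)+

lemma component_edges_subset: "\<Gamma> \<in> components \<Sigma> \<Longrightarrow> edges \<Gamma> \<subseteq> edges \<Sigma>"
  using component_edges by blast

lemma component_closed:
  assumes "\<Gamma> \<in> components \<Sigma>" "e \<in> edges \<Gamma>" "att \<Sigma> e i = Some v"
  shows "v \<in> verts \<Gamma>"
proof -
  obtain j u where u: "e \<in> edges \<Sigma>" "u \<in> verts \<Gamma>" "att \<Sigma> e j = Some u"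
    using assms component_edges by blast
  show ?thesis
  proof (cases "i = j")
    case True
    then show ?thesis using u assms by simp
  next
    case False
    then have "i = (\<not> j)" by auto
    then have "(u, v) \<in> adj (edges \<Sigma>)" using u assms(3) unfolding adj_def by auto
    then have "(u, v) \<in> connection \<Sigma>"
      using u assms(3) att_verts unfolding connection_def adjacency_eq by auto
    then show ?thesis
      using component_verts(1)[OF assms(1)] u(2) in_quotient_imp_closed[OF equiv_connection] by blast
  qed
qed

lemma component_edgeI:
  assumes "\<Gamma> \<in> components \<Sigma>" "e \<in> edges \<Sigma>" "att \<Sigma> e i = Some v" "v \<in> verts \<Gamma>"
  shows "e \<in> edges \<Gamma>"
  using assms component_edges by blast

lemma component_unique:
  assumes "\<Gamma> \<in> components \<Sigma>" "\<Delta> \<in> components \<Sigma>" "v \<in> verts \<Gamma>" "v \<in> verts \<Delta>"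
  shows "\<Gamma> = \<Delta>"
proof -
  have "verts \<Gamma> = verts \<Delta>"
    using quotient_disj[OF equiv_connection component_verts(1)[OF assms(1)] component_verts(1)[OF assms(2)]] assms(3,4) by blast
  then show ?thesis
    by (rule_tac componentE[OF assms(1)], rule_tac componentE[OF assms(2)]) simp
qed

lemma component_of_vertex:
  assumes "v \<in> verts \<Sigma>"
  obtains \<Gamma> where "\<Gamma> \<in> components \<Sigma>" "v \<in> verts \<Gamma>"
proof -
  let ?W = "connection \<Sigma> `` {v}"
  have "?W \<in> verts \<Sigma> // connection \<Sigma>" using assms by (rule quotientI)
  moreover have "v \<in> ?W" using equiv_connection assms by (rule equiv_class_self)
  ultimately show ?thesis
    using that[of "\<Sigma>\<lparr>verts := ?W, edges := {e \<in> edges \<Sigma>. \<exists>i. \<exists>v \<in> ?W. att \<Sigma> e i = Some v}\<rparr>"]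
    unfolding components_def by simp
qed

lemma component_of_edge:
  assumes "e \<in> edges \<Sigma>"
  obtains \<Gamma> where "\<Gamma> \<in> components \<Sigma>" "e \<in> edges \<Gamma>"
proof -
  obtain i v where "att \<Sigma> e i = Some v" using att_some[OF assms] by blast
  then show ?thesis
    using component_of_vertex[OF att_verts[OF assms]] component_edgeI[OF _ assms] that by metis
qed

lemma component_edge_unique:
  assumes "\<Gamma> \<in> components \<Sigma>" "\<Delta> \<in> components \<Sigma>" "e \<in> edges \<Gamma>" "e \<in> edges \<Delta>"
  shows "\<Gamma> = \<Delta>"
proof -
  obtain i v where "v \<in> verts \<Gamma>" "att \<Sigma> e i = Some v" using assms component_edges by blast
  then show ?thesis using component_closed[OF assms(2,4)] component_unique[OF assms(1,2)] by blast
qed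

lemma finite_components: "finite (components \<Sigma>)"
  unfolding components_def
  by (intro finite_imageI finite_quotient finite_verts) (auto simp: connection_def)

lemma component_ends:
  assumes "\<Gamma> \<in> components \<Sigma>" "v \<in> verts \<Gamma>" "X \<subseteq> edges \<Sigma>"
  shows "deg (X \<inter> edges \<Gamma>) v = deg X v"
proof -
  have "ends (X \<inter> edges \<Gamma>) v = ends X v"
    using component_edgeI[OF assms(1) _ _ assms(2)] assms(3) unfolding ends_def by blast
  then show ?thesis by (simp add: deg_def)
qed

lemma connected_in_component:
  assumes "S \<subseteq> edges \<Sigma>" "sconnected (subgr \<Sigma> S)"
  obtains \<Gamma> where "\<Gamma> \<in> components \<Sigma>" "S \<subseteq> edges \<Gamma>"
proof -
  obtain u where u: "u \<in> vset S" using assms(2) unfolding sconnected_subgr by blast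
  then have "u \<in> verts \<Sigma>" using vset_subset[OF assms(1)] by blast
  then obtain \<Gamma> where \<Gamma>: "\<Gamma> \<in> components \<Sigma>" "u \<in> verts \<Gamma>" by (rule component_of_vertex)
  have cl: "v \<in> verts \<Gamma>" if "(u, v) \<in> (adj S)\<^sup>*" for v
    using that
  proof (induction rule: rtrancl_induct)
    case base
    then show ?case using \<Gamma> by simp
  next
    case (step y z)
    obtain e i where e: "e \<in> S" "att \<Sigma> e i = Some y" "att \<Sigma> e (\<not> i) = Some z"
      using step(2) unfolding adj_def by blast
    then have "e \<in> edges \<Gamma>" using component_edgeI[OF \<Gamma>(1)] step.IH assms(1) by blast
    then show ?case using component_closed[OF \<Gamma>(1)] e by blast
  qed
  have "S \<subseteq> edges \<Gamma>"
  proof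
    fix e assume e: "e \<in> S"
    then obtain i v where v: "att \<Sigma> e i = Some v" using att_some assms(1) by blast
    then have "v \<in> vset S" using e unfolding vset_def by blast
    then have "v \<in> verts \<Gamma>" using cl u assms(2) unfolding sconnected_subgr by blast
    then show "e \<in> edges \<Gamma>" using component_edgeI[OF \<Gamma>(1)] e v assms(1) by blast
  qed
  then show ?thesis using that \<Gamma> by blast
qed

lemma component_outer_edges:
  assumes "\<Gamma> \<in> components \<Sigma>"
  shows "outer_edges \<Gamma> = {e \<in> edges \<Gamma>. outer_edge \<Sigma> e}"
  by (simp add: outer_edges_def outer_edge_def component_att[OF assms])

lemma component_circles:
  assumes "\<Gamma> \<in> components \<Sigma>"
  shows "circles \<Gamma> = {S. S \<subseteq> edges \<Gamma> \<and> is_circle (subgr \<Sigma> S)}"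
    "circles (\<Gamma>\<lparr>edges := X\<rparr>) = {S. S \<subseteq> X \<and> is_circle (subgr \<Sigma> S)}"
  by (simp_all add: circles_def component_att[OF assms])

text \<open>Passage from the record-based notion for a component to the edge-set notion
  \<open>tree\<close> inside the whole graph, where degrees and boundaries are computed.\<close>

lemma component_spanning_tree:
  assumes \<Gamma>: "\<Gamma> \<in> components \<Sigma>" and T: "spanning_tree (\<Gamma>\<lparr>edges := edges \<Gamma> - outer_edges \<Gamma>\<rparr>) T"
  shows "tree T (verts \<Gamma>)" "T \<subseteq> edges \<Gamma>"
proof -
  have T': "T \<subseteq> edges \<Gamma> - outer_edges \<Gamma>" "sconnected (\<Gamma>\<lparr>edges := T\<rparr>)" "circles (\<Gamma>\<lparr>edges := T\<rparr>) = {}"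
    using T by (simp_all add: spanning_tree_def)
  show sub: "T \<subseteq> edges \<Gamma>" using T' by blast
  have "adjacency (\<Gamma>\<lparr>edges := T\<rparr>) = adj T"
    by (simp add: adjacency_def adj_def component_att[OF \<Gamma>])
  then have "verts \<Gamma> \<times> verts \<Gamma> \<subseteq> (adj T)\<^sup>*"
    using T'(2) by (auto simp: sconnected_def connection_def)
  moreover have "vset T \<subseteq> verts \<Gamma>"
    using component_closed[OF \<Gamma>] sub unfolding vset_def by blast
  ultimately show "tree T (verts \<Gamma>)"
    using T' sub component_verts[OF \<Gamma>] component_edges_subset[OF \<Gamma>]
    unfolding tree_def component_circles[OF \<Gamma>] component_outer_edges[OF \<Gamma>] by blast
qed

definition outer_base :: "('v, 'e) sgraph \<Rightarrow> 'e set \<Rightarrow> 'e set \<Rightarrow> 'e \<Rightarrow> bool" where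
  "outer_base \<Gamma> D T b \<longleftrightarrow> b \<in> edges \<Gamma> \<and> outer_edge \<Sigma> b \<and> D = insert b T"

definition negative_base :: "('v, 'e) sgraph \<Rightarrow> 'e set \<Rightarrow> 'e set \<Rightarrow> 'e \<Rightarrow> 'e set \<Rightarrow> bool" where
  "negative_base \<Gamma> D T b S \<longleftrightarrow> b \<in> edges \<Gamma> \<and> D = insert b T \<and> b \<notin> T \<and> b \<in> S \<and> S \<in> negative_circles \<Sigma> \<and>
     (\<forall>X. X \<subseteq> D \<and> is_circle (subgr \<Sigma> X) \<longleftrightarrow> X = S) \<and> (\<forall>x\<in>edges \<Gamma>. \<not> outer_edge \<Sigma> x)"

text \<open>The only place where the definition of a component base is unfolded. That the extra edge
  lies on the negative circle and not in the tree follows since the tree contains no circle.\<close>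

lemma component_base_cases:
  assumes \<Gamma>: "\<Gamma> \<in> components \<Sigma>" and D: "component_base \<Gamma> D"
  obtains T where "tree T (verts \<Gamma>)" "T \<subseteq> edges \<Gamma>" "balanced \<Gamma>" "D = T"
  | T b where "tree T (verts \<Gamma>)" "T \<subseteq> edges \<Gamma>" "\<not> balanced \<Gamma>" "outer_edges \<Gamma> \<noteq> {}" "outer_base \<Gamma> D T b"
  | T b S where "tree T (verts \<Gamma>)" "T \<subseteq> edges \<Gamma>" "\<not> balanced \<Gamma>" "outer_edges \<Gamma> = {}" "negative_base \<Gamma> D T b S"
proof -
  obtain T where T: "spanning_tree (\<Gamma>\<lparr>edges := edges \<Gamma> - outer_edges \<Gamma>\<rparr>) T"
    and D': "if balanced \<Gamma> then D = T
        else if outer_edges \<Gamma> \<noteq> {} then \<exists>e \<in> outer_edges \<Gamma>. D = insert e T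
        else \<exists>e \<in> edges \<Gamma>. D = insert e T \<and>
               (\<exists>S \<in> negative_circles \<Gamma>. circles (\<Gamma>\<lparr>edges := insert e T\<rparr>) = {S})"
    using D unfolding component_base_def by blast
  note tree = component_spanning_tree[OF \<Gamma> T]
  consider "balanced \<Gamma>" | "\<not> balanced \<Gamma>" "outer_edges \<Gamma> \<noteq> {}" | "\<not> balanced \<Gamma>" "outer_edges \<Gamma> = {}" by blast
  then show ?thesis
  proof cases
    case 1
    then show ?thesis using that(1) tree D' by simp
  next
    case 2
    then obtain b where "b \<in> outer_edges \<Gamma>" "D = insert b T" using D' by auto
    then have "outer_base \<Gamma> D T b" by (simp add: outer_base_def component_outer_edges[OF \<Gamma>])
    then show ?thesis using that(2) tree 2 by blast
  next
    case 3
    then obtain b S where b: "b \<in> edges \<Gamma>" "D = insert b T" "S \<in> negative_circles \<Gamma>"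
      "circles (\<Gamma>\<lparr>edges := insert b T\<rparr>) = {S}" using D' by auto
    have uniq: "X \<subseteq> insert b T \<and> is_circle (subgr \<Sigma> X) \<longleftrightarrow> X = S" for X
      using b(4) unfolding component_circles[OF \<Gamma>] by blast
    then have S: "S \<subseteq> insert b T" "is_circle (subgr \<Sigma> S)" by blast+
    then have "\<not> S \<subseteq> T" using treeD(7)[OF tree(1)] by blast
    then have bS: "b \<in> S" "b \<notin> T" using S by blast+
    have "S \<in> negative_circles \<Sigma>"
      using b(3) component_edges_subset[OF \<Gamma>]
      by (auto simp: negative_circles_def circles_def component_att[OF \<Gamma>])
    then have "negative_base \<Gamma> D T b S"
      using b(1,2) bS uniq 3(2) unfolding component_outer_edges[OF \<Gamma>] negative_base_def by auto
    then show ?thesis using that(3) tree 3 by blast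
  qed
qed

end

section \<open>Flows on a canonical base\<close>

lemma finprod_int_pow:
  assumes "comm_group A" "x \<in> carrier A" "finite F"
  shows "finprod A (\<lambda>e. x [^]\<^bsub>A\<^esub> (n e :: int)) F = x [^]\<^bsub>A\<^esub> (\<Sum>e\<in>F. n e)"
proof -
  interpret comm_group A by fact
  show ?thesis
    using assms(3)
  proof (induction F rule: finite_induct)
    case (insert e F)
    then show ?case using assms(2) by (simp add: int_pow_mult Pi_def)
  qed simp
qed

context signed_graph
begin

text \<open>The boundary with coefficients in \<open>A\<close>, written multiplicatively, of a chain
  given by its values on reference arcs.\<close>

definition kirchhoff :: "('a, 'm) monoid_scheme \<Rightarrow> ('e \<Rightarrow> 'a) \<Rightarrow> 'v \<Rightarrow> 'a" where
  "kirchhoff A f v = finprod A (\<lambda>e. f e [^]\<^bsub>A\<^esub> eta v e) (edges \<Sigma>)"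

text \<open>This is how integer constructions enter a general group: exponents multiply along each
  edge and add over the edges.\<close>

lemma kirchhoff_int_pow:
  assumes "comm_group A" "x \<in> carrier A"
  shows "kirchhoff A (\<lambda>e. x [^]\<^bsub>A\<^esub> g e) v = x [^]\<^bsub>A\<^esub> bd (edges \<Sigma>) g v"
proof -
  interpret comm_group A by fact
  have "kirchhoff A (\<lambda>e. x [^]\<^bsub>A\<^esub> g e) v = finprod A (\<lambda>e. x [^]\<^bsub>A\<^esub> (eta v e * g e)) (edges \<Sigma>)"
    unfolding kirchhoff_def using assms(2)
    by (intro finprod_cong) (auto simp: int_pow_pow mult.commute simp_implies_def)
  then show ?thesis
    using finprod_int_pow[OF assms finite_edges] by (simp add: bd_def)
qed

lemma kirchhoff_mult:
  assumes "comm_group A" "f \<in> edges \<Sigma> \<rightarrow> carrier A" "g \<in> edges \<Sigma> \<rightarrow> carrier A"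
  shows "kirchhoff A (\<lambda>e. f e \<otimes>\<^bsub>A\<^esub> g e) v = kirchhoff A f v \<otimes>\<^bsub>A\<^esub> kirchhoff A g v"
proof -
  interpret comm_group A by fact
  have "kirchhoff A (\<lambda>e. f e \<otimes>\<^bsub>A\<^esub> g e) v =
      finprod A (\<lambda>e. (f e [^]\<^bsub>A\<^esub> eta v e) \<otimes>\<^bsub>A\<^esub> (g e [^]\<^bsub>A\<^esub> eta v e)) (edges \<Sigma>)"
    unfolding kirchhoff_def using assms(2,3)
    by (intro finprod_cong) (auto simp: int_pow_distrib Pi_iff simp_implies_def)
  also have "\<dots> = kirchhoff A f v \<otimes>\<^bsub>A\<^esub> kirchhoff A g v"
    unfolding kirchhoff_def using assms(2,3) by (intro finprod_multf) (auto simp: Pi_iff)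
  finally show ?thesis .
qed

lemma kirchhoff_cong:
  assumes "comm_group A" "f \<in> edges \<Sigma> \<rightarrow> carrier A"
    "\<And>e i. e \<in> edges \<Sigma> \<Longrightarrow> att \<Sigma> e i = Some v \<Longrightarrow> f e = g e" "g \<in> edges \<Sigma> \<rightarrow> carrier A"
  shows "kirchhoff A f v = kirchhoff A g v"
proof -
  interpret comm_group A by fact
  have "f e [^]\<^bsub>A\<^esub> eta v e = g e [^]\<^bsub>A\<^esub> eta v e" if "e \<in> edges \<Sigma>" for e
  proof (cases "\<exists>i. att \<Sigma> e i = Some v")
    case True
    then show ?thesis using assms(3)[OF that] by auto
  next
    case False
    then have "eta v e = 0" by (intro eta_0) blast
    then show ?thesis by simp
  qed
  then show ?thesis
    unfolding kirchhoff_def using assms(2,4)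
    by (intro finprod_cong) (auto simp: Pi_iff simp_implies_def)
qed

text \<open>At a vertex meeting just one nontrivial edge end, the product reduces to the value there
  or its inverse.\<close>

lemma kirchhoff_leaf:
  assumes A: "comm_group A" and f: "f \<in> edges \<Sigma> \<rightarrow> carrier A"
    and deg: "deg {e \<in> edges \<Sigma>. f e \<noteq> \<one>\<^bsub>A\<^esub>} v = 1"
  shows "kirchhoff A f v \<noteq> \<one>\<^bsub>A\<^esub>"
proof
  interpret comm_group A by fact
  let ?X = "{e \<in> edges \<Sigma>. f e \<noteq> \<one>\<^bsub>A\<^esub>}"
  assume K: "kirchhoff A f v = \<one>\<^bsub>A\<^esub>"
  obtain x where "ends ?X v = {x}" using deg by (auto simp: deg_def card_1_singleton_iff)
  moreover obtain b i where "x = (b, i)" by (cases x)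
  ultimately have bi: "ends ?X v = {(b, i)}" by simp
  then have "(b, i) \<in> ends ?X v" by simp
  then have b: "b \<in> edges \<Sigma>" "f b \<noteq> \<one>\<^bsub>A\<^esub>" "att \<Sigma> b i = Some v" by (auto simp: ends_def)
  have fb: "f b \<in> carrier A" using f b by blast
  \<comment> \<open>A loop would count two ends. It must be excluded because its exponent could be 0
    or 2, and torsion could then hide its value.\<close>
  have "att \<Sigma> b (\<not> i) \<noteq> Some v"
  proof
    assume "att \<Sigma> b (\<not> i) = Some v"
    then have "(b, \<not> i) \<in> ends ?X v" using b by (simp add: ends_def)
    then show False unfolding bi by simp
  qed
  then have eta: "eta v b = tau b i" using b(3) by (simp add: eta_alt[of v b i])
  have "f e [^]\<^bsub>A\<^esub> eta v e = (if b = e then f b [^]\<^bsub>A\<^esub> tau b i else \<one>\<^bsub>A\<^esub>)" if e: "e \<in> edges \<Sigma>" for e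
  proof (cases "b = e")
    case True
    then show ?thesis using eta by simp
  next
    case False
    show ?thesis
    proof (cases "f e = \<one>\<^bsub>A\<^esub>")
      case True
      then show ?thesis using False by simp
    next
      case ne: False
      have "att \<Sigma> e j \<noteq> Some v" for j
      proof
        assume "att \<Sigma> e j = Some v"
        then have "(e, j) \<in> ends ?X v" using ne e by (simp add: ends_def)
        then show False unfolding bi using False by simp
      qed
      then have "eta v e = 0" by (rule eta_0)
      then show ?thesis using False by simp
    qed
  qed
  then have "kirchhoff A f v = finprod A (\<lambda>e. if b = e then f b [^]\<^bsub>A\<^esub> tau b i else \<one>\<^bsub>A\<^esub>) (edges \<Sigma>)"
    unfolding kirchhoff_def using fb by (intro finprod_cong) (auto simp: simp_implies_def)
  also have "\<dots> = f b [^]\<^bsub>A\<^esub> tau b i"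
    using fb b(1) finite_edges by (intro finprod_singleton) auto
  finally have "f b [^]\<^bsub>A\<^esub> tau b i = \<one>\<^bsub>A\<^esub>" using K by simp
  then have "f b = \<one>\<^bsub>A\<^esub>"
    using tau_cases[OF b(1), of i] fb by (auto simp: int_pow_neg int_pow_1)
  then show False using b by simp
qed

text \<open>Each attached end of \<open>e\<close> is carried along the tree to \<open>r\<close>, an
  unattached end contributes nothing. If both ends are attached, two units arrive at
  \<open>r\<close>, which gives 0 or plus or minus 2.\<close>

lemma tree_transfer:
  assumes T: "tree T W" and e: "e \<in> edges \<Sigma>" "e \<notin> T" "\<forall>i v. att \<Sigma> e i = Some v \<longrightarrow> v \<in> W" and r: "r \<in> W"
  obtains f where "\<And>x. x \<notin> insert e T \<Longrightarrow> f x = 0" "f e = 1"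
    "\<And>v. v \<noteq> r \<Longrightarrow> bd (edges \<Sigma>) f v = 0"
    "\<not> outer_edge \<Sigma> e \<Longrightarrow> bd (edges \<Sigma>) f r \<in> {0, 2, -2}"
proof -
  note TE = treeD(1)[OF T]
  have "\<exists>f x. (\<forall>y. y \<notin> T \<longrightarrow> f y = 0) \<and> (att \<Sigma> e i \<noteq> None \<longrightarrow> x = 1 \<or> x = (-1 :: int)) \<and>
      (\<forall>v. bd (edges \<Sigma>) f v = (if att \<Sigma> e i = Some v then 1 else 0) + (if v = r then x else 0))" for i
  proof (cases "att \<Sigma> e i")
    case None
    then show ?thesis by (intro exI[of _ "\<lambda>_. 0"] exI[of _ 0]) (simp add: bd_def)
  next
    case (Some u)
    obtain f \<epsilon> where f: "\<And>y. y \<notin> T \<Longrightarrow> f y = 0" "\<epsilon> = 1 \<or> \<epsilon> = -1"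
      "\<And>v. bd T f v = (if v = u then 1 else 0) + (if v = r then \<epsilon> else 0)"
      using path_chain[OF TE treeD(6)[OF T e(3)[rule_format, OF Some] r]] by metis
    have "bd (edges \<Sigma>) f v = bd T f v" for v
      by (rule bd_superset) (use TE f(1) in auto)
    then show ?thesis using f Some by (intro exI[of _ f] exI[of _ \<epsilon>]) auto
  qed
  then obtain f x where f: "\<And>i y. y \<notin> T \<Longrightarrow> f i y = 0"
    "\<And>i. att \<Sigma> e i \<noteq> None \<Longrightarrow> x i = 1 \<or> x i = (-1 :: int)"
    "\<And>i v. bd (edges \<Sigma>) (f i) v = (if att \<Sigma> e i = Some v then 1 else 0) + (if v = r then x i else 0)"
    by metis
  \<comment> \<open>The factors \<open>- tau e i\<close> make the two path chains cancel the
    boundary of \<open>e\<close> at its own ends.\<close>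
  define h where "h = (\<lambda>y. (if y = e then 1 else 0) + ((- tau e True) * f True y + (- tau e False) * f False y))"
  have bdh: "bd (edges \<Sigma>) h v = (if v = r then - tau e True * x True - tau e False * x False else 0)" for v
  proof -
    have "bd (edges \<Sigma>) h v = eta v e + ((- tau e True) * bd (edges \<Sigma>) (f True) v + (- tau e False) * bd (edges \<Sigma>) (f False) v)"
      unfolding h_def bd_add bd_scale bd_single[OF subset_refl e(1)] by simp
    moreover have "eta v e = (if att \<Sigma> e True = Some v then tau e True else 0) +
        (if att \<Sigma> e False = Some v then tau e False else 0)"
      using eta_alt[of v e True] by simp
    ultimately show ?thesis
      unfolding f(3)
      by (cases "v = r"; cases "att \<Sigma> e True = Some v"; cases "att \<Sigma> e False = Some v")
        (simp_all add: algebra_simps)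
  qed
  have "bd (edges \<Sigma>) h r \<in> {0, 2, -2}" if "\<not> outer_edge \<Sigma> e"
  proof -
    have "att \<Sigma> e i \<noteq> None" for i using attached[OF e(1) that] by auto
    then show ?thesis
      using f(2)[of True] f(2)[of False] tau_cases[OF e(1), of True] tau_cases[OF e(1), of False]
      by (auto simp: bdh)
  qed
  moreover have "h e = 1" using f(1)[of e] e(2) by (simp add: h_def)
  moreover have "h y = 0" if "y \<notin> insert e T" for y using f(1)[of y] that by (simp add: h_def)
  moreover have "bd (edges \<Sigma>) h v = 0" if "v \<noteq> r" for v using that by (simp add: bdh)
  ultimately show ?thesis by (intro that[of h])
qed

end

locale based = signed_graph \<Sigma> for \<Sigma> :: "('v, 'e) sgraph" +
  fixes D :: "('v, 'e) sgraph \<Rightarrow> 'e set" and B :: "'e set"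
  assumes base: "\<And>\<Gamma>. \<Gamma> \<in> components \<Sigma> \<Longrightarrow> component_base \<Gamma> (D \<Gamma>)"
    and B_eq: "B = (\<Union>\<Gamma>\<in>components \<Sigma>. D \<Gamma>)"
begin

section \<open>The base inside components, its circles and key edges\<close>

lemma D_subset:
  assumes "\<Gamma> \<in> components \<Sigma>"
  shows "D \<Gamma> \<subseteq> edges \<Gamma>"
  by (rule component_base_cases[OF assms base[OF assms]]) (auto simp: outer_base_def negative_base_def)

lemma B_subset: "B \<subseteq> edges \<Sigma>"
  using D_subset component_edges_subset B_eq by blast

lemma B_component:
  assumes "\<Gamma> \<in> components \<Sigma>"
  shows "B \<inter> edges \<Gamma> = D \<Gamma>"
proof -
  have "x \<in> D \<Gamma>" if "x \<in> D \<Delta>" "\<Delta> \<in> components \<Sigma>" "x \<in> edges \<Gamma>" for x \<Delta>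
    using component_edge_unique[OF assms that(2,3)] D_subset[OF that(2)] that(1) by blast
  then show ?thesis using D_subset[OF assms] B_eq assms by blast
qed

definition N :: "'e set set" where "N = {C \<in> negative_circles \<Sigma>. C \<subseteq> B}"

text \<open>An edge of the circle whose removal turns the component base into a spanning tree.
  Several pairs of a tree and an edge can describe the same base, so one key edge per circle is
  chosen.\<close>

definition key_edge :: "'e set \<Rightarrow> 'e \<Rightarrow> bool" where
  "key_edge C b \<longleftrightarrow> (\<exists>\<Gamma> T. \<Gamma> \<in> components \<Sigma> \<and> tree T (verts \<Gamma>) \<and> T \<subseteq> edges \<Gamma> \<and> \<not> balanced \<Gamma> \<and>
     outer_edges \<Gamma> = {} \<and> negative_base \<Gamma> (D \<Gamma>) T b C)"

definition key :: "'e set \<Rightarrow> 'e" where "key C = (SOME b. key_edge C b)"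

lemma negative_baseD:
  assumes "negative_base \<Gamma> D' T b S"
  shows "b \<in> edges \<Gamma>" "D' = insert b T" "b \<notin> T" "b \<in> S" "S \<in> negative_circles \<Sigma>" "S \<subseteq> D'"
    "is_circle (subgr \<Sigma> S)" "\<And>X. X \<subseteq> D' \<Longrightarrow> is_circle (subgr \<Sigma> X) \<Longrightarrow> X = S" "S \<subseteq> edges \<Sigma>"
    "(\<Prod>e\<in>S. esign \<Sigma> e) = -1"
proof -
  have *: "X \<subseteq> D' \<and> is_circle (subgr \<Sigma> X) \<longleftrightarrow> X = S" for X
    using assms unfolding negative_base_def by blast
  show "S \<subseteq> D'" "is_circle (subgr \<Sigma> S)" using *[of S] by simp_all
  show "X \<subseteq> D' \<Longrightarrow> is_circle (subgr \<Sigma> X) \<Longrightarrow> X = S" for X using *[of X] by simp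
  show S: "S \<in> negative_circles \<Sigma>" using assms by (simp add: negative_base_def)
  then show "S \<subseteq> edges \<Sigma>" "(\<Prod>e\<in>S. esign \<Sigma> e) = -1" by (simp_all add: negative_circles_iff)
qed (use assms in \<open>simp_all add: negative_base_def\<close>)

lemma negative_base_N:
  assumes "\<Gamma> \<in> components \<Sigma>" "negative_base \<Gamma> (D \<Gamma>) T b S"
  shows "S \<in> N"
proof -
  have "D \<Gamma> \<subseteq> B" using assms(1) B_eq by blast
  then show ?thesis
    using negative_baseD(5,6)[OF assms(2)] by (simp add: N_def)
qed

text \<open>A circle is connected, so it lies in the base of one component. A tree contains none and
  an outer-edge belongs to none, which leaves unbalanced components without outer-edges.\<close>

lemma key_edge_exists:
  assumes "C \<in> N"
  shows "\<exists>b. key_edge C b"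
proof -
  have C: "C \<subseteq> edges \<Sigma>" "is_circle (subgr \<Sigma> C)" "C \<subseteq> B"
    using assms by (auto simp: N_def negative_circles_iff)
  obtain \<Gamma> where \<Gamma>: "\<Gamma> \<in> components \<Sigma>" "C \<subseteq> edges \<Gamma>"
    by (rule connected_in_component[OF C(1) circleD(1)[OF C(2)]])
  have CD: "C \<subseteq> D \<Gamma>" using B_component[OF \<Gamma>(1)] \<Gamma>(2) C(3) by blast
  show ?thesis
  proof (rule component_base_cases[OF \<Gamma>(1) base[OF \<Gamma>(1)]])
    fix T assume T: "tree T (verts \<Gamma>)" "D \<Gamma> = T"
    then show ?thesis using treeD(7)[OF T(1)] C(2) CD by blast
  next
    fix T b assume T: "tree T (verts \<Gamma>)" "outer_base \<Gamma> (D \<Gamma>) T b"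
    then have "b \<notin> C" using circleD(2)[OF C(2)] by (auto simp: outer_base_def)
    then have "C \<subseteq> T" using T(2) CD by (auto simp: outer_base_def)
    then show ?thesis using treeD(7)[OF T(1)] C(2) by blast
  next
    fix T b S assume T: "tree T (verts \<Gamma>)" "T \<subseteq> edges \<Gamma>" "\<not> balanced \<Gamma>" "outer_edges \<Gamma> = {}"
      "negative_base \<Gamma> (D \<Gamma>) T b S"
    have "C = S" by (rule negative_baseD(8)[OF T(5) CD C(2)])
    then show ?thesis using T \<Gamma>(1) unfolding key_edge_def by blast
  qed
qed

lemma keyE:
  assumes "C \<in> N"
  obtains \<Gamma> T where "\<Gamma> \<in> components \<Sigma>" "tree T (verts \<Gamma>)" "T \<subseteq> edges \<Gamma>" "\<not> balanced \<Gamma>"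
    "outer_edges \<Gamma> = {}" "negative_base \<Gamma> (D \<Gamma>) T (key C) C"
proof -
  have "key_edge C (key C)" unfolding key_def using key_edge_exists[OF assms] by (rule someI_ex)
  then show ?thesis using that unfolding key_edge_def by blast
qed

lemma key_mem: "C \<in> N \<Longrightarrow> key C \<in> C"
  by (rule keyE) (auto dest: negative_baseD)

text \<open>The base of such a component contains only one circle, and an edge determines its
  component.\<close>

lemma N_disjoint:
  assumes "C \<in> N" "C' \<in> N" "x \<in> C" "x \<in> C'"
  shows "C = C'"
proof -
  obtain \<Gamma> T where \<Gamma>: "\<Gamma> \<in> components \<Sigma>" "negative_base \<Gamma> (D \<Gamma>) T (key C) C" using keyE[OF assms(1)] by metis
  obtain \<Delta> U where \<Delta>: "\<Delta> \<in> components \<Sigma>" "negative_base \<Delta> (D \<Delta>) U (key C') C'" using keyE[OF assms(2)] by metis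
  have "x \<in> edges \<Gamma>" "x \<in> edges \<Delta>"
    using negative_baseD(6)[OF \<Gamma>(2)] negative_baseD(6)[OF \<Delta>(2)] D_subset \<Gamma>(1) \<Delta>(1) assms by blast+
  then have "\<Gamma> = \<Delta>" using component_edge_unique \<Gamma>(1) \<Delta>(1) by blast
  then show ?thesis
    using negative_baseD(8)[OF \<Gamma>(2)] negative_baseD(6,7)[OF \<Delta>(2)] by blast
qed

text \<open>Without key edges, the part of \<open>X\<close> in a component lies in a tree or in a
  tree with an outer-edge, and both have leaves; at vertices of the component, degrees in this part
  agree with degrees in \<open>X\<close>.\<close>

lemma base_leaf:
  assumes X: "X \<subseteq> B" "X \<noteq> {}" "\<And>C. C \<in> N \<Longrightarrow> key C \<notin> X"
  obtains v where "v \<in> vset X" "deg X v = 1"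
proof -
  have XE: "X \<subseteq> edges \<Sigma>" using X B_subset by blast
  obtain x where x: "x \<in> X" using X by blast
  obtain \<Gamma> where \<Gamma>: "\<Gamma> \<in> components \<Sigma>" "x \<in> edges \<Gamma>" using component_of_edge x XE by blast
  let ?Y = "X \<inter> edges \<Gamma>"
  have Y: "?Y \<noteq> {}" "?Y \<subseteq> D \<Gamma>" using x \<Gamma>(2) B_component[OF \<Gamma>(1)] X(1) by blast+
  have "\<exists>v. v \<in> vset ?Y \<and> deg ?Y v = 1"
  proof (rule component_base_cases[OF \<Gamma>(1) base[OF \<Gamma>(1)]])
    fix T assume T: "tree T (verts \<Gamma>)" "D \<Gamma> = T"
    then show ?thesis using tree_leaf[OF T(1) _ Y(1)] Y(2) by metis
  next
    fix T b assume T: "tree T (verts \<Gamma>)" "outer_base \<Gamma> (D \<Gamma>) T b"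
    then have "?Y \<subseteq> insert b T" "b \<in> edges \<Sigma>" "outer_edge \<Sigma> b"
      using Y(2) component_edges_subset[OF \<Gamma>(1)] by (auto simp: outer_base_def)
    then show ?thesis using tree_outer_leaf[OF T(1) _ Y(1)] by metis
  next
    fix T b S assume S: "negative_base \<Gamma> (D \<Gamma>) T b S"
    then have SN: "S \<in> N" using negative_base_N \<Gamma>(1) by blast
    \<comment> \<open>The edge \<open>b\<close> and tree \<open>T\<close> of this case need not be
      those belonging to \<open>key S\<close>, so the base is decomposed again with the chosen key
      edge.\<close>
    then obtain \<Delta> U where \<Delta>: "\<Delta> \<in> components \<Sigma>" "tree U (verts \<Delta>)" "negative_base \<Delta> (D \<Delta>) U (key S) S"
      using keyE by metis
    have "b \<in> edges \<Gamma>" "b \<in> edges \<Delta>"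
      using negative_baseD(1,4)[OF S] negative_baseD(6)[OF \<Delta>(3)] D_subset[OF \<Delta>(1)] by blast+
    then have "\<Gamma> = \<Delta>" using component_edge_unique \<Gamma>(1) \<Delta>(1) by blast
    then have "?Y \<subseteq> insert (key S) U" using Y(2) negative_baseD(2)[OF \<Delta>(3)] by simp
    then have "?Y \<subseteq> U" using X(3)[OF SN] by blast
    then show ?thesis using tree_leaf[OF \<Delta>(2) _ Y(1)] by metis
  qed
  then obtain v where v: "v \<in> vset ?Y" "deg ?Y v = 1" by blast
  have "v \<in> verts \<Gamma>" using v(1) component_closed[OF \<Gamma>(1)] unfolding vset_def by blast
  then have "deg X v = 1" using component_ends[OF \<Gamma>(1) _ XE] v(2) by simp
  moreover have "v \<in> vset X" using v(1) vset_mono[of ?Y X] by blast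
  ultimately show ?thesis using that by blast
qed

text \<open>The support of a nontrivial \<open>f\<close> would have a leaf, where the Kirchhoff
  product is not neutral.\<close>

lemma flow_on_base_trivial:
  assumes "comm_group A" "f \<in> edges \<Sigma> \<rightarrow> carrier A" "\<And>v. v \<in> verts \<Sigma> \<Longrightarrow> kirchhoff A f v = \<one>\<^bsub>A\<^esub>"
    "\<And>x. x \<in> edges \<Sigma> - B \<Longrightarrow> f x = \<one>\<^bsub>A\<^esub>" "\<And>C. C \<in> N \<Longrightarrow> f (key C) = \<one>\<^bsub>A\<^esub>" "x \<in> edges \<Sigma>"
  shows "f x = \<one>\<^bsub>A\<^esub>"
proof (rule ccontr)
  let ?X = "{x \<in> edges \<Sigma>. f x \<noteq> \<one>\<^bsub>A\<^esub>}"
  assume "f x \<noteq> \<one>\<^bsub>A\<^esub>"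
  then have "?X \<subseteq> B" "?X \<noteq> {}" "\<And>C. C \<in> N \<Longrightarrow> key C \<notin> ?X" using assms(4-6) by auto
  then obtain v where v: "v \<in> vset ?X" "deg ?X v = 1" by (rule base_leaf)
  moreover have "v \<in> verts \<Sigma>" using v(1) vset_subset[of ?X] by blast
  ultimately show False using kirchhoff_leaf[OF assms(1,2)] assms(3) by blast
qed

text \<open>Subtracting \<open>f (key C)\<close> times the circle chain leaves, inside the
  component, a chain on the tree that is conserved off \<open>r\<close>, hence trivial. So
  \<open>f\<close> equals that multiple there, and conservation at \<open>r\<close> says that twice
  \<open>f (key C)\<close> vanishes.\<close>

lemma flow_on_base_tor2:
  assumes A: "comm_group A" and f: "f \<in> edges \<Sigma> \<rightarrow> carrier A"
    and K: "\<And>v. v \<in> verts \<Sigma> \<Longrightarrow> kirchhoff A f v = \<one>\<^bsub>A\<^esub>"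
    and off: "\<And>x. x \<in> edges \<Sigma> - B \<Longrightarrow> f x = \<one>\<^bsub>A\<^esub>" and C: "C \<in> N"
  shows "f (key C) \<in> tor2 A"
proof -
  interpret A: comm_group A by fact
  let ?b = "key C"
  obtain \<Gamma> T where \<Gamma>: "\<Gamma> \<in> components \<Sigma>" "tree T (verts \<Gamma>)" "T \<subseteq> edges \<Gamma>" and nb: "negative_base \<Gamma> (D \<Gamma>) T ?b C"
    using keyE[OF C] by metis
  note nb = negative_baseD[OF nb]
  have bE: "?b \<in> edges \<Sigma>" using nb(4,9) by blast
  have a: "f ?b \<in> carrier A" using f bE by blast
  obtain r where r: "att \<Sigma> ?b True = Some r"
    using attached[OF bE circleD(2)[OF nb(7,4)]] by blast
  have rW: "r \<in> verts \<Gamma>" using component_closed[OF \<Gamma>(1) nb(1) r] .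
  obtain g where g: "\<And>e. e \<notin> C \<Longrightarrow> g e = 0" "g ?b = (1::int)" "\<And>v. v \<noteq> r \<Longrightarrow> bd C g v = 0" "\<bar>bd C g r\<bar> = 2"
    by (rule circle_chain[OF nb(7,9,4) r]; rule that; (use nb(10) in blast)?; blast)
  have bdg: "bd (edges \<Sigma>) g v = bd C g v" for v
    by (rule bd_superset) (use nb(9) g(1) in auto)
  define h where "h = (\<lambda>e. f e \<otimes>\<^bsub>A\<^esub> f ?b [^]\<^bsub>A\<^esub> (- g e))"
  have hc: "h \<in> edges \<Sigma> \<rightarrow> carrier A" using f a by (auto simp: h_def)
  have pc: "(\<lambda>e. f ?b [^]\<^bsub>A\<^esub> k e) \<in> edges \<Sigma> \<rightarrow> carrier A" for k :: "'e \<Rightarrow> int" using a by auto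
  have Kh: "kirchhoff A h v = \<one>\<^bsub>A\<^esub>" if "v \<in> verts \<Sigma>" "v \<noteq> r" for v
  proof -
    have "bd (edges \<Sigma>) (\<lambda>e. - g e) v = 0"
      using bd_scale[of "edges \<Sigma>" "-1" g v] g(3)[OF that(2)] by (simp add: bdg)
    then show ?thesis
      unfolding h_def kirchhoff_mult[OF A f pc] kirchhoff_int_pow[OF A a] using K[OF that(1)] a by simp
  qed
  let ?X = "{e \<in> edges \<Sigma>. h e \<noteq> \<one>\<^bsub>A\<^esub>}"
  have hb: "h ?b = \<one>\<^bsub>A\<^esub>" using a g(2) by (simp add: h_def A.int_pow_neg A.int_pow_1)
  have hD: "h e = \<one>\<^bsub>A\<^esub>" if "e \<in> edges \<Gamma>" "e \<notin> D \<Gamma>" for e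
  proof -
    have "e \<in> edges \<Sigma> - B" using that B_component[OF \<Gamma>(1)] component_edges_subset[OF \<Gamma>(1)] by blast
    moreover have "e \<notin> C" using nb(6) that by blast
    ultimately show ?thesis using off g(1) by (simp add: h_def)
  qed
  have "?X \<inter> edges \<Gamma> = {}"
  proof (rule ccontr)
    assume ne: "?X \<inter> edges \<Gamma> \<noteq> {}"
    have sub: "?X \<inter> edges \<Gamma> \<subseteq> T"
    proof
      fix e assume e: "e \<in> ?X \<inter> edges \<Gamma>"
      then have "e \<in> D \<Gamma>" "e \<noteq> ?b" using hD hb by auto
      then show "e \<in> T" using nb(2) by blast
    qed
    obtain v where v: "v \<in> vset (?X \<inter> edges \<Gamma>)" "v \<noteq> r" "deg (?X \<inter> edges \<Gamma>) v = 1"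
      by (rule tree_leaf[OF \<Gamma>(2) sub ne])
    have vW: "v \<in> verts \<Gamma>" using v(1) component_closed[OF \<Gamma>(1)] unfolding vset_def by blast
    have "deg ?X v = 1" using component_ends[OF \<Gamma>(1) vW, of ?X] v(3) by auto
    moreover have "v \<in> verts \<Sigma>" using vW component_verts(2)[OF \<Gamma>(1)] by blast
    ultimately show False using kirchhoff_leaf[OF A hc] Kh[OF _ v(2)] by blast
  qed
  then have h1: "h e = \<one>\<^bsub>A\<^esub>" if "e \<in> edges \<Gamma>" for e
    using that component_edges_subset[OF \<Gamma>(1)] by blast
  have rV: "r \<in> verts \<Sigma>" using rW component_verts(2)[OF \<Gamma>(1)] by blast
  have one: "(\<lambda>_. \<one>\<^bsub>A\<^esub>) \<in> edges \<Sigma> \<rightarrow> carrier A" by simp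
  \<comment> \<open>Only edges in the component of \<open>r\<close> are known to have neutral value,
    and no others meet \<open>r\<close>.\<close>
  have "kirchhoff A h r = kirchhoff A (\<lambda>_. \<one>\<^bsub>A\<^esub>) r"
    by (rule kirchhoff_cong[OF A hc _ one]) (rule h1, rule component_edgeI[OF \<Gamma>(1) _ _ rW])
  also have "\<dots> = \<one>\<^bsub>A\<^esub>" by (simp add: kirchhoff_def)
  finally have "kirchhoff A f r \<otimes>\<^bsub>A\<^esub> f ?b [^]\<^bsub>A\<^esub> (bd (edges \<Sigma>) (\<lambda>e. - g e) r) = \<one>\<^bsub>A\<^esub>"
    unfolding h_def kirchhoff_mult[OF A f pc] kirchhoff_int_pow[OF A a] .
  moreover have "bd (edges \<Sigma>) (\<lambda>e. - g e) r = - bd C g r"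
    using bd_scale[of "edges \<Sigma>" "-1" g r] by (simp add: bdg)
  ultimately have "f ?b [^]\<^bsub>A\<^esub> (- bd C g r) = \<one>\<^bsub>A\<^esub>"
    using K[OF rV] a by simp
  moreover have "bd C g r = 2 \<or> bd C g r = -2" using g(4) by linarith
  ultimately have "f ?b [^]\<^bsub>A\<^esub> (2::int) = \<one>\<^bsub>A\<^esub>"
    using a by (auto simp: A.int_pow_neg)
  then have "f ?b [^]\<^bsub>A\<^esub> (2::nat) = \<one>\<^bsub>A\<^esub>"
    by (metis int_pow_int of_nat_numeral)
  then show ?thesis using a by (simp add: tor2_def)
qed

end

section \<open>Fundamental circuits\<close>

lemma finprod_integer_group: "finprod integer_group f F = sum f F" if "finite F"
proof -
  interpret comm_group integer_group by (rule abelian_integer_group)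
  show ?thesis using that by (induction F rule: finite_induct) auto
qed

context signed_graph
begin

lemma kirchhoff_integer_group: "kirchhoff integer_group f v = bd (edges \<Sigma>) f v"
  by (simp add: kirchhoff_def bd_def finprod_integer_group finite_edges)

definition ref :: "'e \<Rightarrow> 'e arc" where "ref e = (e, tau e)"

section \<open>Arcs, reference arcs and flows\<close>

lemma fst_ref [simp]: "fst (ref e) = e"
  by (simp add: ref_def)

lemma fst_arc_inv [simp]: "fst (arc_inv a) = fst a"
  by (simp add: arc_inv_def)

lemma arc_inv_arc_inv [simp]: "arc_inv (arc_inv a) = a"
  by (simp add: arc_inv_def)

text \<open>The sign of an edge fixes one arrow from the other, so there are just two arcs, inverse
  to each other; \<open>tau\<close> gives the one with arrow 1 at end \<open>True\<close>.\<close>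

lemma arcs_iff: "a \<in> arcs \<Sigma> \<longleftrightarrow> fst a \<in> edges \<Sigma> \<and> (a = ref (fst a) \<or> a = arc_inv (ref (fst a)))"
proof -
  obtain e t where a: "a = (e, t)" by (cases a)
  have eq: "t = s \<longleftrightarrow> t True = s True \<and> t False = s False" for s :: "bool \<Rightarrow> int"
  proof
    assume "t True = s True \<and> t False = s False"
    then show "t = s" by (intro ext) (case_tac x; simp)
  qed simp
  show ?thesis
  proof (cases "e \<in> edges \<Sigma>")
    case True
    then show ?thesis
      using esign_cases[OF True]
      unfolding a arcs_def ref_def arc_inv_def
      by (auto simp: eq tau_def all_bool_eq)
  qed (simp add: a arcs_def)
qed

lemma ref_arc: "e \<in> edges \<Sigma> \<Longrightarrow> ref e \<in> arcs \<Sigma>"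
  by (simp add: arcs_iff)

lemma arc_inv_arc: "a \<in> arcs \<Sigma> \<Longrightarrow> arc_inv a \<in> arcs \<Sigma>"
  by (metis arcs_iff arc_inv_arc_inv fst_arc_inv)

lemma arc_inv_neq: "a \<in> arcs \<Sigma> \<Longrightarrow> arc_inv a \<noteq> a"
proof
  assume a: "a \<in> arcs \<Sigma>" "arc_inv a = a"
  have "snd (arc_inv a) True = - snd a True" by (simp add: arc_inv_def)
  then have "snd a True = 0" using a(2) by simp
  moreover have "snd a True = 1 \<or> snd a True = -1"
    using a(1) by (cases a) (simp add: arcs_def)
  ultimately show False by simp
qed

lemma incidence_inv: "incidence \<Sigma> v (arc_inv a) = - incidence \<Sigma> v a"
  by (cases a) (simp add: incidence_def arc_inv_def)

lemma incidence_ref: "e \<in> edges \<Sigma> \<Longrightarrow> incidence \<Sigma> v (ref e) = eta v e"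
  using esign_cases[of e]
  by (auto simp: incidence_def ref_def eta_alt[of v e True] tau_def loop_at_def all_bool_eq)

lemma orientation_image:
  assumes "orientation \<Sigma> S \<omega>" "S \<subseteq> edges \<Sigma>"
  obtains \<phi> where "\<omega> = \<phi> ` S" "inj_on \<phi> S" "\<And>e. e \<in> S \<Longrightarrow> fst (\<phi> e) = e"
    "\<And>e. e \<in> S \<Longrightarrow> \<phi> e = ref e \<or> \<phi> e = arc_inv (ref e)"
proof -
  have "\<forall>e\<in>S. \<exists>a. a \<in> \<omega> \<and> fst a = e" using assms(1) unfolding orientation_def by blast
  then obtain \<phi> where \<phi>: "\<And>e. e \<in> S \<Longrightarrow> \<phi> e \<in> \<omega> \<and> fst (\<phi> e) = e" by metis
  have sub: "a \<in> arcs \<Sigma>" "fst a \<in> S" if "a \<in> \<omega>" for a using assms(1) that by (auto simp: orientation_def)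
  have "a = \<phi> (fst a)" if "a \<in> \<omega>" for a
  proof -
    have "\<exists>!b. b \<in> \<omega> \<and> fst b = fst a" using assms(1) sub(2)[OF that] by (auto simp: orientation_def)
    then show ?thesis using \<phi>[OF sub(2)[OF that]] that by blast
  qed
  then have "\<omega> = \<phi> ` S" using \<phi> sub by blast
  moreover have "inj_on \<phi> S" using \<phi> by (metis inj_onI)
  moreover have "\<phi> e = ref e \<or> \<phi> e = arc_inv (ref e)" if "e \<in> S" for e
    using \<phi>[OF that] sub[of "\<phi> e"] arcs_iff[of "\<phi> e"] by auto
  ultimately show ?thesis using that \<phi> by blast
qed

lemma orientation_ref: "S \<subseteq> edges \<Sigma> \<Longrightarrow> orientation \<Sigma> S (ref ` S)"
  unfolding orientation_def
proof (intro conjI ballI)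
  assume S: "S \<subseteq> edges \<Sigma>"
  show "ref ` S \<subseteq> {a \<in> arcs \<Sigma>. fst a \<in> S}" using S ref_arc by auto
  show "\<exists>!a. a \<in> ref ` S \<and> fst a = e" if "e \<in> S" for e
    by (rule ex1I[of _ "ref e"]) (use that in \<open>auto simp del: split_paired_All\<close>)
qed

lemma one_chainsD:
  assumes "c \<in> one_chains \<Sigma> A"
  shows "c \<in> arcs \<Sigma> \<rightarrow>\<^sub>E carrier A" "a \<in> arcs \<Sigma> \<Longrightarrow> c (arc_inv a) = inv\<^bsub>A\<^esub> (c a)"
    "a \<in> arcs \<Sigma> \<Longrightarrow> c a \<in> carrier A" "(\<lambda>e. c (ref e)) \<in> edges \<Sigma> \<rightarrow> carrier A"
  using assms ref_arc by (auto simp: one_chains_def)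

text \<open>Reversing an arc inverts its value and negates its incidence number, so each factor is
  independent of the orientation. The law over all orientations therefore reduces to the reference
  arcs.\<close>

lemma flows_iff:
  assumes A: "comm_group A"
  shows "c \<in> flows \<Sigma> A \<longleftrightarrow> c \<in> one_chains \<Sigma> A \<and> (\<forall>v\<in>verts \<Sigma>. kirchhoff A (\<lambda>e. c (ref e)) v = \<one>\<^bsub>A\<^esub>)"
proof -
  interpret comm_group A by fact
  have "finprod A (\<lambda>a. c a [^]\<^bsub>A\<^esub> incidence \<Sigma> v a) \<omega> = kirchhoff A (\<lambda>e. c (ref e)) v"
    if c: "c \<in> one_chains \<Sigma> A" and \<omega>: "orientation \<Sigma> (edges \<Sigma>) \<omega>" for v \<omega>
  proof -
    obtain \<phi> where \<phi>: "\<omega> = \<phi> ` edges \<Sigma>" "inj_on \<phi> (edges \<Sigma>)"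
      "\<And>e. e \<in> edges \<Sigma> \<Longrightarrow> fst (\<phi> e) = e" "\<And>e. e \<in> edges \<Sigma> \<Longrightarrow> \<phi> e = ref e \<or> \<phi> e = arc_inv (ref e)"
      using orientation_image[OF \<omega> subset_refl] by metis
    have term_eq: "c (\<phi> e) [^]\<^bsub>A\<^esub> incidence \<Sigma> v (\<phi> e) = c (ref e) [^]\<^bsub>A\<^esub> eta v e"
      and cl: "c (\<phi> e) \<in> carrier A" if e: "e \<in> edges \<Sigma>" for e
    proof -
      note r = one_chainsD(2,3)[OF c ref_arc[OF e]]
      show "c (\<phi> e) [^]\<^bsub>A\<^esub> incidence \<Sigma> v (\<phi> e) = c (ref e) [^]\<^bsub>A\<^esub> eta v e" "c (\<phi> e) \<in> carrier A"
        using \<phi>(4)[OF e] r by (auto simp: incidence_inv incidence_ref[OF e] int_pow_neg int_pow_inv)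
    qed
    have "finprod A (\<lambda>a. c a [^]\<^bsub>A\<^esub> incidence \<Sigma> v a) \<omega> =
        finprod A (\<lambda>e. c (\<phi> e) [^]\<^bsub>A\<^esub> incidence \<Sigma> v (\<phi> e)) (edges \<Sigma>)"
      unfolding \<phi>(1) by (rule finprod_reindex) (use \<phi>(2) cl in auto)
    also have "\<dots> = kirchhoff A (\<lambda>e. c (ref e)) v"
      unfolding kirchhoff_def
      by (rule finprod_cong') (use term_eq one_chainsD(4)[OF c] in auto)
    finally show ?thesis .
  qed
  note K = this
  show ?thesis
  proof (cases "c \<in> one_chains \<Sigma> A")
    case True
    have "(\<forall>\<omega>. orientation \<Sigma> (edges \<Sigma>) \<omega> \<longrightarrow> finprod A (\<lambda>a. c a [^]\<^bsub>A\<^esub> incidence \<Sigma> v a) \<omega> = \<one>\<^bsub>A\<^esub>)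
        \<longleftrightarrow> kirchhoff A (\<lambda>e. c (ref e)) v = \<one>\<^bsub>A\<^esub>" for v
      using K[OF True] orientation_ref[OF subset_refl] by auto
    then show ?thesis using True unfolding flows_def by simp
  qed (simp add: flows_def)
qed

lemma signed_graph_subgr:
  assumes "S \<subseteq> edges \<Sigma>"
  shows "signed_graph (subgr \<Sigma> S)"
proof
  show "finite (verts (subgr \<Sigma> S))" using finite_vset[OF assms] by (simp add: verts_subgr)
  show "finite (edges (subgr \<Sigma> S))" using finite_sub[OF assms] by (simp add: subgr_def)
qed (use att_some esign_cases assms in \<open>auto simp: subgr_def\<close>)

text \<open>Passing to a subgraph changes neither attachments nor signs. Circuits are defined
  through flows of subgraphs, and these equations bring such flows back to boundaries in the whole
  graph.\<close>

lemma subgr_eqs: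
  assumes "S \<subseteq> edges \<Sigma>"
  shows "signed_graph.ref (subgr \<Sigma> S) = ref" "signed_graph.eta (subgr \<Sigma> S) = eta"
    "signed_graph.kirchhoff (subgr \<Sigma> S) integer_group f v = bd S f v"
    "arcs (subgr \<Sigma> S) = {a \<in> arcs \<Sigma>. fst a \<in> S}"
proof -
  interpret s: signed_graph "subgr \<Sigma> S" by (rule signed_graph_subgr[OF assms])
  have fields: "esign (subgr \<Sigma> S) = esign \<Sigma>" "att (subgr \<Sigma> S) = att \<Sigma>" "edges (subgr \<Sigma> S) = S"
    by (simp_all add: subgr_def)
  have tau: "s.tau = tau" by (intro ext) (simp add: s.tau_def tau_def fields)
  show "s.ref = ref" by (intro ext) (simp add: s.ref_def ref_def tau)
  show eta: "s.eta = eta" by (intro ext) (simp add: s.eta_def eta_def tau fields cong: if_cong)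
  show "s.kirchhoff integer_group f v = bd S f v"
    unfolding s.kirchhoff_integer_group s.bd_def eta bd_def fields ..
  show "arcs (subgr \<Sigma> S) = {a \<in> arcs \<Sigma>. fst a \<in> S}"
    using assms by (auto simp: arcs_def subgr_def)
qed

lemma nowhere_zero_flowD:
  assumes S: "S \<subseteq> edges \<Sigma>" and c: "nowhere_zero_flow (subgr \<Sigma> S) c"
  shows "\<And>e. e \<in> S \<Longrightarrow> c (ref e) \<noteq> 0" "\<And>e. e \<in> S \<Longrightarrow> c (arc_inv (ref e)) = - c (ref e)"
    "\<And>v. bd S (\<lambda>e. c (ref e)) v = 0"
proof -
  interpret s: signed_graph "subgr \<Sigma> S" by (rule signed_graph_subgr[OF S])
  note eqs = subgr_eqs[OF S]
  have ar: "ref e \<in> arcs (subgr \<Sigma> S)" if "e \<in> S" for e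
    unfolding eqs using that ref_arc S by auto
  have c': "c \<in> one_chains (subgr \<Sigma> S) integer_group" "\<And>v. v \<in> vset S \<Longrightarrow> bd S (\<lambda>e. c (ref e)) v = 0"
    using c unfolding nowhere_zero_flow_def s.flows_iff[OF abelian_integer_group] eqs verts_subgr by auto
  show "c (ref e) \<noteq> 0" if "e \<in> S" for e
    using c ar[OF that] by (auto simp: nowhere_zero_flow_def)
  show "c (arc_inv (ref e)) = - c (ref e)" if "e \<in> S" for e
    using s.one_chainsD(2)[OF c'(1) ar[OF that]] by simp
  show "bd S (\<lambda>e. c (ref e)) v = 0" for v
    using c'(2) bd_not_vset by blast
qed

definition chain_of :: "('e \<Rightarrow> int) \<Rightarrow> 'e arc \<Rightarrow> int" where
  "chain_of f a = (if a = ref (fst a) then f (fst a) else - f (fst a))"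

lemma chain_of_ref: "e \<in> edges \<Sigma> \<Longrightarrow> chain_of f (ref e) = f e" 
  and chain_of_inv_ref: "e \<in> edges \<Sigma> \<Longrightarrow> chain_of f (arc_inv (ref e)) = - f e"
  using arc_inv_neq[OF ref_arc[of e]] by (simp_all add: chain_of_def)

lemma nowhere_zero_flowI:
  assumes S: "S \<subseteq> edges \<Sigma>" and f: "\<And>e. e \<in> S \<Longrightarrow> f e \<noteq> 0" "\<And>v. bd S f v = 0"
  shows "nowhere_zero_flow (subgr \<Sigma> S) (restrict (chain_of f) (arcs (subgr \<Sigma> S)))" (is "nowhere_zero_flow _ ?c")
proof -
  interpret s: signed_graph "subgr \<Sigma> S" by (rule signed_graph_subgr[OF S])
  note eqs = subgr_eqs[OF S]
  have cases: "\<exists>e\<in>S. a = ref e \<or> a = arc_inv (ref e)" if "a \<in> arcs (subgr \<Sigma> S)" for a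
    using that unfolding eqs arcs_iff by auto
  have "?c \<in> one_chains (subgr \<Sigma> S) integer_group"
  proof -
    have "?c (arc_inv a) = - ?c a" if a: "a \<in> arcs (subgr \<Sigma> S)" for a
      using cases[OF a] a s.arc_inv_arc[OF a] S by (auto simp: chain_of_ref chain_of_inv_ref subsetD)
    then show ?thesis by (auto simp: one_chains_def)
  qed
  moreover have "bd S (\<lambda>e. ?c (ref e)) v = 0" for v
  proof -
    have "bd S (\<lambda>e. ?c (ref e)) v = bd S f v"
    proof (rule bd_cong)
      fix e assume e: "e \<in> S"
      then have "ref e \<in> arcs (subgr \<Sigma> S)" unfolding eqs using ref_arc S by auto
      then show "?c (ref e) = f e" using e S by (simp add: chain_of_ref subsetD)
    qed
    then show ?thesis using f by simp
  qed
  moreover have "?c a \<noteq> 0" if a: "a \<in> arcs (subgr \<Sigma> S)" for a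
    using cases[OF a] a f(1) S by (auto simp: chain_of_ref chain_of_inv_ref subsetD)
  ultimately show ?thesis
    unfolding nowhere_zero_flow_def s.flows_iff[OF abelian_integer_group] eqs by simp
qed

end

context based
begin

text \<open>The integers have no 2-torsion, so the values at the key edges vanish as well.\<close>

lemma integer_flow_on_base:
  assumes "\<And>x. x \<notin> B \<Longrightarrow> f x = 0" "\<And>v. bd (edges \<Sigma>) f v = (0::int)"
  shows "f x = 0"
proof (cases "x \<in> edges \<Sigma>")
  case True
  have "f x = \<one>\<^bsub>integer_group\<^esub>"
  proof (rule flow_on_base_trivial[OF abelian_integer_group])
    fix C assume "C \<in> N"
    then have "f (key C) \<in> tor2 integer_group"
      using assms by (intro flow_on_base_tor2[OF abelian_integer_group]) (auto simp: kirchhoff_integer_group)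
    then show "f (key C) = \<one>\<^bsub>integer_group\<^esub>" by (simp add: tor2_def)
  qed (use assms True in \<open>auto simp: kirchhoff_integer_group\<close>)
  then show ?thesis by simp
next
  case False
  then show ?thesis using assms(1) B_subset by blast
qed

text \<open>If the component is balanced, the tree and \<open>e\<close> together contain a circle,
  which is positive and carries a flow. Otherwise \<open>e\<close> is transferred along the tree to
  a vertex of the extra edge, and the boundary left there is removed by the outer-edge or by a
  multiple of the negative circle chain. The cardinality bound is part of the statement because the
  flow is afterwards known only through choice.\<close>

lemma fundamental_flow:
  assumes e: "e \<in> edges \<Sigma> - B"
  shows "\<exists>g. (\<forall>x. g x \<noteq> 0 \<longrightarrow> x \<in> insert e B) \<and> g e = (1::int) \<and> (\<forall>v. bd (edges \<Sigma>) g v = 0) \<and>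
    card {x. g x \<noteq> 0} \<le> card (vset {x. g x \<noteq> 0}) + 1"
proof -
  obtain \<Gamma> where \<Gamma>: "\<Gamma> \<in> components \<Sigma>" "e \<in> edges \<Gamma>" using component_of_edge e by blast
  have DB: "D \<Gamma> \<subseteq> B" using \<Gamma>(1) B_eq by blast
  have eE: "e \<in> edges \<Sigma>" "e \<notin> D \<Gamma>" using e DB by blast+
  have ends: "\<forall>i v. att \<Sigma> e i = Some v \<longrightarrow> v \<in> verts \<Gamma>" using component_closed[OF \<Gamma>] by blast
  have finish: ?thesis
    if T: "tree T (verts \<Gamma>)" "insert e (D \<Gamma>) \<subseteq> insert e (insert b T)"
      and g: "\<And>x. x \<notin> insert e (D \<Gamma>) \<Longrightarrow> g x = 0" "g e = (1::int)" "\<And>v. bd (edges \<Sigma>) g v = 0" for T b g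
  proof -
    let ?C = "{x. g x \<noteq> 0}"
    have C: "?C \<subseteq> insert e (D \<Gamma>)" using g(1) by blast
    have "card ?C \<le> card (vset ?C) + 1"
    proof (rule tree_plus_two_card[OF T(1)])
      show "?C \<subseteq> insert e (insert b T)" using C T(2) by blast
      show "?C \<noteq> {}" using g(2) by force
      show "?C \<subseteq> edges \<Sigma>" using C eE(1) DB B_subset by blast
    qed
    then show ?thesis using C DB g(2,3) by (intro exI[of _ g]) blast
  qed
  show ?thesis
  proof (rule component_base_cases[OF \<Gamma>(1) base[OF \<Gamma>(1)]])
    fix T assume T: "tree T (verts \<Gamma>)" "T \<subseteq> edges \<Gamma>" "balanced \<Gamma>" "D \<Gamma> = T"
    have bal: "outer_edges \<Gamma> = {}" "\<And>S. S \<in> circles \<Gamma> \<Longrightarrow> (\<Prod>e\<in>S. esign \<Sigma> e) = 1"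
      using T(3) by (auto simp: balanced_def component_att[OF \<Gamma>(1)])
    have TE: "insert e T \<subseteq> edges \<Sigma>" using treeD(1)[OF T(1)] eE by blast
    have no: "\<not> outer_edge \<Sigma> x" if "x \<in> insert e T" for x
      using bal(1) that \<Gamma>(2) T(2) component_outer_edges[OF \<Gamma>(1)] by blast
    have "vset (insert e T) \<subseteq> verts \<Gamma>"
      using ends treeD(3)[OF T(1)] unfolding vset_def by blast
    \<comment> \<open>The tree with \<open>e\<close> has as many edges as the component has
      vertices, which is dense enough to contain a circle.\<close>
    then have "card (vset (insert e T)) \<le> card (verts \<Gamma>)"
      by (rule card_mono[OF treeD(5)[OF T(1)]])
    also have "\<dots> = card (insert e T)"
      using tree_card[OF T(1)] finite_sub[OF treeD(1)[OF T(1)]] eE(2) T(4) by simp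
    finally obtain S where S: "S \<subseteq> insert e T" "is_circle (subgr \<Sigma> S)"
      using dense_contains_circle[OF TE] no by blast
    have SE: "S \<subseteq> edges \<Sigma>" using S(1) TE by blast
    have eS: "e \<in> S" using S treeD(7)[OF T(1)] by blast
    have "S \<in> circles \<Gamma>"
      unfolding component_circles[OF \<Gamma>(1)] using S T(2) \<Gamma>(2) by blast
    then have pos: "(\<Prod>x\<in>S. esign \<Sigma> x) = 1" by (rule bal(2))
    obtain w where w: "att \<Sigma> e True = Some w" using attached[OF eE(1)] no by blast
    obtain g where g: "\<And>x. x \<notin> S \<Longrightarrow> g x = 0" "g e = (1::int)" "\<And>v. v \<noteq> w \<Longrightarrow> bd S g v = 0" "bd S g w = 0"
      by (rule circle_chain[OF S(2) SE eS w]; rule that; (use pos in blast)?; blast)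
    have "bd (edges \<Sigma>) g v = 0" for v
    proof -
      have "bd (edges \<Sigma>) g v = bd S g v" by (rule bd_superset) (use SE g(1) in auto)
      then show ?thesis using g(3,4) by (cases "v = w") auto
    qed
    then show ?thesis
      using g(1,2) S(1) T(4) by (intro finish[OF T(1), of e g]) auto
  next
    fix T b assume T: "tree T (verts \<Gamma>)" "T \<subseteq> edges \<Gamma>" "outer_base \<Gamma> (D \<Gamma>) T b"
    then have b: "b \<in> edges \<Gamma>" "outer_edge \<Sigma> b" "D \<Gamma> = insert b T" by (auto simp: outer_base_def)
    have bE: "b \<in> edges \<Sigma>" using b component_edges_subset[OF \<Gamma>(1)] by blast
    obtain j r where r: "att \<Sigma> b j = Some r" using att_some[OF bE] by blast
    have "att \<Sigma> b (\<not> j) = None"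
    proof -
      obtain i where "att \<Sigma> b i = None" using b(2) outer_edge_iff[OF bE] by blast
      then show ?thesis using r by (cases "i = j") auto
    qed
    then have etab: "eta v b = (if v = r then tau b j else 0)" for v
      using r by (simp add: eta_alt[of v b j])
    have rW: "r \<in> verts \<Gamma>" by (rule component_closed[OF \<Gamma>(1) b(1) r])
    have eT: "e \<notin> T" "e \<noteq> b" using eE(2) b(3) by auto
    obtain f where f: "\<And>x. x \<notin> insert e T \<Longrightarrow> f x = 0" "f e = 1" "\<And>v. v \<noteq> r \<Longrightarrow> bd (edges \<Sigma>) f v = 0"
      using tree_transfer[OF T(1) eE(1) eT(1) ends rW] by metis
    \<comment> \<open>\<open>tau b j\<close> is its own inverse, so this value on the outer-edge
      cancels whatever boundary remains at \<open>r\<close>.\<close>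
    define k where "k = - bd (edges \<Sigma>) f r * tau b j"
    define g where "g = (\<lambda>x. f x + (if x = b then k else 0))"
    have "bd (edges \<Sigma>) g v = 0" for v
    proof (cases "v = r")
      case True
      have "bd (edges \<Sigma>) g v = bd (edges \<Sigma>) f r - bd (edges \<Sigma>) f r * (tau b j * tau b j)"
        unfolding g_def bd_add bd_single[OF subset_refl bE] True etab k_def by simp
      then show ?thesis by (simp add: tau_square[OF bE])
    next
      case False
      then show ?thesis unfolding g_def bd_add bd_single[OF subset_refl bE] by (simp add: etab f(3))
    qed
    then show ?thesis
      using f(1,2) b(3) eT by (intro finish[OF T(1), of b g]) (auto simp: g_def)
  next
    fix T b S assume T: "tree T (verts \<Gamma>)" "T \<subseteq> edges \<Gamma>" "outer_edges \<Gamma> = {}" "negative_base \<Gamma> (D \<Gamma>) T b S"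
    note nb = negative_baseD[OF T(4)]
    have bE: "b \<in> edges \<Sigma>" using nb(4,9) by blast
    obtain r where r: "att \<Sigma> b True = Some r" using attached[OF bE circleD(2)[OF nb(7,4)]] by blast
    have rW: "r \<in> verts \<Gamma>" by (rule component_closed[OF \<Gamma>(1) nb(1) r])
    have eT: "e \<notin> T" "e \<notin> S" using eE(2) nb(2,6) by auto
    have no: "\<not> outer_edge \<Sigma> e" using T(3) \<Gamma>(2) component_outer_edges[OF \<Gamma>(1)] by blast
    obtain f where f: "\<And>x. x \<notin> insert e T \<Longrightarrow> f x = 0" "f e = 1" "\<And>v. v \<noteq> r \<Longrightarrow> bd (edges \<Sigma>) f v = 0"
      "bd (edges \<Sigma>) f r \<in> {0, 2, -2}"
      using tree_transfer[OF T(1) eE(1) eT(1) ends rW] no by metis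
    obtain h where h: "\<And>x. x \<notin> S \<Longrightarrow> h x = (0::int)" "\<And>v. v \<noteq> r \<Longrightarrow> bd S h v = 0" "\<bar>bd S h r\<bar> = 2"
      by (rule circle_chain[OF nb(7,9,4) r]; rule that; (use nb(10) in blast)?; blast)
    have bdh: "bd (edges \<Sigma>) h v = bd S h v" for v
      by (rule bd_superset) (use nb(9) h(1) in auto)
    \<comment> \<open>The circle chain has boundary plus or minus 2 at \<open>r\<close> and the
      transferred edge 0 or plus or minus 2, so 0, 1 or -1 suffices.\<close>
    obtain k where k: "bd (edges \<Sigma>) f r + k * bd S h r = 0"
    proof -
      have "bd S h r = 2 \<or> bd S h r = -2" using h(3) by linarith
      then show ?thesis using f(4) that[of 0] that[of 1] that[of "-1"] by auto
    qed
    define g where "g = (\<lambda>x. f x + k * h x)"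
    have "bd (edges \<Sigma>) g v = 0" for v
      unfolding g_def bd_add bd_scale bdh using f(3) h(2) k by (cases "v = r") auto
    moreover have "g x = 0" if "x \<notin> insert e (D \<Gamma>)" for x
    proof -
      have "x \<notin> insert e T" "x \<notin> S" using that nb(2,6) by blast+
      then show ?thesis using f(1) h(1) by (simp add: g_def)
    qed
    moreover have "g e = 1" using f(2) h(1)[OF eT(2)] by (simp add: g_def)
    ultimately show ?thesis
      using nb(2) by (intro finish[OF T(1), of b g]) auto
  qed
qed

section \<open>The fundamental flow and circuit of an edge outside the base\<close>

definition fund :: "'e \<Rightarrow> 'e \<Rightarrow> int" where
  "fund e = (SOME g. (\<forall>x. g x \<noteq> 0 \<longrightarrow> x \<in> insert e B) \<and> g e = (1::int) \<and> (\<forall>v. bd (edges \<Sigma>) g v = 0) \<and>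
    card {x. g x \<noteq> 0} \<le> card (vset {x. g x \<noteq> 0}) + 1)"

lemma fund:
  assumes "e \<in> edges \<Sigma> - B"
  shows "\<And>x. x \<notin> insert e B \<Longrightarrow> fund e x = 0" "fund e e = 1" "\<And>v. bd (edges \<Sigma>) (fund e) v = 0"
    "card {x. fund e x \<noteq> 0} \<le> card (vset {x. fund e x \<noteq> 0}) + 1"
  using someI_ex[OF fundamental_flow[OF assms]] unfolding fund_def[symmetric] by blast+

text \<open>The difference of both sides vanishes at \<open>e\<close> and is therefore a flow on the
  base.\<close>

lemma fund_multiple:
  assumes e: "e \<in> edges \<Sigma> - B" and f: "\<And>x. x \<notin> insert e B \<Longrightarrow> f x = 0" "\<And>v. bd (edges \<Sigma>) f v = 0"
  shows "f x = f e * fund e x"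
proof -
  have "f x - f e * fund e x = 0"
  proof (rule integer_flow_on_base[of "\<lambda>x. f x - f e * fund e x"])
    show "f x - f e * fund e x = 0" if "x \<notin> B" for x
      using that f(1)[of x] fund(1)[OF e, of x] fund(2)[OF e] by (cases "x = e") auto
    show "bd (edges \<Sigma>) (\<lambda>x. f x - f e * fund e x) v = 0" for v
      by (simp add: bd_diff bd_scale f(2) fund(3)[OF e])
  qed
  then show ?thesis by simp
qed

definition fsupp :: "'e \<Rightarrow> 'e set" where "fsupp e = {x. fund e x \<noteq> 0}"

lemma fsupp_subset: "e \<in> edges \<Sigma> - B \<Longrightarrow> fsupp e \<subseteq> insert e B" "e \<in> edges \<Sigma> - B \<Longrightarrow> fsupp e \<subseteq> edges \<Sigma>"
proof -
  show 1: "fsupp e \<subseteq> insert e B" if "e \<in> edges \<Sigma> - B" for e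
    using fund(1)[OF that] unfolding fsupp_def by blast
  show "e \<in> edges \<Sigma> - B \<Longrightarrow> fsupp e \<subseteq> edges \<Sigma>"
    using 1[of e] B_subset by blast
qed

lemma bd_fsupp:
  assumes "e \<in> edges \<Sigma> - B" "\<And>x. x \<notin> fsupp e \<Longrightarrow> f x = 0"
  shows "bd (edges \<Sigma>) f v = bd (fsupp e) f v"
  by (rule bd_superset) (use fsupp_subset[OF assms(1)] assms(2) in auto)

lemma rigid_fund:
  assumes e: "e \<in> edges \<Sigma> - B"
  shows "rigid_flow \<Sigma> (fsupp e) (fund e) e"
proof
  show "fsupp e \<subseteq> edges \<Sigma>" by (rule fsupp_subset(2)[OF e])
  show "e \<in> fsupp e" using fund(2)[OF e] by (simp add: fsupp_def)
  show "(fund e b \<noteq> 0) = (b \<in> fsupp e)" for b by (simp add: fsupp_def)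
  show "bd (fsupp e) (fund e) v = 0" for v
    using bd_fsupp[OF e, of "fund e" v] fund(3)[OF e] by (simp add: fsupp_def)
  show "\<bar>fund e e\<bar> = 1" using fund(2)[OF e] by simp
  show "card (fsupp e) \<le> card (vset (fsupp e)) + 1" using fund(4)[OF e] by (simp add: fsupp_def)
  fix h b
  assume h: "\<And>b. b \<notin> fsupp e \<Longrightarrow> h b = 0" "\<And>v. bd (fsupp e) h v = 0" "h e = 0"
  have "h b = h e * fund e b"
  proof (rule fund_multiple[OF e])
    show "h x = 0" if "x \<notin> insert e B" for x
      using that fsupp_subset(1)[OF e] by (intro h(1)) blast
    show "bd (edges \<Sigma>) h v = 0" for v
      using bd_fsupp[of e h v] e h(1,2) by simp
  qed
  then show "h b = 0" using h(3) by simp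
qed

text \<open>Extended by zero, the flow is a multiple of \<open>fund e\<close>, with nonzero factor
  because it does not vanish on the nonempty set \<open>S\<close>.\<close>

lemma support_eq_fsupp:
  assumes e: "e \<in> edges \<Sigma> - B" and S: "S \<subseteq> insert e B" "S \<noteq> {}" and c: "nowhere_zero_flow (subgr \<Sigma> S) c"
  obtains k where "S = fsupp e" "k \<noteq> 0" "\<And>x. x \<in> S \<Longrightarrow> c (ref x) = k * fund e x"
proof -
  have SE: "S \<subseteq> edges \<Sigma>" using S(1) e B_subset by blast
  define f where "f = (\<lambda>x. if x \<in> S then c (ref x) else 0)"
  have f: "f x \<noteq> 0 \<longleftrightarrow> x \<in> S" for x using nowhere_zero_flowD(1)[OF SE c] by (simp add: f_def)
  have "bd (edges \<Sigma>) f v = 0" for v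
  proof -
    have "bd (edges \<Sigma>) f v = bd S f v" by (rule bd_superset) (use SE in \<open>auto simp: f_def\<close>)
    also have "\<dots> = bd S (\<lambda>x. c (ref x)) v" by (rule bd_cong) (simp add: f_def)
    finally show ?thesis using nowhere_zero_flowD(3)[OF SE c] by simp
  qed
  then have mult: "f x = f e * fund e x" for x
    using f S(1) by (intro fund_multiple[OF e]) blast+
  obtain y where "y \<in> S" using S(2) by blast
  then have "f y \<noteq> 0" using f by blast
  then have fe: "f e \<noteq> 0" unfolding mult[of y] by simp
  have "x \<in> S \<longleftrightarrow> x \<in> fsupp e" for x
    unfolding f[symmetric] mult[of x] fsupp_def using fe by simp
  then have "S = fsupp e" by blast
  moreover have "c (ref x) = f e * fund e x" if "x \<in> S" for x using mult[of x] that by (simp add: f_def)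
  ultimately show ?thesis using that[of "f e"] fe by blast
qed

text \<open>Every nonempty edge set inside \<open>insert e B\<close> with a nowhere-zero flow is the
  support of \<open>fund e\<close>, which gives uniqueness and minimality at once. The definite
  description in \<open>base_circuit\<close> thereby denotes this support.\<close>

lemma circuit_iff:
  assumes e: "e \<in> edges \<Sigma> - B"
  shows "circuit \<Sigma> C \<and> C \<subseteq> insert e B \<longleftrightarrow> C = fsupp e"
proof
  assume "circuit \<Sigma> C \<and> C \<subseteq> insert e B"
  then obtain c where "C \<subseteq> insert e B" "C \<noteq> {}" "nowhere_zero_flow (subgr \<Sigma> C) c"
    unfolding circuit_def by blast
  then show "C = fsupp e" using support_eq_fsupp[OF e] by metis
next
  assume C: "C = fsupp e"
  interpret r: rigid_flow \<Sigma> "fsupp e" "fund e" e by (rule rigid_fund[OF e])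
  have "nowhere_zero_flow (subgr \<Sigma> (fsupp e)) (restrict (chain_of (fund e)) (arcs (subgr \<Sigma> (fsupp e))))"
    by (rule nowhere_zero_flowI[OF r.C]) (use r.supp r.flow in auto)
  moreover have "\<not> (\<exists>c. nowhere_zero_flow (subgr \<Sigma> S) c)" if "S \<subset> fsupp e \<and> S \<noteq> {}" for S
  proof
    assume "\<exists>c. nowhere_zero_flow (subgr \<Sigma> S) c"
    then obtain c where c: "nowhere_zero_flow (subgr \<Sigma> S) c" by blast
    have "S \<subseteq> insert e B" using that fsupp_subset(1)[OF e] by blast
    then have "S = fsupp e" using support_eq_fsupp[OF e _ _ c] that by metis
    then show False using that by blast
  qed
  ultimately have "circuit \<Sigma> (fsupp e)"
    unfolding circuit_def using r.C r.e r.connected by blast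
  then show "circuit \<Sigma> C \<and> C \<subseteq> insert e B" using C fsupp_subset(1)[OF e] by blast
qed

lemma base_circuit_eq: "e \<in> edges \<Sigma> - B \<Longrightarrow> base_circuit \<Sigma> B e = fsupp e"
  unfolding base_circuit_def circuit_iff by simp

lemma direction_exists:
  assumes "e \<in> edges \<Sigma> - B"
  shows "\<exists>\<omega>. circuit_direction \<Sigma> (base_circuit \<Sigma> B e) \<omega>"
proof -
  have "circuit \<Sigma> (fsupp e)" using circuit_iff[OF assms] by blast
  then obtain c where "nowhere_zero_flow (subgr \<Sigma> (fsupp e)) c" unfolding circuit_def by blast
  then show ?thesis unfolding base_circuit_eq[OF assms] circuit_direction_def by blast
qed

text \<open>A direction comes from a flow that is a nonzero multiple of \<open>fund e\<close>, so it
  provides the signs up to one global sign \<open>s\<close>; \<open>value_double_edge\<close>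
  provides the absolute values.\<close>

lemma circuit_flow_fund:
  assumes e: "e \<in> edges \<Sigma> - B" and \<omega>: "circuit_direction \<Sigma> (base_circuit \<Sigma> B e) \<omega>"
  obtains s where "s = 1 \<or> s = -1" "\<And>x. x \<in> edges \<Sigma> \<Longrightarrow> circuit_flow \<Sigma> (base_circuit \<Sigma> B e) \<omega> (ref x) = s * fund e x"
    "\<And>x. x \<in> edges \<Sigma> \<Longrightarrow> circuit_flow \<Sigma> (base_circuit \<Sigma> B e) \<omega> (arc_inv (ref x)) = - (s * fund e x)"
proof -
  interpret r: rigid_flow \<Sigma> "fsupp e" "fund e" e by (rule rigid_fund[OF e])
  obtain c where c: "nowhere_zero_flow (subgr \<Sigma> (fsupp e)) c"
    and \<omega>_eq: "\<omega> = {a \<in> arcs (subgr \<Sigma> (fsupp e)). c a > 0}"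
    using \<omega> unfolding base_circuit_eq[OF e] circuit_direction_def by blast
  have "fsupp e \<noteq> {}" using r.e by blast
  then obtain k where k: "k \<noteq> 0" "\<And>x. x \<in> fsupp e \<Longrightarrow> c (ref x) = k * fund e x"
    using support_eq_fsupp[OF e fsupp_subset(1)[OF e] _ c] by metis
  define s where "s = sgn k"
  have mem: "ref x \<in> \<omega> \<longleftrightarrow> x \<in> fsupp e \<and> k * fund e x > 0"
    "arc_inv (ref x) \<in> \<omega> \<longleftrightarrow> x \<in> fsupp e \<and> k * fund e x < 0" if "x \<in> edges \<Sigma>" for x
    unfolding \<omega>_eq subgr_eqs(4)[OF r.C]
    using that k(2)[of x] nowhere_zero_flowD(2)[OF r.C c, of x] ref_arc[OF that] arc_inv_arc[OF ref_arc[OF that]]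
    by auto
  have val: "\<bar>fund e x\<bar> = (if double_edge \<Sigma> (fsupp e) x then 2 else 1)" if "x \<in> fsupp e" for x
    by (rule r.value_double_edge[OF that])
  have sg: "(if double_edge \<Sigma> (fsupp e) x then 2 else 1) * (if k * fund e x > 0 then 1 else if k * fund e x < 0 then -1 else 0)
    = s * fund e x" if "x \<in> fsupp e" for x
    unfolding val[OF that, symmetric] s_def using k(1)
    by (cases "k > 0"; cases "fund e x > 0"; cases "fund e x = 0")
      (auto simp: zero_less_mult_iff mult_less_0_iff)
  have 1: "circuit_flow \<Sigma> (base_circuit \<Sigma> B e) \<omega> (ref x) = s * fund e x" if x: "x \<in> edges \<Sigma>" for x
  proof (cases "x \<in> fsupp e")
    case True
    have "circuit_flow \<Sigma> (fsupp e) \<omega> (ref x) = (if double_edge \<Sigma> (fsupp e) x then 2 else 1) *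
        (if k * fund e x > 0 then 1 else if k * fund e x < 0 then -1 else 0)"
      unfolding circuit_flow_def using ref_arc[OF x] True by (simp add: mem[OF x] cong: if_cong)
    then show ?thesis unfolding base_circuit_eq[OF e] sg[OF True] .
  next
    case False
    then have "fund e x = 0" using r.supp by blast
    then show ?thesis unfolding base_circuit_eq[OF e] circuit_flow_def
      using ref_arc[OF x] False by (simp add: mem[OF x])
  qed
  have 2: "circuit_flow \<Sigma> (base_circuit \<Sigma> B e) \<omega> (arc_inv (ref x)) = - (s * fund e x)" if x: "x \<in> edges \<Sigma>" for x
  proof -
    have "circuit_flow \<Sigma> (base_circuit \<Sigma> B e) \<omega> (arc_inv (ref x)) = - circuit_flow \<Sigma> (base_circuit \<Sigma> B e) \<omega> (ref x)"
      unfolding circuit_flow_def using ref_arc[OF x] arc_inv_arc[OF ref_arc[OF x]] mem[OF x] by auto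
    then show ?thesis using 1[OF x] by simp
  qed
  show ?thesis by (rule that[of s]) (use k(1) 1 2 in \<open>auto simp: s_def sgn_if\<close>)
qed

end

section \<open>Coordinates on the flow group\<close>

text \<open>One statement about the kernel and one about the image yield both forms of the
  decomposition: the external one through the parameter groups \<open>K i\<close>, the internal one
  through their images, whose elements are lifted back to parameters.\<close>

lemma coordinate_iso:
  assumes G: "comm_group G" and I: "finite I" and K: "\<And>i. i \<in> I \<Longrightarrow> group (K i)"
    and \<phi>: "\<And>i. i \<in> I \<Longrightarrow> \<phi> i \<in> hom (K i) G"
    and inj: "\<And>h. h \<in> (\<Pi>\<^sub>E i\<in>I. carrier (K i)) \<Longrightarrow> finprod G (\<lambda>i. \<phi> i (h i)) I = \<one>\<^bsub>G\<^esub> \<Longrightarrow>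
      (\<And>i. i \<in> I \<Longrightarrow> h i = \<one>\<^bsub>K i\<^esub>)"
    and surj: "\<And>y. y \<in> carrier G \<Longrightarrow> \<exists>h\<in>(\<Pi>\<^sub>E i\<in>I. carrier (K i)). finprod G (\<lambda>i. \<phi> i (h i)) I = y"
  shows "(\<lambda>h. finprod G (\<lambda>i. \<phi> i (h i)) I) \<in> iso (product_group I K) G"
    and "internal_direct_sum G I (\<lambda>i. \<phi> i ` carrier (K i))"
proof -
  interpret G: comm_group G by fact
  let ?\<Theta> = "\<lambda>h. finprod G (\<lambda>i. \<phi> i (h i)) I"
  have cl: "\<phi> i x \<in> carrier G" if "i \<in> I" "x \<in> carrier (K i)" for i x
    using \<phi>[OF that(1)] that(2) by (auto simp: hom_def)
  have fcl: "(\<lambda>i. \<phi> i (h i)) \<in> I \<rightarrow> carrier G" if "h \<in> (\<Pi>\<^sub>E i\<in>I. carrier (K i))" for h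
    using that cl by (auto simp: PiE_iff)
  have PG: "group (product_group I K)" using K by simp
  have hom: "?\<Theta> \<in> hom (product_group I K) G"
  proof (rule homI)
    fix x assume "x \<in> carrier (product_group I K)"
    then show "?\<Theta> x \<in> carrier G" using fcl by simp
  next
    fix x y assume xy: "x \<in> carrier (product_group I K)" "y \<in> carrier (product_group I K)"
    have "?\<Theta> (x \<otimes>\<^bsub>product_group I K\<^esub> y) = finprod G (\<lambda>i. \<phi> i (x i) \<otimes>\<^bsub>G\<^esub> \<phi> i (y i)) I"
      using xy fcl by (intro G.finprod_cong') (auto simp: PiE_iff cl hom_mult[OF \<phi>])
    also have "\<dots> = ?\<Theta> x \<otimes>\<^bsub>G\<^esub> ?\<Theta> y"
      using xy fcl by (intro G.finprod_multf) auto
    finally show "?\<Theta> (x \<otimes>\<^bsub>product_group I K\<^esub> y) = ?\<Theta> x \<otimes>\<^bsub>G\<^esub> ?\<Theta> y" .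
  qed
  interpret \<Theta>: group_hom "product_group I K" G ?\<Theta>
    by (simp add: group_hom_def group_hom_axioms_def PG hom G.is_group)
  have "inj_on ?\<Theta> (carrier (product_group I K))"
    unfolding \<Theta>.inj_on_one_iff
  proof (intro allI impI)
    fix h assume h: "h \<in> carrier (product_group I K)" "?\<Theta> h = \<one>\<^bsub>G\<^esub>"
    then have "h \<in> (\<Pi>\<^sub>E i\<in>I. carrier (K i))" by simp
    then have "h i = (\<lambda>i\<in>I. \<one>\<^bsub>K i\<^esub>) i" for i
      using inj[OF _ h(2), of i] by (cases "i \<in> I") auto
    then show "h = \<one>\<^bsub>product_group I K\<^esub>" by auto
  qed
  moreover have "?\<Theta> ` carrier (product_group I K) = carrier G"
  proof
    show "?\<Theta> ` carrier (product_group I K) \<subseteq> carrier G" using \<Theta>.hom_closed by blast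
    show "carrier G \<subseteq> ?\<Theta> ` carrier (product_group I K)"
    proof
      fix y assume "y \<in> carrier G"
      then obtain h where "h \<in> (\<Pi>\<^sub>E i\<in>I. carrier (K i))" "?\<Theta> h = y" using surj by blast
      then show "y \<in> ?\<Theta> ` carrier (product_group I K)" by auto
    qed
  qed
  ultimately show "?\<Theta> \<in> iso (product_group I K) G"
    using hom by (simp add: iso_iff)
  let ?H = "\<lambda>i. \<phi> i ` carrier (K i)"
  let ?S = "sum_group I (\<lambda>i. G\<lparr>carrier := ?H i\<rparr>)"
  let ?F = "\<lambda>x. finprod G x I"
  have gh: "group_hom (K i) G (\<phi> i)" if "i \<in> I" for i
    using K[OF that] \<phi>[OF that] by (simp add: group_hom_def group_hom_axioms_def G.is_group)
  have sub: "subgroup (?H i) G" if "i \<in> I" for i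
    using group_hom.img_is_subgroup[OF gh[OF that]] .
  have grp: "group (G\<lparr>carrier := ?H i\<rparr>)" if "i \<in> I" for i
    using subgroup.subgroup_is_group[OF sub[OF that] G.is_group] .
  \<comment> \<open>The index set is finite, so the finitely supported families are all
    families.\<close>
  have carr: "carrier ?S = (\<Pi>\<^sub>E i\<in>I. ?H i)"
    using I grp by (subst carrier_sum_group) auto
  have Hcl: "x \<in> I \<rightarrow> carrier G" if "x \<in> carrier ?S" for x
    using that cl unfolding carr by (auto simp: PiE_iff)
  have Fhom: "?F \<in> hom ?S G"
  proof (rule homI)
    fix x assume "x \<in> carrier ?S"
    then show "?F x \<in> carrier G" using Hcl by (intro G.finprod_closed)
  next
    fix x y assume xy: "x \<in> carrier ?S" "y \<in> carrier ?S"
    have "?F (x \<otimes>\<^bsub>?S\<^esub> y) = finprod G (\<lambda>i. x i \<otimes>\<^bsub>G\<^esub> y i) I"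
      using Hcl[OF xy(1)] Hcl[OF xy(2)] by (intro G.finprod_cong') (auto simp: Pi_iff)
    then show "?F (x \<otimes>\<^bsub>?S\<^esub> y) = ?F x \<otimes>\<^bsub>G\<^esub> ?F y"
      using G.finprod_multf[OF Hcl[OF xy(1)] Hcl[OF xy(2)]] by simp
  qed
  have SG: "group ?S" using grp by simp
  interpret F: group_hom ?S G ?F
    by (simp add: group_hom_def group_hom_axioms_def SG Fhom G.is_group)
  have lift: "\<exists>h\<in>(\<Pi>\<^sub>E i\<in>I. carrier (K i)). (\<forall>i\<in>I. x i = \<phi> i (h i)) \<and> ?F x = ?\<Theta> h" if x: "x \<in> carrier ?S" for x
  proof -
    have "\<forall>i\<in>I. \<exists>z. z \<in> carrier (K i) \<and> x i = \<phi> i z"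
      using x unfolding carr by (auto simp: PiE_iff)
    then obtain z where z: "\<And>i. i \<in> I \<Longrightarrow> z i \<in> carrier (K i) \<and> x i = \<phi> i (z i)" by metis
    have "?F x = ?\<Theta> (restrict z I)"
      using z cl by (intro G.finprod_cong') auto
    then show ?thesis using z by (intro bexI[of _ "restrict z I"]) auto
  qed
  have "inj_on ?F (carrier ?S)"
    unfolding F.inj_on_one_iff
  proof (intro allI impI)
    fix x assume x: "x \<in> carrier ?S" "?F x = \<one>\<^bsub>G\<^esub>"
    obtain h where h: "h \<in> (\<Pi>\<^sub>E i\<in>I. carrier (K i))" "\<And>i. i \<in> I \<Longrightarrow> x i = \<phi> i (h i)" "?F x = ?\<Theta> h"
      using lift[OF x(1)] by blast
    have "x i = (\<lambda>i\<in>I. \<one>\<^bsub>G\<^esub>) i" for i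
    proof (cases "i \<in> I")
      case True
      then have "h i = \<one>\<^bsub>K i\<^esub>" using inj[OF h(1) _ True] h(3) x(2) by simp
      then show ?thesis using h(2)[OF True] group_hom.hom_one[OF gh[OF True]] True by simp
    next
      case False
      then show ?thesis using x(1) unfolding carr by (auto simp: PiE_iff extensional_def)
    qed
    then show "x = \<one>\<^bsub>?S\<^esub>" by auto
  qed
  moreover have "?F ` carrier ?S = carrier G"
  proof
    show "?F ` carrier ?S \<subseteq> carrier G" using F.hom_closed by blast
    show "carrier G \<subseteq> ?F ` carrier ?S"
    proof
      fix y assume "y \<in> carrier G"
      then obtain h where h: "h \<in> (\<Pi>\<^sub>E i\<in>I. carrier (K i))" "?\<Theta> h = y" using surj by blast
      let ?x = "\<lambda>i\<in>I. \<phi> i (h i)"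
      have "?F ?x = ?\<Theta> h" using fcl[OF h(1)] by (intro G.finprod_cong') auto
      moreover have "?x \<in> carrier ?S" unfolding carr using h(1) by (auto simp: PiE_iff)
      ultimately show "y \<in> ?F ` carrier ?S" using h(2) by (intro image_eqI[of y ?F ?x]) simp_all
    qed
  qed
  ultimately have "?F \<in> iso ?S G" using Fhom by (simp add: iso_iff)
  then show "internal_direct_sum G I ?H"
    using sub by (simp add: internal_direct_sum_def)
qed

text \<open>A product over a disjoint union splits, and each part is renumbered by an initial
  segment of the naturals, the form in which powers of a group are stated.\<close>

lemma product_group_Plus_iso:
  assumes P: "finite P" and Q: "finite Q"
  shows "product_group (P <+> Q) (case_sum (\<lambda>_. X) (\<lambda>_. Y)) \<cong>
    product_group {..<card P} (\<lambda>_. X) \<times>\<times> product_group {..<card Q} (\<lambda>_. Y)"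
proof -
  obtain p where p: "bij_betw p {..<card P} P"
    using ex_bij_betw_nat_finite[OF P] by (auto simp: atLeast0LessThan)
  obtain q where q: "bij_betw q {..<card Q} Q"
    using ex_bij_betw_nat_finite[OF Q] by (auto simp: atLeast0LessThan)
  let ?K = "case_sum (\<lambda>_. X) (\<lambda>_. Y)"
  let ?p' = "the_inv_into {..<card P} p" and ?q' = "the_inv_into {..<card Q} q"
  let ?f = "\<lambda>h. (\<lambda>j\<in>{..<card P}. h (Inl (p j)), \<lambda>j\<in>{..<card Q}. h (Inr (q j)))"
  let ?g = "\<lambda>(x, y). \<lambda>i\<in>P <+> Q. case_sum (\<lambda>u. x (?p' u)) (\<lambda>u. y (?q' u)) i"
  have pP: "p j \<in> P" if "j < card P" for j using p that by (auto simp: bij_betw_def)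
  have qQ: "q j \<in> Q" if "j < card Q" for j using q that by (auto simp: bij_betw_def)
  have p': "?p' u < card P" "p (?p' u) = u" if "u \<in> P" for u
    using p that the_inv_into_into[of p "{..<card P}" u] f_the_inv_into_f[of p "{..<card P}" u]
    by (auto simp: bij_betw_def)
  have q': "?q' u < card Q" "q (?q' u) = u" if "u \<in> Q" for u
    using q that the_inv_into_into[of q "{..<card Q}" u] f_the_inv_into_f[of q "{..<card Q}" u]
    by (auto simp: bij_betw_def)
  have pj: "?p' (p j) = j" if "j < card P" for j
    using p that by (auto simp: bij_betw_def intro: the_inv_into_f_f)
  have qj: "?q' (q j) = j" if "j < card Q" for j
    using q that by (auto simp: bij_betw_def intro: the_inv_into_f_f)
  let ?L = "product_group (P <+> Q) ?K"
  let ?R = "product_group {..<card P} (\<lambda>_. X) \<times>\<times> product_group {..<card Q} (\<lambda>_. Y)"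
  have fc: "?f h \<in> carrier ?R" if "h \<in> carrier ?L" for h
  proof -
    have "h (Inl (p j)) \<in> carrier X" if "j < card P" for j
      using \<open>h \<in> carrier ?L\<close> pP[OF that] by (force simp: PiE_iff)
    moreover have "h (Inr (q j)) \<in> carrier Y" if "j < card Q" for j
      using \<open>h \<in> carrier ?L\<close> qQ[OF that] by (force simp: PiE_iff)
    ultimately show ?thesis by (simp add: DirProd_def)
  qed
  have gc: "?g z \<in> carrier ?L" if "z \<in> carrier ?R" for z
    using that p'(1) q'(1) by (cases z) (auto simp: DirProd_def PiE_iff)
  have "?f \<in> hom ?L ?R"
  proof (rule homI)
    fix h h' assume "h \<in> carrier ?L" "h' \<in> carrier ?L"
    show "?f (h \<otimes>\<^bsub>?L\<^esub> h') = ?f h \<otimes>\<^bsub>?R\<^esub> ?f h'"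
      using pP qQ by (auto simp: DirProd_def fun_eq_iff)
  qed (rule fc)
  moreover have "bij_betw ?f (carrier ?L) (carrier ?R)"
  proof (rule bij_betw_byWitness[where f' = ?g])
    show "\<forall>h\<in>carrier ?L. ?g (?f h) = h"
    proof
      fix h assume h: "h \<in> carrier ?L"
      show "?g (?f h) = h"
      proof
        fix i
        show "?g (?f h) i = h i"
        proof (cases "i \<in> P <+> Q")
          case True
          then show ?thesis using p' q' by auto
        next
          case False
          then show ?thesis using h by (auto simp: PiE_iff extensional_def)
        qed
      qed
    qed
    show "\<forall>z\<in>carrier ?R. ?f (?g z) = z"
    proof
      fix z assume z: "z \<in> carrier ?R"
      obtain x y where xy: "z = (x, y)" by (cases z)
      have "x \<in> extensional {..<card P}" "y \<in> extensional {..<card Q}"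
        using z xy by (auto simp: DirProd_def PiE_iff)
      then show "?f (?g z) = z"
        unfolding xy using pP qQ pj qj by (auto simp: fun_eq_iff extensional_def)
    qed
  qed (use fc gc in blast)+
  ultimately show ?thesis by (intro is_isoI) (simp add: iso_def)
qed

lemma subgroup_tor2:
  assumes "comm_group A"
  shows "subgroup (tor2 A) A"
proof -
  interpret comm_group A by fact
  show ?thesis
  proof (rule subgroupI)
    show "tor2 A \<noteq> {}" using one_closed nat_pow_one by (auto simp: tor2_def intro: exI[of _ "\<one>\<^bsub>A\<^esub>"])
  qed (auto simp: tor2_def nat_pow_inv nat_pow_distrib)
qed

lemma tor2_even_pow:
  assumes "comm_group A" "x \<in> tor2 A" "even (n :: int)"
  shows "x [^]\<^bsub>A\<^esub> n = \<one>\<^bsub>A\<^esub>"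
proof -
  interpret comm_group A by fact
  have x: "x \<in> carrier A" "x [^]\<^bsub>A\<^esub> (2::int) = \<one>\<^bsub>A\<^esub>"
    using assms(2) by (auto simp: tor2_def) (metis int_pow_int of_nat_numeral)
  obtain m where "n = 2 * m" using assms(3) by blast
  then have "x [^]\<^bsub>A\<^esub> n = (x [^]\<^bsub>A\<^esub> (2::int)) [^]\<^bsub>A\<^esub> m" using int_pow_pow[OF x(1)] by simp
  then show ?thesis using x(2) by simp
qed

context signed_graph
begin

section \<open>The flow group and multiples of integer chains\<close>

lemma chain_eqI:
  assumes "c \<in> one_chains \<Sigma> A" "d \<in> one_chains \<Sigma> A" "\<And>x. x \<in> edges \<Sigma> \<Longrightarrow> c (ref x) = d (ref x)"
  shows "c = d"
proof
  fix a
  show "c a = d a"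
  proof (cases "a \<in> arcs \<Sigma>")
    case True
    then have x: "fst a \<in> edges \<Sigma>" "a = ref (fst a) \<or> a = arc_inv (ref (fst a))" using arcs_iff by blast+
    then show ?thesis
      using assms(3)[OF x(1)] one_chainsD(2)[OF assms(1) ref_arc[OF x(1)]] one_chainsD(2)[OF assms(2) ref_arc[OF x(1)]]
      by metis
  next
    case False
    then show ?thesis
      using PiE_arb[OF one_chainsD(1)[OF assms(1)]] PiE_arb[OF one_chainsD(1)[OF assms(2)]] by simp
  qed
qed

lemma comm_group_flow_group:
  assumes A: "comm_group A"
  shows "comm_group (flow_group \<Sigma> A)"
proof -
  interpret A: comm_group A by fact
  let ?P = "product_group (arcs \<Sigma>) (\<lambda>_. A)"
  have P: "group ?P" by simp
  have r: "x \<in> edges \<Sigma> \<Longrightarrow> ref x \<in> arcs \<Sigma>" for x by (rule ref_arc)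
  have sub: "subgroup (flows \<Sigma> A) ?P"
  proof (rule group.subgroupI[OF P])
    show "flows \<Sigma> A \<subseteq> carrier ?P" by (auto simp: flows_def one_chains_def)
    have "(\<lambda>a\<in>arcs \<Sigma>. \<one>\<^bsub>A\<^esub>) \<in> flows \<Sigma> A"
      unfolding flows_iff[OF A] one_chains_def kirchhoff_def
      by (auto simp: arc_inv_arc r intro!: A.finprod_one_eqI)
    then show "flows \<Sigma> A \<noteq> {}" by blast
  next
    fix c assume c: "c \<in> flows \<Sigma> A"
    then have c': "c \<in> one_chains \<Sigma> A" "\<And>v. v \<in> verts \<Sigma> \<Longrightarrow> kirchhoff A (\<lambda>e. c (ref e)) v = \<one>\<^bsub>A\<^esub>"
      using flows_iff[OF A] by auto
    have inv_eq: "inv\<^bsub>?P\<^esub> c = (\<lambda>a\<in>arcs \<Sigma>. inv\<^bsub>A\<^esub> (c a))"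
      using one_chainsD(1)[OF c'(1)] by simp
    have ch: "inv\<^bsub>?P\<^esub> c \<in> one_chains \<Sigma> A"
      unfolding inv_eq one_chains_def using one_chainsD(2,3)[OF c'(1)] by (auto simp: arc_inv_arc)
    have inv_cl: "(\<lambda>e. inv\<^bsub>A\<^esub> (c (ref e))) \<in> edges \<Sigma> \<rightarrow> carrier A" using one_chainsD(4)[OF c'(1)] by auto
    have "kirchhoff A (\<lambda>e. (inv\<^bsub>?P\<^esub> c) (ref e)) v = \<one>\<^bsub>A\<^esub>" if v: "v \<in> verts \<Sigma>" for v
    proof -
      have "kirchhoff A (\<lambda>e. (inv\<^bsub>?P\<^esub> c) (ref e)) v = kirchhoff A (\<lambda>e. inv\<^bsub>A\<^esub> (c (ref e))) v"
        by (rule kirchhoff_cong[OF A one_chainsD(4)[OF ch] _ inv_cl]) (simp add: inv_eq r)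
      moreover have "kirchhoff A (\<lambda>e. c (ref e)) v \<otimes>\<^bsub>A\<^esub> kirchhoff A (\<lambda>e. inv\<^bsub>A\<^esub> (c (ref e))) v = \<one>\<^bsub>A\<^esub>"
        unfolding kirchhoff_mult[OF A one_chainsD(4)[OF c'(1)] inv_cl, symmetric]
        unfolding kirchhoff_def
        by (rule A.finprod_one_eqI) (use one_chainsD(4)[OF c'(1)] in \<open>auto simp: Pi_iff\<close>)
      moreover have "kirchhoff A (\<lambda>e. inv\<^bsub>A\<^esub> (c (ref e))) v \<in> carrier A"
        unfolding kirchhoff_def using inv_cl by (intro A.finprod_closed) (auto simp: Pi_iff)
      ultimately show ?thesis using c'(2)[OF v] by simp
    qed
    then show "inv\<^bsub>?P\<^esub> c \<in> flows \<Sigma> A" unfolding flows_iff[OF A] using ch by blast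
  next
    fix c d assume cd: "c \<in> flows \<Sigma> A" "d \<in> flows \<Sigma> A"
    then have c: "c \<in> one_chains \<Sigma> A" "\<And>v. v \<in> verts \<Sigma> \<Longrightarrow> kirchhoff A (\<lambda>e. c (ref e)) v = \<one>\<^bsub>A\<^esub>"
      and d: "d \<in> one_chains \<Sigma> A" "\<And>v. v \<in> verts \<Sigma> \<Longrightarrow> kirchhoff A (\<lambda>e. d (ref e)) v = \<one>\<^bsub>A\<^esub>"
      using flows_iff[OF A] by auto
    have ch: "c \<otimes>\<^bsub>?P\<^esub> d \<in> one_chains \<Sigma> A"
      unfolding one_chains_def using one_chainsD(2,3)[OF c(1)] one_chainsD(2,3)[OF d(1)]
      by (auto simp: arc_inv_arc A.inv_mult)
    have mcl: "(\<lambda>e. c (ref e) \<otimes>\<^bsub>A\<^esub> d (ref e)) \<in> edges \<Sigma> \<rightarrow> carrier A"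
      using one_chainsD(4)[OF c(1)] one_chainsD(4)[OF d(1)] by auto
    have "kirchhoff A (\<lambda>e. (c \<otimes>\<^bsub>?P\<^esub> d) (ref e)) v = \<one>\<^bsub>A\<^esub>" if v: "v \<in> verts \<Sigma>" for v
    proof -
      have "kirchhoff A (\<lambda>e. (c \<otimes>\<^bsub>?P\<^esub> d) (ref e)) v = kirchhoff A (\<lambda>e. c (ref e) \<otimes>\<^bsub>A\<^esub> d (ref e)) v"
        by (rule kirchhoff_cong[OF A one_chainsD(4)[OF ch] _ mcl]) (simp add: r)
      then show ?thesis
        using kirchhoff_mult[OF A one_chainsD(4)[OF c(1)] one_chainsD(4)[OF d(1)]] c(2)[OF v] d(2)[OF v] by simp
    qed
    then show "c \<otimes>\<^bsub>?P\<^esub> d \<in> flows \<Sigma> A" unfolding flows_iff[OF A] using ch by blast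
  qed
  have "group (flow_group \<Sigma> A)"
    unfolding flow_group_def by (rule subgroup.subgroup_is_group[OF sub P])
  then show ?thesis
  proof (rule group.group_comm_groupI)
    fix x y assume "x \<in> carrier (flow_group \<Sigma> A)" "y \<in> carrier (flow_group \<Sigma> A)"
    then have "x \<in> one_chains \<Sigma> A" "y \<in> one_chains \<Sigma> A"
      using flows_iff[OF A] by (auto simp: flow_group_def)
    then have "x a \<in> carrier A" "y a \<in> carrier A" if "a \<in> arcs \<Sigma>" for a
      using one_chainsD(3)[OF _ that] by blast+
    then show "x \<otimes>\<^bsub>flow_group \<Sigma> A\<^esub> y = y \<otimes>\<^bsub>flow_group \<Sigma> A\<^esub> x"
      by (auto simp: flow_group_def A.m_comm intro!: restrict_ext)
  qed
qed

lemma flow_group_simps: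
  "carrier (flow_group \<Sigma> A) = flows \<Sigma> A"
  "x \<otimes>\<^bsub>flow_group \<Sigma> A\<^esub> y = (\<lambda>a\<in>arcs \<Sigma>. x a \<otimes>\<^bsub>A\<^esub> y a)"
  "\<one>\<^bsub>flow_group \<Sigma> A\<^esub> = (\<lambda>a\<in>arcs \<Sigma>. \<one>\<^bsub>A\<^esub>)"
  by (simp_all add: flow_group_def)

lemma finprod_flow_group:
  assumes A: "comm_group A" and "finite J" "x \<in> J \<rightarrow> flows \<Sigma> A" "a \<in> arcs \<Sigma>"
  shows "finprod (flow_group \<Sigma> A) x J a = finprod A (\<lambda>i. x i a) J"
proof -
  interpret A: comm_group A by fact
  interpret G: comm_group "flow_group \<Sigma> A" by (rule comm_group_flow_group[OF A])
  have cl: "c a \<in> carrier A" if "c \<in> flows \<Sigma> A" for c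
    using that one_chainsD(3)[OF _ assms(4)] flows_iff[OF A] by blast
  show ?thesis
    using assms(2,3)
  proof (induction J rule: finite_induct)
    case empty
    then show ?case using assms(4) by (simp add: flow_group_simps)
  next
    case (insert i J)
    then have "finprod (flow_group \<Sigma> A) x (insert i J) = x i \<otimes>\<^bsub>flow_group \<Sigma> A\<^esub> finprod (flow_group \<Sigma> A) x J"
      by (intro G.finprod_insert) (auto simp: flow_group_simps)
    moreover have "finprod A (\<lambda>i. x i a) (insert i J) = x i a \<otimes>\<^bsub>A\<^esub> finprod A (\<lambda>i. x i a) J"
      using insert by (intro A.finprod_insert) (auto simp: cl Pi_iff)
    ultimately show ?case using insert assms(4) by (simp add: flow_group_simps)
  qed
qed

text \<open>Required at reference arcs only; every other arc is the inverse of one, and inverting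
  twice gives the general rule.\<close>

definition antisym_chain :: "('e arc \<Rightarrow> int) \<Rightarrow> bool" where
  "antisym_chain k \<longleftrightarrow> (\<forall>x\<in>edges \<Sigma>. k (arc_inv (ref x)) = - k (ref x))"

lemma scale_chain_one_chain:
  assumes A: "comm_group A" and k: "antisym_chain k" and h: "h \<in> carrier A"
  shows "scale_chain \<Sigma> A h k \<in> one_chains \<Sigma> A"
proof -
  interpret A: comm_group A by fact
  have "k (arc_inv a) = - k a" if "a \<in> arcs \<Sigma>" for a
  proof -
    have x: "fst a \<in> edges \<Sigma>" "a = ref (fst a) \<or> a = arc_inv (ref (fst a))" using that arcs_iff by blast+
    have "k (arc_inv (ref (fst a))) = - k (ref (fst a))" using k x(1) by (simp add: antisym_chain_def)
    then show ?thesis using x(2) by (metis arc_inv_arc_inv minus_minus)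
  qed
  then show ?thesis
    using h by (auto simp: scale_chain_def one_chains_def arc_inv_arc A.int_pow_neg)
qed

text \<open>It is enough that \<open>h\<close> annihilates the integer boundary, which need not
  vanish itself; torsion multiples of circle chains need this freedom.\<close>

lemma scale_chain_flow:
  assumes A: "comm_group A" and k: "antisym_chain k" and h: "h \<in> carrier A"
    and v: "\<And>v. v \<in> verts \<Sigma> \<Longrightarrow> h [^]\<^bsub>A\<^esub> bd (edges \<Sigma>) (\<lambda>x. k (ref x)) v = \<one>\<^bsub>A\<^esub>"
  shows "scale_chain \<Sigma> A h k \<in> flows \<Sigma> A"
proof -
  interpret A: comm_group A by fact
  have "kirchhoff A (\<lambda>e. scale_chain \<Sigma> A h k (ref e)) w = kirchhoff A (\<lambda>e. h [^]\<^bsub>A\<^esub> k (ref e)) w" for w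
    by (rule kirchhoff_cong[OF A]) (use h in \<open>auto simp: scale_chain_def ref_arc\<close>)
  then show ?thesis
    unfolding flows_iff[OF A] using scale_chain_one_chain[OF A k h] v kirchhoff_int_pow[OF A h] by simp
qed

end

text \<open>The chains \<open>k\<close> are described only through what the coordinates need: units
  on their circle, or \<open>fund e\<close> up to a sign. All choices of orientations and directions
  are thereby covered at the same time.\<close>

locale flow_coordinates = based \<Sigma> D B + comm_group A
  for \<Sigma> :: "('v, 'e) sgraph" and D :: "('v, 'e) sgraph \<Rightarrow> 'e set" and B :: "'e set"
    and A :: "('a, 'm) monoid_scheme" (structure) +
  fixes k :: "'e set + 'e \<Rightarrow> 'e arc \<Rightarrow> int"
  assumes antisym: "\<And>i. i \<in> N <+> (edges \<Sigma> - B) \<Longrightarrow> antisym_chain (k i)"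
    and circle_on: "\<And>C x. C \<in> N \<Longrightarrow> x \<in> C \<Longrightarrow> \<bar>k (Inl C) (ref x)\<bar> = 1"
    and circle_off: "\<And>C x. C \<in> N \<Longrightarrow> x \<in> edges \<Sigma> - C \<Longrightarrow> k (Inl C) (ref x) = 0"
    and circuit: "\<And>e. e \<in> edges \<Sigma> - B \<Longrightarrow> \<exists>s\<in>{1, -1}. \<forall>x\<in>edges \<Sigma>. k (Inr e) (ref x) = s * fund e x"
begin

definition coeff :: "'e set + 'e \<Rightarrow> ('a, 'm) monoid_scheme" where
  "coeff = case_sum (\<lambda>_. A\<lparr>carrier := tor2 A\<rparr>) (\<lambda>_. A)"

abbreviation idx :: "('e set + 'e) set" where "idx \<equiv> N <+> (edges \<Sigma> - B)"

abbreviation total :: "('e set + 'e \<Rightarrow> 'a) \<Rightarrow> 'e arc \<Rightarrow> 'a" where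
  "total h \<equiv> finprod (flow_group \<Sigma> A) (\<lambda>i. scale_chain \<Sigma> A (h i) (k i)) idx"

section \<open>Triangular coordinates of flows\<close>

lemma A: "comm_group A" ..

lemma idx_iff [simp]: "Inl C \<in> idx \<longleftrightarrow> C \<in> N" "Inr e \<in> idx \<longleftrightarrow> e \<in> edges \<Sigma> - B"
  by auto

lemma finite_N: "finite N"
proof (rule finite_subset)
  show "N \<subseteq> Pow (edges \<Sigma>)" by (auto simp: N_def negative_circles_iff)
qed (simp add: finite_edges)

lemma finite_idx: "finite idx"
  using finite_N finite_edges by simp

lemma coeff_carrier: "x \<in> carrier (coeff i) \<Longrightarrow> x \<in> carrier A"
  by (cases i) (auto simp: coeff_def tor2_def)

lemma coeff_group: "group (coeff i)"
  using subgroup.subgroup_is_group[OF subgroup_tor2[OF A] is_group] is_group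
  by (cases i) (auto simp: coeff_def)

lemma coeff_ops: "x \<otimes>\<^bsub>coeff i\<^esub> y = x \<otimes> y" "\<one>\<^bsub>coeff i\<^esub> = \<one>"
  by (cases i; simp add: coeff_def)+

text \<open>At each vertex of a circle two units are added, so every orientation has even boundary,
  though it need not be zero. This is why coefficients on circles are taken from the
  2-torsion.\<close>

lemma circle_bd_even:
  assumes "C \<in> N"
  shows "even (bd (edges \<Sigma>) (\<lambda>x. k (Inl C) (ref x)) v)"
proof -
  have C: "C \<subseteq> edges \<Sigma>" "is_circle (subgr \<Sigma> C)" using assms by (auto simp: N_def negative_circles_iff)
  have "bd (edges \<Sigma>) (\<lambda>x. k (Inl C) (ref x)) v = bd C (\<lambda>x. k (Inl C) (ref x)) v"
    by (rule bd_superset) (use C circle_off[OF assms] in auto)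
  moreover have "even (bd C f v)" if f: "\<And>x. x \<in> C \<Longrightarrow> \<bar>f x\<bar> = 1" for f
  proof (cases "v \<in> vset C")
    case True
    obtain a i b j where "bd C f v = tau a i * f a + tau b j * f b" "a \<in> C" "b \<in> C"
      "tau a i = 1 \<or> tau a i = -1" "tau b j = 1 \<or> tau b j = -1"
      using deg2_bd[OF C(1) circleD(3)[OF C(2) True]] by metis
    moreover have "f a = 1 \<or> f a = -1" "f b = 1 \<or> f b = -1"
      using f[OF \<open>a \<in> C\<close>] f[OF \<open>b \<in> C\<close>] by linarith+
    ultimately show ?thesis by auto
  qed (simp add: bd_not_vset)
  ultimately show ?thesis using circle_on[OF assms] by simp
qed

lemma scale_flow:
  assumes i: "i \<in> idx" and h: "h \<in> carrier (coeff i)"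
  shows "scale_chain \<Sigma> A h (k i) \<in> flows \<Sigma> A"
proof (rule scale_chain_flow[OF A antisym[OF i] coeff_carrier[OF h]])
  fix v
  show "h [^] bd (edges \<Sigma>) (\<lambda>x. k i (ref x)) v = \<one>"
  proof (cases i)
    case (Inl C)
    then have "h \<in> tor2 A" "C \<in> N" using h i by (auto simp: coeff_def)
    then show ?thesis using tor2_even_pow[OF A] circle_bd_even Inl by blast
  next
    case (Inr e)
    then have 2: "i = Inr e" "e \<in> edges \<Sigma> - B" using i by auto
    obtain s where s: "\<And>x. x \<in> edges \<Sigma> \<Longrightarrow> k (Inr e) (ref x) = s * fund e x" using circuit[OF 2(2)] by blast
    have "bd (edges \<Sigma>) (\<lambda>x. k i (ref x)) v = bd (edges \<Sigma>) (\<lambda>x. s * fund e x) v"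
      by (rule bd_cong) (simp add: 2 s)
    also have "\<dots> = 0" by (simp add: bd_scale fund(3)[OF 2(2)])
    finally show ?thesis by simp
  qed
qed

lemma scale_hom:
  assumes i: "i \<in> idx"
  shows "(\<lambda>h. scale_chain \<Sigma> A h (k i)) \<in> hom (coeff i) (flow_group \<Sigma> A)"
proof (rule homI)
  show "scale_chain \<Sigma> A x (k i) \<in> carrier (flow_group \<Sigma> A)" if "x \<in> carrier (coeff i)" for x
    using scale_flow[OF i that] by (simp add: flow_group_simps)
  fix x y assume "x \<in> carrier (coeff i)" "y \<in> carrier (coeff i)"
  then have "x \<in> carrier A" "y \<in> carrier A" by (auto intro: coeff_carrier)
  then show "scale_chain \<Sigma> A (x \<otimes>\<^bsub>coeff i\<^esub> y) (k i) =
      scale_chain \<Sigma> A x (k i) \<otimes>\<^bsub>flow_group \<Sigma> A\<^esub> scale_chain \<Sigma> A y (k i)"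
    by (auto simp: coeff_ops flow_group_simps scale_chain_def int_pow_distrib intro!: restrict_ext)
qed

lemma total_ref:
  assumes h: "h \<in> (\<Pi>\<^sub>E i\<in>idx. carrier (coeff i))" and x: "x \<in> edges \<Sigma>"
  shows "total h (ref x) = finprod A (\<lambda>i. h i [^] k i (ref x)) idx"
proof -
  have fl: "(\<lambda>i. scale_chain \<Sigma> A (h i) (k i)) \<in> idx \<rightarrow> flows \<Sigma> A"
    using h scale_flow by (auto simp: PiE_iff)
  have hc: "h i \<in> carrier A" if "i \<in> idx" for i using h that coeff_carrier by (auto simp: PiE_iff)
  have "total h (ref x) = finprod A (\<lambda>i. scale_chain \<Sigma> A (h i) (k i) (ref x)) idx"
    by (rule finprod_flow_group[OF A finite_idx fl ref_arc[OF x]])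
  also have "\<dots> = finprod A (\<lambda>i. h i [^] k i (ref x)) idx"
    using hc by (intro finprod_cong') (auto simp: scale_chain_def ref_arc[OF x])
  finally show ?thesis .
qed

lemma total_ref_single:
  assumes h: "h \<in> (\<Pi>\<^sub>E i\<in>idx. carrier (coeff i))" and x: "x \<in> edges \<Sigma>" and j: "j \<in> idx"
    and others: "\<And>i. i \<in> idx \<Longrightarrow> i \<noteq> j \<Longrightarrow> h i [^] k i (ref x) = \<one>"
  shows "total h (ref x) = h j [^] k j (ref x)"
proof -
  have hc: "h i \<in> carrier A" if "i \<in> idx" for i using h that coeff_carrier by (auto simp: PiE_iff)
  have "total h (ref x) = finprod A (\<lambda>i. if j = i then h i [^] k i (ref x) else \<one>) idx"
    unfolding total_ref[OF h x] using hc others by (intro finprod_cong') (auto simp: hc[OF j])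
  also have "\<dots> = h j [^] k j (ref x)"
    using hc by (intro finprod_singleton[OF j finite_idx]) auto
  finally show ?thesis .
qed

lemma circuit_value:
  assumes "e \<in> edges \<Sigma> - B" "x \<in> edges \<Sigma> - B"
  shows "x \<noteq> e \<Longrightarrow> k (Inr e) (ref x) = 0" "k (Inr e) (ref e) = 1 \<or> k (Inr e) (ref e) = -1"
  using circuit[OF assms(1)] fund(1)[OF assms(1), of x] fund(2)[OF assms(1)] assms by auto

lemma N_subset: "C \<in> N \<Longrightarrow> C \<subseteq> B" "C \<in> N \<Longrightarrow> C \<subseteq> edges \<Sigma>"
  by (auto simp: N_def negative_circles_iff)

text \<open>An edge outside the base lies on no circle in the base and on no other fundamental
  circuit, so it isolates one coordinate.\<close>

lemma total_off_base:
  assumes h: "h \<in> (\<Pi>\<^sub>E i\<in>idx. carrier (coeff i))" and e: "e \<in> edges \<Sigma> - B"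
  shows "total h (ref e) = h (Inr e) [^] k (Inr e) (ref e)"
proof (rule total_ref_single[OF h])
  fix i assume i: "i \<in> idx" "i \<noteq> Inr e"
  have "k i (ref e) = 0"
  proof (cases i)
    case (Inl C)
    then have "C \<in> N" using i(1) by auto
    then show ?thesis using circle_off[of C e] N_subset(1)[of C] e Inl by blast
  next
    case (Inr e')
    then have "e' \<in> edges \<Sigma> - B" using i(1) by auto
    then show ?thesis using circuit_value(1)[OF _ e, of e'] i(2) Inr by blast
  qed
  then show "h i [^] k i (ref e) = \<one>" by simp
qed (use e in auto)

text \<open>The key edge lies on no other circle of the base but possibly on fundamental circuits;
  hence the assumption that the circuit coordinates are trivial.\<close>

lemma total_key:
  assumes h: "h \<in> (\<Pi>\<^sub>E i\<in>idx. carrier (coeff i))" and C: "C \<in> N"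
    and triv: "\<And>e. e \<in> edges \<Sigma> - B \<Longrightarrow> h (Inr e) = \<one>"
  shows "total h (ref (key C)) = h (Inl C) [^] k (Inl C) (ref (key C))"
proof (rule total_ref_single[OF h])
  show kE: "key C \<in> edges \<Sigma>" using key_mem[OF C] N_subset(2)[OF C] by blast
  fix i assume i: "i \<in> idx" "i \<noteq> Inl C"
  show "h i [^] k i (ref (key C)) = \<one>"
  proof (cases i)
    case (Inl C')
    then have C': "C' \<in> N" using i(1) by auto
    then have "key C \<notin> C'" using N_disjoint[OF C C'] key_mem[OF C] i(2) Inl by blast
    then have "k i (ref (key C)) = 0" using circle_off[OF C', of "key C"] Inl kE by blast
    then show ?thesis by simp
  next
    case (Inr e)
    then show ?thesis using triv i(1) by auto
  qed
qed (use C in auto)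

text \<open>The exponents plus or minus 1 are their own inverses; this absorbs the unknown signs in
  the chains \<open>k\<close>.\<close>

lemma pow_unit:
  assumes "x \<in> carrier A" "(n::int) = 1 \<or> n = -1"
  shows "x [^] n = \<one> \<Longrightarrow> x = \<one>" "(x [^] n) [^] n = x" "x [^] n \<in> carrier A"
  using assms by (auto simp: int_pow_neg)

lemma key_value: "C \<in> N \<Longrightarrow> k (Inl C) (ref (key C)) = 1 \<or> k (Inl C) (ref (key C)) = -1"
  using circle_on[of C "key C"] key_mem[of C] by linarith

text \<open>The system is triangular: edges outside the base kill the circuit coordinates, after
  which the key edges kill those of the circles.\<close>

lemma total_injective:
  assumes h: "h \<in> (\<Pi>\<^sub>E i\<in>idx. carrier (coeff i))" and one: "total h = \<one>\<^bsub>flow_group \<Sigma> A\<^esub>" and i: "i \<in> idx"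
  shows "h i = \<one>"
proof -
  have hc: "h i \<in> carrier A" if "i \<in> idx" for i using h that coeff_carrier by (auto simp: PiE_iff)
  have t1: "total h (ref x) = \<one>" if "x \<in> edges \<Sigma>" for x
    unfolding one using ref_arc[OF that] by (simp add: flow_group_simps)
  have E: "h (Inr e) = \<one>" if "e \<in> edges \<Sigma> - B" for e
    by (rule pow_unit(1)[OF hc circuit_value(2)[OF that that]])
      (use that t1 total_off_base[OF h that] in auto)
  have "h (Inl C) = \<one>" if "C \<in> N" for C
    by (rule pow_unit(1)[OF hc key_value[OF that]])
      (use that t1 total_key[OF h that E] key_mem[OF that] N_subset(2)[OF that] in auto)
  then show ?thesis using i E by auto
qed

lemma total_flow:
  assumes "h \<in> (\<Pi>\<^sub>E i\<in>idx. carrier (coeff i))"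
  shows "total h \<in> flows \<Sigma> A"
proof -
  interpret G: comm_group "flow_group \<Sigma> A" by (rule comm_group_flow_group[OF A])
  have "total h \<in> carrier (flow_group \<Sigma> A)"
    using assms scale_flow by (intro G.finprod_closed) (auto simp: flow_group_simps PiE_iff)
  then show ?thesis by (simp add: flow_group_simps)
qed

text \<open>The values of \<open>y\<close> outside the base fix the circuit coordinates; what then
  remains lives on the base and has 2-torsion values at the key edges, which fix the circle
  coordinates. A remainder that vanishes in both places is trivial.\<close>

lemma total_surjective:
  assumes y: "y \<in> flows \<Sigma> A"
  shows "\<exists>h\<in>(\<Pi>\<^sub>E i\<in>idx. carrier (coeff i)). total h = y"
proof -
  interpret G: comm_group "flow_group \<Sigma> A" by (rule comm_group_flow_group[OF A])
  have yc: "y (ref x) \<in> carrier A" if "x \<in> edges \<Sigma>" for x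
    using y one_chainsD(3)[OF _ ref_arc[OF that]] flows_iff[OF A] by blast
  have diff: "\<exists>d\<in>flows \<Sigma> A. \<forall>x\<in>edges \<Sigma>. d (ref x) \<otimes> z (ref x) = y (ref x)" if z: "z \<in> flows \<Sigma> A" for z
  proof -
    have yz: "y \<in> carrier (flow_group \<Sigma> A)" "z \<in> carrier (flow_group \<Sigma> A)" using y z by (simp_all add: flow_group_simps)
    define d where "d = y \<otimes>\<^bsub>flow_group \<Sigma> A\<^esub> inv\<^bsub>flow_group \<Sigma> A\<^esub> z"
    have dc: "d \<in> carrier (flow_group \<Sigma> A)" using yz by (simp add: d_def)
    have "d \<otimes>\<^bsub>flow_group \<Sigma> A\<^esub> z = y" using yz by (simp add: d_def G.m_assoc)
    moreover have "(d \<otimes>\<^bsub>flow_group \<Sigma> A\<^esub> z) (ref x) = d (ref x) \<otimes> z (ref x)" if "x \<in> edges \<Sigma>" for x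
      using ref_arc[OF that] by (simp add: flow_group_simps(2))
    ultimately have "d (ref x) \<otimes> z (ref x) = y (ref x)" if "x \<in> edges \<Sigma>" for x
      using that by simp
    then show ?thesis using dc by (auto simp: flow_group_simps(1))
  qed
  have fl: "(\<lambda>e. d (ref e)) \<in> edges \<Sigma> \<rightarrow> carrier A" "\<And>v. v \<in> verts \<Sigma> \<Longrightarrow> kirchhoff A (\<lambda>e. d (ref e)) v = \<one>"
    if "d \<in> flows \<Sigma> A" for d
    using that one_chainsD(4) flows_iff[OF A] by blast+
  \<comment> \<open>The exponent undoes the sign with which \<open>e\<close> occurs in its own
    circuit.\<close>
  define h1 where "h1 = (\<lambda>i\<in>idx. case i of Inl C \<Rightarrow> \<one> | Inr e \<Rightarrow> y (ref e) [^] k (Inr e) (ref e))"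
  have one_tor: "\<one> \<in> tor2 A" using subgroup.one_closed[OF subgroup_tor2[OF A]] .
  have h1: "h1 \<in> (\<Pi>\<^sub>E i\<in>idx. carrier (coeff i))"
    using one_tor yc by (auto simp: h1_def coeff_def)
  have off1: "total h1 (ref e) = y (ref e)" if "e \<in> edges \<Sigma> - B" for e
    unfolding total_off_base[OF h1 that]
    using that pow_unit(2)[OF yc circuit_value(2)[OF that that]] by (simp add: h1_def)
  obtain d where d: "d \<in> flows \<Sigma> A" "\<And>x. x \<in> edges \<Sigma> \<Longrightarrow> d (ref x) \<otimes> total h1 (ref x) = y (ref x)"
    using diff[OF total_flow[OF h1]] by blast
  have d_off: "d (ref x) = \<one>" if "x \<in> edges \<Sigma> - B" for x
  proof -
    have "d (ref x) \<otimes> y (ref x) = y (ref x)" using d(2)[of x] off1[OF that] that by simp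
    moreover have "d (ref x) \<in> carrier A" "y (ref x) \<in> carrier A" using fl(1)[OF d(1)] yc that by auto
    ultimately show ?thesis by simp
  qed
  have d_key: "d (ref (key C)) \<in> tor2 A" if "C \<in> N" for C
    by (rule flow_on_base_tor2[OF A fl[OF d(1)] d_off that])
  define h where "h = (\<lambda>i\<in>idx. case i of Inl C \<Rightarrow> d (ref (key C)) [^] k (Inl C) (ref (key C))
    | Inr e \<Rightarrow> h1 (Inr e))"
  \<comment> \<open>The circle part of \<open>h\<close> alone, with trivial circuit coordinates as
    \<open>total_key\<close> demands; \<open>h\<close> is the product of \<open>h2\<close> and
    \<open>h1\<close>.\<close>
  define h2 where "h2 = (\<lambda>i\<in>idx. case i of Inl C \<Rightarrow> h (Inl C) | Inr e \<Rightarrow> \<one>)"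
  have tor_pow: "x [^] (n::int) \<in> tor2 A" if "x \<in> tor2 A" "n = 1 \<or> n = -1" for x n
  proof -
    have "x \<in> carrier A" using that(1) by (simp add: tor2_def)
    then show ?thesis
      using that subgroup.m_inv_closed[OF subgroup_tor2[OF A] that(1)] by (auto simp: int_pow_neg)
  qed
  have hN: "h (Inl C) \<in> tor2 A" if "C \<in> N" for C
    using tor_pow[OF d_key[OF that] key_value[OF that]] that by (simp add: h_def)
  have h2: "h2 \<in> (\<Pi>\<^sub>E i\<in>idx. carrier (coeff i))"
    using hN by (auto simp: h2_def coeff_def)
  have h: "h \<in> (\<Pi>\<^sub>E i\<in>idx. carrier (coeff i))"
    using hN yc by (auto simp: h_def h1_def coeff_def)
  have split: "total h (ref x) = total h2 (ref x) \<otimes> total h1 (ref x)" if x: "x \<in> edges \<Sigma>" for x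
  proof -
    have c: "h1 i \<in> carrier A" "h2 i \<in> carrier A" if "i \<in> idx" for i
      using coeff_carrier[OF PiE_mem[OF h1 that]] coeff_carrier[OF PiE_mem[OF h2 that]] by simp_all
    have "h i = h2 i \<otimes> h1 i" if i: "i \<in> idx" for i
    proof (cases i)
      case (Inl C)
      then have "h2 i = h i" "h1 i = \<one>" using i by (simp_all add: h1_def h2_def)
      then show ?thesis using c(2)[OF i] by simp
    next
      case (Inr e)
      then have "h1 i = h i" "h2 i = \<one>" using i by (simp_all add: h_def h2_def)
      then show ?thesis using c(1)[OF i] by simp
    qed
    then have "finprod A (\<lambda>i. h i [^] k i (ref x)) idx = finprod A (\<lambda>i. h2 i [^] k i (ref x) \<otimes> h1 i [^] k i (ref x)) idx"
      using c by (intro finprod_cong') (auto simp: int_pow_distrib)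
    also have "\<dots> = finprod A (\<lambda>i. h2 i [^] k i (ref x)) idx \<otimes> finprod A (\<lambda>i. h1 i [^] k i (ref x)) idx"
      using c by (intro finprod_multf) auto
    finally show ?thesis unfolding total_ref[OF h x] total_ref[OF h1 x] total_ref[OF h2 x] .
  qed
  obtain d' where d': "d' \<in> flows \<Sigma> A" "\<And>x. x \<in> edges \<Sigma> \<Longrightarrow> d' (ref x) \<otimes> total h (ref x) = y (ref x)"
    using diff[OF total_flow[OF h]] by blast
  have tc: "total g (ref x) \<in> carrier A" if "x \<in> edges \<Sigma>" "g \<in> (\<Pi>\<^sub>E i\<in>idx. carrier (coeff i))" for x g
    using fl(1)[OF total_flow[OF that(2)]] that(1) by auto
  have d'c: "d' (ref x) \<in> carrier A" "d (ref x) \<in> carrier A" if "x \<in> edges \<Sigma>" for x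
    using fl(1)[OF d'(1)] fl(1)[OF d(1)] that by auto
  have dd: "d' (ref x) \<otimes> total h2 (ref x) = d (ref x)" if x: "x \<in> edges \<Sigma>" for x
  proof -
    have "(d' (ref x) \<otimes> total h2 (ref x)) \<otimes> total h1 (ref x) = d (ref x) \<otimes> total h1 (ref x)"
      using d'(2)[OF x] d(2)[OF x] split[OF x] d'c[OF x] tc[OF x h1] tc[OF x h2] by (simp add: m_assoc)
    then show ?thesis using d'c[OF x] tc[OF x h1] tc[OF x h2] by simp
  qed
  have triv2: "h2 (Inr e) = \<one>" if "e \<in> edges \<Sigma> - B" for e using that by (simp add: h2_def)
  have "d' (ref x) = \<one>" if x: "x \<in> edges \<Sigma>" for x
  proof (rule flow_on_base_trivial[OF A fl[OF d'(1)] _ _ x])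
    fix x assume x: "x \<in> edges \<Sigma> - B"
    have "total h2 (ref x) = \<one>" unfolding total_off_base[OF h2 x] using triv2[OF x] by simp
    then show "d' (ref x) = \<one>" using dd[of x] d_off[OF x] d'c(1)[of x] x by simp
  next
    fix C assume C: "C \<in> N"
    have kE: "key C \<in> edges \<Sigma>" using key_mem[OF C] N_subset(2)[OF C] by blast
    have "total h2 (ref (key C)) = h2 (Inl C) [^] k (Inl C) (ref (key C))"
      by (rule total_key[OF h2 C triv2])
    also have "\<dots> = d (ref (key C))"
      using pow_unit(2)[OF d'c(2)[OF kE] key_value[OF C]] C by (simp add: h2_def h_def)
    finally have "total h2 (ref (key C)) = d (ref (key C))" .
    then have "d' (ref (key C)) \<otimes> d (ref (key C)) = d (ref (key C))" using dd[OF kE] by simp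
    then show "d' (ref (key C)) = \<one>" using d'c[OF kE] by simp
  qed
  then have "total h (ref x) = y (ref x)" if "x \<in> edges \<Sigma>" for x
    using d'(2)[OF that] tc[OF that h] that by simp
  then have "total h = y"
    using total_flow[OF h] y flows_iff[OF A] by (intro chain_eqI[of _ A]) auto
  then show ?thesis using h by blast
qed

theorem direct_sum:
  "internal_direct_sum (flow_group \<Sigma> A) idx (\<lambda>i. (\<lambda>h. scale_chain \<Sigma> A h (k i)) ` carrier (coeff i))"
  "product_group idx coeff \<cong> flow_group \<Sigma> A"
proof -
  note * = coordinate_iso[OF comm_group_flow_group[OF A] finite_idx coeff_group scale_hom]
  show "internal_direct_sum (flow_group \<Sigma> A) idx (\<lambda>i. (\<lambda>h. scale_chain \<Sigma> A h (k i)) ` carrier (coeff i))"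
    by (rule *(2)) (auto simp: coeff_ops flow_group_simps intro: total_injective total_surjective)
  have "(\<lambda>h. total h) \<in> iso (product_group idx coeff) (flow_group \<Sigma> A)"
    by (rule *(1)) (auto simp: coeff_ops flow_group_simps intro: total_injective total_surjective)
  then show "product_group idx coeff \<cong> flow_group \<Sigma> A" by (rule is_isoI)
qed

end

context signed_graph
begin

lemma orientation_chain_values:
  assumes \<omega>: "orientation \<Sigma> C \<omega>" and C: "C \<subseteq> edges \<Sigma>"
  shows "antisym_chain (orientation_chain \<Sigma> \<omega>)"
    "\<And>x. x \<in> C \<Longrightarrow> \<bar>orientation_chain \<Sigma> \<omega> (ref x)\<bar> = 1"
    "\<And>x. x \<in> edges \<Sigma> - C \<Longrightarrow> orientation_chain \<Sigma> \<omega> (ref x) = 0"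
proof -
  obtain \<phi> where \<phi>: "\<omega> = \<phi> ` C" "\<And>e. e \<in> C \<Longrightarrow> fst (\<phi> e) = e"
    "\<And>e. e \<in> C \<Longrightarrow> \<phi> e = ref e \<or> \<phi> e = arc_inv (ref e)"
    using orientation_image[OF \<omega> C] by metis
  have mem: "a \<in> \<omega> \<longleftrightarrow> fst a \<in> C \<and> a = \<phi> (fst a)" for a
    unfolding \<phi>(1) using \<phi>(2) by auto
  have on: "(ref x \<in> \<omega> \<and> arc_inv (ref x) \<notin> \<omega>) \<or> (ref x \<notin> \<omega> \<and> arc_inv (ref x) \<in> \<omega>)" if "x \<in> C" for x
  proof -
    have "arc_inv (ref x) \<noteq> ref x" using that C by (intro arc_inv_neq ref_arc) blast
    then show ?thesis using \<phi>(3)[OF that] that by (elim disjE) (simp_all add: mem)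
  qed
  have off: "ref x \<notin> \<omega>" "arc_inv (ref x) \<notin> \<omega>" if "x \<notin> C" for x
    using that by (simp_all add: mem)
  have val: "orientation_chain \<Sigma> \<omega> (ref x) = (if ref x \<in> \<omega> then 1 else if arc_inv (ref x) \<in> \<omega> then -1 else 0)"
    "orientation_chain \<Sigma> \<omega> (arc_inv (ref x)) = (if arc_inv (ref x) \<in> \<omega> then 1 else if ref x \<in> \<omega> then -1 else 0)"
    if "x \<in> edges \<Sigma>" for x
    using ref_arc[OF that] arc_inv_arc[OF ref_arc[OF that]] by (simp_all add: orientation_chain_def)
  show "antisym_chain (orientation_chain \<Sigma> \<omega>)"
    unfolding antisym_chain_def
  proof
    fix x assume x: "x \<in> edges \<Sigma>"
    show "orientation_chain \<Sigma> \<omega> (arc_inv (ref x)) = - orientation_chain \<Sigma> \<omega> (ref x)"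
      unfolding val[OF x] using on[of x] off[of x] by (cases "x \<in> C") auto
  qed
  show "\<bar>orientation_chain \<Sigma> \<omega> (ref x)\<bar> = 1" if "x \<in> C" for x
  proof -
    have "x \<in> edges \<Sigma>" using that C by blast
    then show ?thesis unfolding val[OF \<open>x \<in> edges \<Sigma>\<close>] using on[OF that] by auto
  qed
  show "orientation_chain \<Sigma> \<omega> (ref x) = 0" if "x \<in> edges \<Sigma> - C" for x
    using that val(1)[of x] off[of x] by simp
qed

end

section \<open>Counting coordinates and assembling the decomposition\<close>

context based
begin

text \<open>A tree has one edge less than vertices, and exactly the unbalanced components receive an
  extra edge.\<close>

lemma card_component_base:
  assumes "\<Gamma> \<in> components \<Sigma>"
  shows "card (D \<Gamma>) + (if balanced \<Gamma> then 1 else 0) = card (verts \<Gamma>)"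
proof (rule component_base_cases[OF assms base[OF assms]])
  fix T assume "tree T (verts \<Gamma>)" "balanced \<Gamma>" "D \<Gamma> = T"
  then show ?thesis using tree_card by simp
next
  fix T b assume T: "tree T (verts \<Gamma>)" "\<not> balanced \<Gamma>" "outer_base \<Gamma> (D \<Gamma>) T b"
  then have "b \<notin> T" "D \<Gamma> = insert b T" using treeD(2)[OF T(1)] by (auto simp: outer_base_def)
  then show ?thesis using tree_card[OF T(1)] finite_sub[OF treeD(1)[OF T(1)]] T(2) by simp
next
  fix T b S assume T: "tree T (verts \<Gamma>)" "\<not> balanced \<Gamma>" "negative_base \<Gamma> (D \<Gamma>) T b S"
  then show ?thesis
    using negative_baseD(2,3)[OF T(3)] tree_card[OF T(1)] finite_sub[OF treeD(1)[OF T(1)]] T(2) by simp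
qed

lemma card_base: "card B + num_balanced \<Sigma> = card (verts \<Sigma>)"
proof -
  have "(\<Union>\<Gamma>\<in>components \<Sigma>. verts \<Gamma>) = verts \<Sigma>"
  proof
    show "(\<Union>\<Gamma>\<in>components \<Sigma>. verts \<Gamma>) \<subseteq> verts \<Sigma>" using component_verts(2) by (rule UN_least)
    show "verts \<Sigma> \<subseteq> (\<Union>\<Gamma>\<in>components \<Sigma>. verts \<Gamma>)"
      by (rule subsetI) (rule component_of_vertex, assumption, rule UN_I)
  qed
  moreover have "card (\<Union>\<Gamma>\<in>components \<Sigma>. verts \<Gamma>) = (\<Sum>\<Gamma>\<in>components \<Sigma>. card (verts \<Gamma>))"
  proof (rule card_UN_disjoint[OF finite_components])
    show "\<forall>\<Gamma>\<in>components \<Sigma>. finite (verts \<Gamma>)" using component_verts(4) by blast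
    show "\<forall>\<Gamma>\<in>components \<Sigma>. \<forall>\<Delta>\<in>components \<Sigma>. \<Gamma> \<noteq> \<Delta> \<longrightarrow> verts \<Gamma> \<inter> verts \<Delta> = {}"
      using component_unique by blast
  qed
  moreover have "card B = (\<Sum>\<Gamma>\<in>components \<Sigma>. card (D \<Gamma>))"
    unfolding B_eq
  proof (rule card_UN_disjoint[OF finite_components])
    show "\<forall>\<Gamma>\<in>components \<Sigma>. finite (D \<Gamma>)"
      using D_subset component_edges_subset finite_sub by (meson subset_trans)
    show "\<forall>\<Gamma>\<in>components \<Sigma>. \<forall>\<Delta>\<in>components \<Sigma>. \<Gamma> \<noteq> \<Delta> \<longrightarrow> D \<Gamma> \<inter> D \<Delta> = {}"
      using D_subset component_edge_unique by blast
  qed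
  moreover have "num_balanced \<Sigma> = (\<Sum>\<Gamma>\<in>components \<Sigma>. if balanced \<Gamma> then 1 else 0)"
    using sum.inter_filter[OF finite_components, of "\<lambda>_. 1 :: nat" balanced] by (simp add: num_balanced_def)
  ultimately show ?thesis
    using card_component_base by (simp flip: sum.distrib)
qed

lemma cr_eq: "cr \<Sigma> = int (card (edges \<Sigma> - B))"
proof -
  have "card (edges \<Sigma> - B) + card B = card (edges \<Sigma>)"
    using card_Diff_subset[OF finite_sub[OF B_subset] B_subset] card_mono[OF finite_edges B_subset] by simp
  then show ?thesis using card_base by (simp add: cr_def)
qed

text \<open>Each unbalanced component without outer-edges contributes the one circle of its base,
  and every negative circle in \<open>B\<close> arises from such a component.\<close>

lemma card_N: "card N = u_c \<Sigma>"
proof -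
  let ?U = "{\<Gamma> \<in> components \<Sigma>. \<not> balanced \<Gamma> \<and> outer_edges \<Gamma> = {}}"
  define G where "G = (\<lambda>\<Gamma>. SOME S. \<exists>T b. negative_base \<Gamma> (D \<Gamma>) T b S)"
  have ex: "\<exists>T b. negative_base \<Gamma> (D \<Gamma>) T b (G \<Gamma>)" if U: "\<Gamma> \<in> ?U" for \<Gamma>
  proof -
    have \<Gamma>: "\<Gamma> \<in> components \<Sigma>" using U by simp
    have "\<exists>S T b. negative_base \<Gamma> (D \<Gamma>) T b S"
    proof (rule component_base_cases[OF \<Gamma> base[OF \<Gamma>]])
      fix T b S assume "negative_base \<Gamma> (D \<Gamma>) T b S"
      then show ?thesis by blast
    qed (use U in simp_all)
    then show ?thesis unfolding G_def by (rule someI_ex)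
  qed
  have "bij_betw G ?U N"
  proof (rule bij_betw_imageI)
    show "inj_on G ?U"
    proof (rule inj_onI)
      fix \<Gamma> \<Delta> assume U: "\<Gamma> \<in> ?U" "\<Delta> \<in> ?U" "G \<Gamma> = G \<Delta>"
      obtain T b T' b' where nb: "negative_base \<Gamma> (D \<Gamma>) T b (G \<Gamma>)" "negative_base \<Delta> (D \<Delta>) T' b' (G \<Delta>)"
        using ex[OF U(1)] ex[OF U(2)] by blast
      have "b \<in> edges \<Gamma>" by (rule negative_baseD(1)[OF nb(1)])
      moreover have "b \<in> edges \<Delta>"
        using negative_baseD(4)[OF nb(1)] negative_baseD(6)[OF nb(2)] U D_subset[of \<Delta>] by auto
      ultimately show "\<Gamma> = \<Delta>" using component_edge_unique U by blast
    qed
    show "G ` ?U = N"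
    proof
      show "G ` ?U \<subseteq> N" using ex negative_base_N by blast
      show "N \<subseteq> G ` ?U"
      proof
        fix C assume "C \<in> N"
        then obtain \<Gamma> T where \<Gamma>: "\<Gamma> \<in> components \<Sigma>" "\<not> balanced \<Gamma>" "outer_edges \<Gamma> = {}"
          "negative_base \<Gamma> (D \<Gamma>) T (key C) C" using keyE by metis
        then have U: "\<Gamma> \<in> ?U" by simp
        obtain T' b' where nb: "negative_base \<Gamma> (D \<Gamma>) T' b' (G \<Gamma>)" using ex[OF U] by blast
        have "G \<Gamma> = C"
          by (rule negative_baseD(8)[OF \<Gamma>(4) negative_baseD(6)[OF nb] negative_baseD(7)[OF nb]])
        then show "C \<in> G ` ?U" using U by blast
      qed
    qed
  qed
  then have "card ?U = card N" by (rule bij_betw_same_card)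
  then show ?thesis unfolding u_c_def ..
qed

lemma flow_coordinatesI:
  assumes A: "comm_group A" and \<omega>: "\<And>C. C \<in> N \<Longrightarrow> orientation \<Sigma> C (\<omega> C)"
    and \<delta>: "\<And>e. e \<in> edges \<Sigma> - B \<Longrightarrow> circuit_direction \<Sigma> (base_circuit \<Sigma> B e) (\<delta> e)"
  shows "flow_coordinates \<Sigma> D B A
    (case_sum (\<lambda>C. orientation_chain \<Sigma> (\<omega> C)) (\<lambda>e. circuit_flow \<Sigma> (base_circuit \<Sigma> B e) (\<delta> e)))"
proof -
  interpret A: comm_group A by fact
  have NE: "C \<subseteq> edges \<Sigma>" if "C \<in> N" for C using that by (auto simp: N_def negative_circles_iff)
  note oc = orientation_chain_values[OF \<omega> NE]
  show ?thesis
  proof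
    fix i assume i: "i \<in> N <+> (edges \<Sigma> - B)"
    show "antisym_chain (case_sum (\<lambda>C. orientation_chain \<Sigma> (\<omega> C)) (\<lambda>e. circuit_flow \<Sigma> (base_circuit \<Sigma> B e) (\<delta> e)) i)"
    proof (cases i)
      case (Inl C)
      then have "C \<in> N" using i by auto
      then show ?thesis using oc(1) Inl by simp
    next
      case (Inr e)
      then have e: "e \<in> edges \<Sigma> - B" using i by auto
      obtain s where "\<And>x. x \<in> edges \<Sigma> \<Longrightarrow> circuit_flow \<Sigma> (base_circuit \<Sigma> B e) (\<delta> e) (ref x) = s * fund e x"
        "\<And>x. x \<in> edges \<Sigma> \<Longrightarrow> circuit_flow \<Sigma> (base_circuit \<Sigma> B e) (\<delta> e) (arc_inv (ref x)) = - (s * fund e x)"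
        using circuit_flow_fund[OF e \<delta>[OF e]] by metis
      then show ?thesis using Inr by (simp add: antisym_chain_def)
    qed
  next
    fix e assume e: "e \<in> edges \<Sigma> - B"
    obtain s where "s = 1 \<or> s = -1"
      "\<And>x. x \<in> edges \<Sigma> \<Longrightarrow> circuit_flow \<Sigma> (base_circuit \<Sigma> B e) (\<delta> e) (ref x) = s * fund e x"
      using circuit_flow_fund[OF e \<delta>[OF e]] by metis
    then show "\<exists>s\<in>{1, -1}. \<forall>x\<in>edges \<Sigma>.
        case_sum (\<lambda>C. orientation_chain \<Sigma> (\<omega> C)) (\<lambda>e. circuit_flow \<Sigma> (base_circuit \<Sigma> B e) (\<delta> e)) (Inr e) (ref x) =
        s * fund e x"
      by auto
  qed (use oc(2,3) in auto)
qed

theorem flow_group_decomposition: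
  assumes A: "comm_group A" and \<omega>: "\<And>C. C \<in> N \<Longrightarrow> orientation \<Sigma> C (\<omega> C)"
    and \<delta>: "\<And>e. e \<in> edges \<Sigma> - B \<Longrightarrow> circuit_direction \<Sigma> (base_circuit \<Sigma> B e) (\<delta> e)"
  shows "internal_direct_sum (flow_group \<Sigma> A) (N <+> (edges \<Sigma> - B))
      (case_sum
        (\<lambda>C. multiples \<Sigma> A (tor2 A) (orientation_chain \<Sigma> (\<omega> C)))
        (\<lambda>e. multiples \<Sigma> A (carrier A) (circuit_flow \<Sigma> (base_circuit \<Sigma> B e) (\<delta> e))))"
    and "flow_group \<Sigma> A \<cong> product_group {..<u_c \<Sigma>} (\<lambda>_. A\<lparr>carrier := tor2 A\<rparr>)
      \<times>\<times> product_group {..<nat (cr \<Sigma>)} (\<lambda>_. A)"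
proof -
  interpret flow_coordinates \<Sigma> D B A
    "case_sum (\<lambda>C. orientation_chain \<Sigma> (\<omega> C)) (\<lambda>e. circuit_flow \<Sigma> (base_circuit \<Sigma> B e) (\<delta> e))"
    by (rule flow_coordinatesI[OF assms])
  have eq: "(\<lambda>i. (\<lambda>h. scale_chain \<Sigma> A h
        (case_sum (\<lambda>C. orientation_chain \<Sigma> (\<omega> C)) (\<lambda>e. circuit_flow \<Sigma> (base_circuit \<Sigma> B e) (\<delta> e)) i)) ` carrier (coeff i)) =
      case_sum
        (\<lambda>C. multiples \<Sigma> A (tor2 A) (orientation_chain \<Sigma> (\<omega> C)))
        (\<lambda>e. multiples \<Sigma> A (carrier A) (circuit_flow \<Sigma> (base_circuit \<Sigma> B e) (\<delta> e)))"
    by (rule ext) (simp add: multiples_def coeff_def split: sum.split)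
  show "internal_direct_sum (flow_group \<Sigma> A) (N <+> (edges \<Sigma> - B))
      (case_sum
        (\<lambda>C. multiples \<Sigma> A (tor2 A) (orientation_chain \<Sigma> (\<omega> C)))
        (\<lambda>e. multiples \<Sigma> A (carrier A) (circuit_flow \<Sigma> (base_circuit \<Sigma> B e) (\<delta> e))))"
    using direct_sum(1) unfolding eq .
  have "group (product_group idx coeff)" using coeff_group by simp
  then have "flow_group \<Sigma> A \<cong> product_group idx coeff"
    using direct_sum(2) group.iso_sym by blast
  also have "product_group idx coeff \<cong> product_group {..<card N} (\<lambda>_. A\<lparr>carrier := tor2 A\<rparr>)
      \<times>\<times> product_group {..<card (edges \<Sigma> - B)} (\<lambda>_. A)"
    unfolding coeff_def using finite_N finite_edges by (intro product_group_Plus_iso) auto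
  also have "card N = u_c \<Sigma>" by (rule card_N)
  also have "card (edges \<Sigma> - B) = nat (cr \<Sigma>)" by (simp add: cr_eq)
  finally show "flow_group \<Sigma> A \<cong> product_group {..<u_c \<Sigma>} (\<lambda>_. A\<lparr>carrier := tor2 A\<rparr>)
      \<times>\<times> product_group {..<nat (cr \<Sigma>)} (\<lambda>_. A)" .
qed

end

theorem theorem5p1:
  fixes \<Sigma> :: "('v, 'e) sgraph" and A :: "('a, 'm) monoid_scheme" and B :: "'e set"
  assumes "signed_graph \<Sigma>" and "comm_group A" and "canonical_base \<Sigma> B"
  shows "(\<forall>\<omega> \<delta>.
            (\<forall>C \<in> {C \<in> negative_circles \<Sigma>. C \<subseteq> B}. orientation \<Sigma> C (\<omega> C)) \<longrightarrow>
            (\<forall>e \<in> edges \<Sigma> - B. circuit_direction \<Sigma> (base_circuit \<Sigma> B e) (\<delta> e)) \<longrightarrow>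
            internal_direct_sum (flow_group \<Sigma> A)
              ({C \<in> negative_circles \<Sigma>. C \<subseteq> B} <+> (edges \<Sigma> - B))
              (case_sum
                (\<lambda>C. multiples \<Sigma> A (tor2 A) (orientation_chain \<Sigma> (\<omega> C)))
                (\<lambda>e. multiples \<Sigma> A (carrier A) (circuit_flow \<Sigma> (base_circuit \<Sigma> B e) (\<delta> e)))))
       \<and> flow_group \<Sigma> A \<cong>
           product_group {..<u_c \<Sigma>} (\<lambda>_. A\<lparr>carrier := tor2 A\<rparr>)
             \<times>\<times> product_group {..<nat (cr \<Sigma>)} (\<lambda>_. A)
       \<and> cr \<Sigma> = int (card (edges \<Sigma> - B))"
proof -
  interpret signed_graph \<Sigma> by fact
  obtain D where D: "\<And>\<Gamma>. \<Gamma> \<in> components \<Sigma> \<Longrightarrow> component_base \<Gamma> (D \<Gamma>)" "B = (\<Union>\<Gamma>\<in>components \<Sigma>. D \<Gamma>)"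
    using assms(3) unfolding canonical_base_def by blast
  interpret based \<Sigma> D B by unfold_locales (use D in auto)
  \<comment> \<open>The isomorphism mentions no orientation or direction, so one admissible choice
    has to be exhibited: reference arcs on the circles and any direction of each circuit.\<close>
  have ref_or: "orientation \<Sigma> C (ref ` C)" if "C \<in> N" for C
    using that by (intro orientation_ref) (auto simp: N_def negative_circles_iff)
  obtain \<delta> where \<delta>: "\<And>e. e \<in> edges \<Sigma> - B \<Longrightarrow> circuit_direction \<Sigma> (base_circuit \<Sigma> B e) (\<delta> e)"
    using direction_exists by metis
  show ?thesis
    unfolding N_def[symmetric]
    using flow_group_decomposition(1)[OF assms(2)] flow_group_decomposition(2)[OF assms(2) ref_or \<delta>] cr_eq
    by (intro conjI allI impI) auto
qed

end
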